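(* Let $0 < n < d$ be integers, let $0 < \delta < 1$, and let $C, C_{F} \geq 1$. Let $\mathcal{V} \subset \mathcal{A}(d,n)$ be a $\delta$-separated set of affine $n$-planes, and let $P \subset B(1) \subset \mathbb{R}^{d}$ be a $\delta$-separated $(\delta,t,C_{F})$-set with $d - n < t \leq d$. For $r > 0$ let $$ \mathcal{I}_{r}(P,\mathcal{V}) = \{(p,V) \in P \times \mathcal{V} : p \in V(r)\}. $$ Then, for every $\varepsilon > 0$, $$ |\mathcal{I}_{C\delta}(P,\mathcal{V})| \leq K \cdot \delta^{-\varepsilon} \cdot C_{F} \cdot |P| \cdot |\mathcal{V}|^{n/(d+n-t)} \cdot \delta^{n(t+1-d)(d-n)/(d+n-t)}, $$ where the constant $K > 0$ depends only on $C,d,\varepsilon,t$.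
   Context: $|\cdot|$ denotes cardinality for finite sets. $B(1)$ is the closed unit ball centred at $0$ in $\mathbb{R}^{d}$. For $A \subset \mathbb{R}^{d}$ and $r > 0$, $A(r) := \{x \in \mathbb{R}^{d} : \operatorname{dist}(x,A) \leq r\}$. $\mathcal{A}(d,n)$ is the set of all affine $n$-planes in $\mathbb{R}^{d}$ with the metric $d_{\mathcal{A}}(V,W) := \|\pi_{V_{0}} - \pi_{W_{0}}\|_{op} + |a - b|$, where $V = V_{0} + a$, $W = W_{0} + b$ with $V_{0},W_{0}$ linear $n$-dimensional subspaces, $a \in V_{0}^{\perp}$, $b \in W_{0}^{\perp}$, and $\pi_{V_0}$ denotes orthogonal projection onto $V_0$. $(\delta,s,C)$-sets: for $0 \leq s < \infty$, $0 < \delta < 1$ and $C > 0$, a bounded subset $P$ of a metric space $X$ is a $(\delta,s,C)$-set if $|P \cap B|_{\delta} \leq C \cdot |P|_{\delta} \cdot r^{s}$ for every $\delta \leq r \leq 1$ and every ball $B \subset X$ of radius $r$, where $|A|_{\delta}$ denotes the minimal number of $\delta$-balls needed to cover $A$ ($:= \infty$ if no finite cover exists). *)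

theory Defs
  imports "HOL-Analysis.Analysis"
begin

definition neighbourhood :: "'a::metric_space set \<Rightarrow> real \<Rightarrow> 'a set"
  where "neighbourhood A r = {x. infdist x A \<le> r}"

definition orth_proj :: "'a::euclidean_space set \<Rightarrow> 'a \<Rightarrow> 'a"
  where "orth_proj U x = (THE y. y \<in> U \<and> x - y \<in> U\<^sup>\<bottom>)"

definition affine_planes :: "nat \<Rightarrow> 'a::euclidean_space set set"
  where "affine_planes n = {V. affine V \<and> aff_dim V = int n}"

text \<open>Every affine plane has a unique representation \<open>V = V\<^sub>0 + a\<close> with \<open>V\<^sub>0\<close> a linear
  subspace and \<open>a\<close> orthogonal to \<open>V\<^sub>0\<close>; the next two definitions extract \<open>V\<^sub>0\<close> and \<open>a\<close>.
  See \<open>affine_planes_repr\<close> and \<open>plane_dist_repr\<close> below.\<close>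

definition plane_direction :: "'a::euclidean_space set \<Rightarrow> 'a set"
  where "plane_direction V = {x - y | x y. x \<in> V \<and> y \<in> V}"

definition plane_offset :: "'a::euclidean_space set \<Rightarrow> 'a"
  where "plane_offset V = (THE a. a \<in> V \<and> a \<in> (plane_direction V)\<^sup>\<bottom>)"

definition plane_dist :: "'a::euclidean_space set \<Rightarrow> 'a set \<Rightarrow> real"
  where "plane_dist V W =
    onorm (\<lambda>x. orth_proj (plane_direction V) x - orth_proj (plane_direction W) x)
      + norm (plane_offset V - plane_offset W)"

definition delta_separated :: "('b \<Rightarrow> 'b \<Rightarrow> real) \<Rightarrow> real \<Rightarrow> 'b set \<Rightarrow> bool"
  where "delta_separated D \<delta> S \<longleftrightarrow> (\<forall>x\<in>S. \<forall>y\<in>S. x \<noteq> y \<longrightarrow> \<delta> \<le> D x y)"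

text \<open>Balls are closed. The infimum over the empty family is \<open>\<infinity>\<close>, so the covering
  number of a set without finite cover is \<open>\<infinity>\<close>.\<close>

definition covering_number :: "real \<Rightarrow> 'a::metric_space set \<Rightarrow> ennreal"
  where "covering_number \<delta> A =
    (INF F \<in> {F. finite F \<and> A \<subseteq> (\<Union>x\<in>F. cball x \<delta>)}. of_nat (card F))"

text \<open>Intended for \<open>0 \<le> s\<close>, \<open>0 < \<delta> < 1\<close> and \<open>0 < C\<close>.\<close>

definition delta_s_set :: "real \<Rightarrow> real \<Rightarrow> real \<Rightarrow> 'a::metric_space set \<Rightarrow> bool"
  where "delta_s_set \<delta> s C P \<longleftrightarrow> bounded P \<and>
    (\<forall>r x. \<delta> \<le> r \<and> r \<le> 1 \<longrightarrow>
      covering_number \<delta> (P \<inter> cball x r)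
        \<le> ennreal C * covering_number \<delta> P * ennreal (r powr s))"

definition incidences :: "real \<Rightarrow> 'a::metric_space set \<Rightarrow> 'a set set \<Rightarrow> ('a \<times> 'a set) set"
  where "incidences r P \<V> = {(p, V). p \<in> P \<and> V \<in> \<V> \<and> p \<in> neighbourhood V r}"

lemma orth_proj_eqI:
  assumes "subspace U" "y \<in> U" "x - y \<in> U\<^sup>\<bottom>"
  shows "orth_proj U x = y"
  unfolding orth_proj_def
proof (rule the_equality)
  fix z assume z: "z \<in> U \<and> x - z \<in> U\<^sup>\<bottom>"
  have "z - y \<in> U" using z assms by (simp add: subspace_diff)
  moreover have "z - y \<in> U\<^sup>\<bottom>"
    using subspace_diff[OF subspace_orthogonal_comp assms(3), of "x - z"] z by simp
  ultimately have "orthogonal (z - y) (z - y)" by (auto simp: orthogonal_comp_def)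
  then show "z = y" by (simp add: orthogonal_self)
qed (use assms in auto)

lemma orth_proj_props:
  assumes "subspace U"
  shows "orth_proj U x \<in> U" "x - orth_proj U x \<in> U\<^sup>\<bottom>"
proof -
  have "x \<in> U + U\<^sup>\<bottom>" using subspace_sum_orthogonal_comp[OF assms] by simp
  then obtain y z where "x = y + z" "y \<in> U" "z \<in> U\<^sup>\<bottom>" by (rule set_plus_elim)
  then have "y \<in> U" "x - y \<in> U\<^sup>\<bottom>" by auto
  with orth_proj_eqI[OF assms this] show "orth_proj U x \<in> U" "x - orth_proj U x \<in> U\<^sup>\<bottom>" by auto
qed

lemma plane_direction_translate:
  assumes "subspace U"
  shows "plane_direction ((+) a ` U) = U"
proof
  show "plane_direction ((+) a ` U) \<subseteq> U"
    using assms by (auto simp: plane_direction_def subspace_diff)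
  show "U \<subseteq> plane_direction ((+) a ` U)"
  proof
    fix u assume "u \<in> U"
    moreover have "u = (a + u) - (a + 0)" "0 \<in> U" using assms by (auto simp: subspace_0)
    ultimately show "u \<in> plane_direction ((+) a ` U)"
      unfolding plane_direction_def by blast
  qed
qed

lemma plane_offset_translate:
  assumes "subspace U" "a \<in> U\<^sup>\<bottom>"
  shows "plane_offset ((+) a ` U) = a"
  unfolding plane_offset_def plane_direction_translate[OF assms(1)]
proof (rule the_equality)
  show "a \<in> (+) a ` U \<and> a \<in> U\<^sup>\<bottom>"
    using assms subspace_0[OF assms(1)] by (auto intro: image_eqI[of _ _ 0])
next
  fix b assume b: "b \<in> (+) a ` U \<and> b \<in> U\<^sup>\<bottom>"
  then obtain u where u: "u \<in> U" "b = a + u" by auto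
  have "b - a \<in> U\<^sup>\<bottom>" using b assms by (simp add: subspace_diff subspace_orthogonal_comp)
  with u have "orthogonal u u" by (auto simp: orthogonal_comp_def)
  with u show "b = a" by (simp add: orthogonal_self)
qed

lemma plane_dist_repr:
  assumes "subspace V0" "subspace W0" "a \<in> V0\<^sup>\<bottom>" "b \<in> W0\<^sup>\<bottom>"
  shows "plane_dist ((+) a ` V0) ((+) b ` W0)
    = onorm (\<lambda>x. orth_proj V0 x - orth_proj W0 x) + norm (a - b)"
  using assms by (simp add: plane_dist_def plane_direction_translate plane_offset_translate)

lemma affine_planes_repr:
  "affine_planes n = {(+) a ` V0 | a V0. subspace V0 \<and> dim V0 = n \<and> a \<in> V0\<^sup>\<bottom>}" (is "?L = ?R")
proof
  show "?R \<subseteq> ?L"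
    by (auto simp: affine_planes_def affine_translation[symmetric] subspace_imp_affine
        aff_dim_translation_eq aff_dim_subspace)
  show "?L \<subseteq> ?R"
  proof
    fix V :: "'a set" assume "V \<in> ?L"
    then have V: "affine V" "aff_dim V = int n" by (auto simp: affine_planes_def)
    then have "V \<noteq> {}" by auto
    then obtain v where "v \<in> V" by blast
    define U where "U = (\<lambda>x. (- v) + x) ` V"
    have U: "subspace U" "V = (+) v ` U"
      using affine_diffs_subspace[OF V(1) \<open>v \<in> V\<close>] by (auto simp: U_def image_image)
    define a where "a = v - orth_proj U v"
    have a: "a \<in> U\<^sup>\<bottom>" and p: "orth_proj U v \<in> U"
      using orth_proj_props[OF U(1)] by (auto simp: a_def)
    have "V = (+) a ` U"
    proof -
      have "(+) (orth_proj U v) ` U = U"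
      proof
        show "(+) (orth_proj U v) ` U \<subseteq> U" using p U(1) by (auto intro: subspace_add)
        show "U \<subseteq> (+) (orth_proj U v) ` U"
        proof
          fix u assume "u \<in> U"
          then have "u - orth_proj U v \<in> U" using p U(1) by (auto intro: subspace_diff)
          then show "u \<in> (+) (orth_proj U v) ` U" by (intro image_eqI) auto
        qed
      qed
      then have "V = (+) a ` ((+) (orth_proj U v) ` U)"
        unfolding image_image U(2) by (simp add: a_def add.assoc[symmetric])
      with \<open>(+) (orth_proj U v) ` U = U\<close> show ?thesis by simp
    qed
    moreover have "dim U = n"
      using V(2) U by (simp add: aff_dim_translation_eq aff_dim_subspace)
    ultimately show "V \<in> ?R" using U(1) a by blast
  qed
qed

end

theory Submission
  imports Defs "HOL-Probability.Probability"
begin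

text \<open>
  Write \<open>d\<close> for the dimension of the space and \<open>m = d - n\<close>. After splitting the planes into finitely
  many classes, every plane is a graph \<open>x\<^sub>k = b\<^sub>k + \<Sum>\<^sub>i A\<^sub>k\<^sub>i x\<^sub>i\<close> with bounded slopes over a fixed
  set \<open>I\<close> of \<open>n\<close> coordinates (\<open>affine_plane_is_graph\<close>), and \<open>\<delta>\<close>-separated planes have separated
  parameters \<open>(b, A)\<close> (\<open>plane_dist_graph_le\<close>). The parameter space has dimension \<open>m (n + 1)\<close> and
  carries Lebesgue measure in \<open>b\<close> and Gaussian measure in \<open>A\<close>. Let \<open>F \<theta>\<close> be the sum over \<open>p \<in> P\<close> of
  Gaussians of width \<open>\<delta>\<close> in the vertical distances from \<open>p\<close> to the plane with parameter \<open>\<theta>\<close>. Then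
  \<open>\<delta>\<^sup>m F\<close> dominates the number of points near each plane that is \<open>\<delta>\<close>-close to \<open>\<theta>\<close>, so the
  incidences are controlled by the integral of \<open>F\<close> over the union of disjoint cubes of side about \<open>\<delta>\<close>
  around the given parameters. The volume \<open>e\<close> of this union is about \<open>card \<V>\<close> times \<open>\<delta>\<close> to the power
  \<open>m (n + 1)\<close>.

  This integral is estimated by splitting \<open>F\<close> at a scale \<open>\<rho>\<close> into a low and a high part. Widening a
  Gaussian is a shift of its variance \<open>s\<close>. The high part is the \<open>N\<close>-th difference of \<open>F\<close> in \<open>s\<close> with
  step \<open>\<rho>\<^sup>2\<close>, and the low part is the rest, a combination of the same sums at variances of order
  \<open>\<rho>\<^sup>2\<close>. Put \<open>B\<close> for a constant times \<open>C\<^sub>F card P\<close>.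

  Up to constant factors, the two parts are bounded as follows.

  \<^item> The low part is at most \<open>B \<rho> powr (t - d)\<close> pointwise: inside the unit ball the
  \<open>\<rho>\<close>-neighbourhood of a plane is covered by about \<open>\<rho> powr (- n)\<close> balls of radius \<open>\<rho>\<close>, each with at
  most \<open>B \<rho> powr t\<close> points, and the Gaussians have height about \<open>\<rho> powr (- m)\<close> (\<open>profile_le\<close>).

  \<^item> The high part has squared \<open>L\<^sup>2\<close> norm at most \<open>B\<^sup>2 \<rho> powr (t - m)\<close>. The average over all planes
  of the product of the Gaussians of two points \<open>p\<close> and \<open>q\<close>, with variances \<open>s\<close> and \<open>s'\<close>, is a
  Gaussian in the vertical part of \<open>p - q\<close>, whose variance is \<open>s + s'\<close> plus the squared horizontal
  distance (\<open>nn_integral_bump_mult\<close>). At distances from \<open>\<delta>\<close> on it is at most about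
  \<open>\<bar>p - q\<bar> powr (- m)\<close>, and differences in \<open>s\<close> multiply this by an arbitrarily high power of
  \<open>\<rho> / \<bar>p - q\<bar>\<close> (\<open>fdiff_heat_kernel_bound\<close>). The resulting kernel is concentrated at distances up to
  \<open>\<rho>\<close>, and summing it over a Frostman set of exponent \<open>t > m\<close> gives the bound (\<open>potential_bound\<close>).

  Hence the integral is at most about \<open>B (e \<rho> powr (t - d) + \<rho> powr n)\<close> (\<open>weighted_cubes_bound\<close>), and
  \<open>\<rho> = e powr (1 / (d + n - t))\<close> balances the two terms (\<open>incidence_bound_graphs\<close>). If this scale is
  below \<open>\<delta>\<close>, the pointwise bound at scale \<open>\<delta>\<close> alone suffices.
\<close>

section \<open>Gaussian averages in one coordinate\<close>

text \<open>The parameter is the variance because variances add up in every integration below.\<close>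

definition gauss :: "real \<Rightarrow> real \<Rightarrow> real"
  where "gauss s = normal_density 0 (sqrt s)"

lemma gauss_eq: "s > 0 \<Longrightarrow> gauss s x = exp (- x\<^sup>2 / (2 * s)) / sqrt (2 * pi * s)"
  by (simp add: gauss_def normal_density_def)

lemma gauss_pos: "s > 0 \<Longrightarrow> gauss s x > 0"
  by (simp add: gauss_def normal_density_pos)

lemma gauss_measurable [measurable]: "gauss s \<in> borel_measurable borel"
  unfolding gauss_def by simp

lemma gauss_minus: "gauss s (- x) = gauss s x"
  by (simp add: gauss_def normal_density_def)

text \<open>Convolution of two centred Gaussians: averaging over the offset of a plane adds the variances.\<close>

lemma nn_integral_gauss_mult:
  assumes "s > 0" "s' > 0"
  shows "(\<integral>\<^sup>+b. ennreal (gauss s (x - b) * gauss s' (y - b)) \<partial>lborel) = ennreal (gauss (s + s') (x - y))"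
proof -
  have "(\<integral>\<^sup>+b. ennreal (gauss s (x - b) * gauss s' (y - b)) \<partial>lborel)
      = (\<integral>\<^sup>+b. ennreal (gauss s (x - (y + 1 * b)) * gauss s' (y - (y + 1 * b))) \<partial>lborel)"
    by (subst nn_integral_real_affine[where c=1 and t=y]) simp_all
  also have "\<dots> = (\<integral>\<^sup>+b. ennreal (gauss s ((x - y) - b) * gauss s' b) \<partial>lborel)"
    by (simp add: gauss_minus algebra_simps)
  also have "\<dots> = ennreal (gauss (s + s') (x - y))"
    using assms conv_normal_density_zero_mean[of "sqrt s" "sqrt s'", THEN fun_cong, of "x - y"]
    by (simp add: gauss_def)
  finally show ?thesis .
qed

abbreviation std_gauss :: "real measure"
  where "std_gauss \<equiv> density lborel std_normal_density"

text \<open>For a standard Gaussian slope \<open>a\<close>, the product \<open>a \<sigma>\<close> is centred normal with variance \<open>\<sigma>\<^sup>2\<close>. Averaging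
  over the slope therefore turns the horizontal distance \<open>\<sigma>\<close> into additional variance.\<close>

lemma nn_integral_gauss_slope:
  assumes "s > 0"
  shows "(\<integral>\<^sup>+a. ennreal (gauss s (w - a * \<sigma>)) \<partial>std_gauss) = ennreal (gauss (s + \<sigma>\<^sup>2) w)"
proof (cases "\<sigma> = 0")
  case True
  interpret prob_space std_gauss by (rule prob_space_normal_density) simp
  show ?thesis using True emeasure_space_1 by simp
next
  case False
  have n: "std_normal_density a = \<bar>\<sigma>\<bar> * gauss (\<sigma>\<^sup>2) (a * \<sigma>)" for a
    using False by (simp add: gauss_def normal_density_def power_mult_distrib real_sqrt_mult)
  have "(\<integral>\<^sup>+a. ennreal (gauss s (w - a * \<sigma>)) \<partial>std_gauss)
      = (\<integral>\<^sup>+a. ennreal \<bar>\<sigma>\<bar> * ennreal (gauss s (w - (0 + \<sigma> * a)) * gauss (\<sigma>\<^sup>2) (0 - (0 + \<sigma> * a))) \<partial>lborel)"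
    using assms False
    by (subst nn_integral_density)
       (auto simp: n ennreal_mult'[symmetric] mult_ac gauss_minus less_imp_le[OF gauss_pos] intro!: nn_integral_cong)
  also have "\<dots> = ennreal \<bar>\<sigma>\<bar> * (\<integral>\<^sup>+a. ennreal (gauss s (w - (0 + \<sigma> * a)) * gauss (\<sigma>\<^sup>2) (0 - (0 + \<sigma> * a))) \<partial>lborel)"
    by (rule nn_integral_cmult) measurable
  also have "\<dots> = (\<integral>\<^sup>+b. ennreal (gauss s (w - b) * gauss (\<sigma>\<^sup>2) (0 - b)) \<partial>lborel)"
    using False by (subst (2) nn_integral_real_affine[where c=\<sigma> and t=0]) simp_all
  finally show ?thesis using nn_integral_gauss_mult[of s "\<sigma>\<^sup>2" w 0] assms False by simp
qed

lemma nn_integral_gauss_slopes: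
  fixes I :: "'i set"
  assumes "finite I" "s > 0"
  shows "(\<integral>\<^sup>+a. ennreal (gauss s (w - (\<Sum>i\<in>I. a i * \<sigma> i))) \<partial>(PiM I (\<lambda>_. std_gauss)))
    = ennreal (gauss (s + (\<Sum>i\<in>I. (\<sigma> i)\<^sup>2)) w)"
  using assms
proof (induction I arbitrary: s rule: finite_induct)
  case empty
  interpret prob_space "PiM ({}::'i set) (\<lambda>_. std_gauss)"
    by (intro prob_space_PiM prob_space_normal_density) simp
  show ?case using emeasure_space_1 by simp
next
  case (insert i I)
  interpret product_sigma_finite "\<lambda>_::'i. std_gauss"
    by (intro product_sigma_finite.intro prob_space_imp_sigma_finite prob_space_normal_density) simp
  have upd: "(\<Sum>j\<in>insert i I. (x(i := y)) j * \<sigma> j) = y * \<sigma> i + (\<Sum>j\<in>I. x j * \<sigma> j)"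
    for x :: "'i \<Rightarrow> real" and y
    using insert.hyps by (auto intro!: sum.cong)
  have "(\<integral>\<^sup>+a. ennreal (gauss s (w - (\<Sum>j\<in>insert i I. a j * \<sigma> j))) \<partial>(PiM (insert i I) (\<lambda>_. std_gauss)))
      = (\<integral>\<^sup>+x. (\<integral>\<^sup>+y. ennreal (gauss s (w - (\<Sum>j\<in>insert i I. (x(i := y)) j * \<sigma> j))) \<partial>std_gauss)
          \<partial>(PiM I (\<lambda>_. std_gauss)))"
    using insert.hyps
    by (intro product_nn_integral_insert) (auto intro!: measurable_compose[OF _ gauss_measurable])
  also have "\<dots> = (\<integral>\<^sup>+x. (\<integral>\<^sup>+y. ennreal (gauss s ((w - (\<Sum>j\<in>I. x j * \<sigma> j)) - y * \<sigma> i)) \<partial>std_gauss)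
          \<partial>(PiM I (\<lambda>_. std_gauss)))"
    unfolding upd by (simp add: algebra_simps)
  also have "\<dots> = (\<integral>\<^sup>+x. ennreal (gauss (s + (\<sigma> i)\<^sup>2) (w - (\<Sum>j\<in>I. x j * \<sigma> j))) \<partial>(PiM I (\<lambda>_. std_gauss)))"
    by (simp only: nn_integral_gauss_slope[OF insert.prems])
  also have "\<dots> = ennreal (gauss (s + (\<sigma> i)\<^sup>2 + (\<Sum>j\<in>I. (\<sigma> j)\<^sup>2)) w)"
    using insert.prems by (intro insert.IH add_pos_nonneg) auto
  finally show ?case using insert.hyps by (simp add: add_ac)
qed

section \<open>Differences of the heat kernel in the variance\<close>

text \<open>The operator \<open>1 - T\<close>, where \<open>T\<close> shifts the variance by \<open>\<eta>\<close>. A shift of the variance is a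
  convolution with a Gaussian of width \<open>sqrt \<eta>\<close>, so the powers of \<open>1 - T\<close> are high-pass filters of
  increasing order at this scale.\<close>

definition fdiff :: "real \<Rightarrow> (real \<Rightarrow> real) \<Rightarrow> real \<Rightarrow> real"
  where "fdiff \<eta> f s = f s - f (s + \<eta>)"

lemma fdiff_funpow_Suc:
  "(fdiff \<eta> ^^ Suc N) f s = (fdiff \<eta> ^^ N) f s - (fdiff \<eta> ^^ N) f (s + \<eta>)"
  by (simp add: fdiff_def)

(* Powers of fdiff are unfolded pointwise by fdiff_funpow_Suc only. *)
declare funpow.simps(2) [simp del]

lemma fdiff_funpow_has_derivative:
  assumes "\<And>s. s > 0 \<Longrightarrow> (f has_real_derivative f' s) (at s)" "\<eta> \<ge> 0" "s > 0"
  shows "((fdiff \<eta> ^^ N) f has_real_derivative (fdiff \<eta> ^^ N) f' s) (at s)"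
  using assms(3)
proof (induction N arbitrary: s)
  case (Suc N)
  have "((\<lambda>x. (fdiff \<eta> ^^ N) f (x + \<eta>)) has_real_derivative (fdiff \<eta> ^^ N) f' (s + \<eta>)) (at s)"
    using Suc.IH[of "s + \<eta>"] Suc.prems assms(2) by (simp add: DERIV_shift)
  then show ?case using DERIV_diff[OF Suc.IH[OF Suc.prems]] by (simp add: fdiff_funpow_Suc)
qed (simp add: assms)

lemma fdiff_funpow_linear:
  "(fdiff \<eta> ^^ N) (\<lambda>s. a * f s + b * g s) = (\<lambda>s. a * (fdiff \<eta> ^^ N) f s + b * (fdiff \<eta> ^^ N) g s)"
  by (induction N) (auto simp: fdiff_funpow_Suc fun_eq_iff algebra_simps)

lemma fdiff_funpow_sum:
  "(fdiff \<eta> ^^ N) (\<lambda>s. \<Sum>i\<in>A. f i s) = (\<lambda>s. \<Sum>i\<in>A. (fdiff \<eta> ^^ N) (f i) s)"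
  by (induction N) (auto simp: fdiff_funpow_Suc fun_eq_iff sum_subtractf)

lemma fdiff_funpow_shift:
  "(fdiff \<eta> ^^ N) (\<lambda>s. f (s + c)) s = (fdiff \<eta> ^^ N) f (s + c)"
  by (induction N arbitrary: s) (auto simp: fdiff_funpow_Suc add_ac)

lemma fdiff_funpow_bound:
  assumes "\<And>x. s \<le> x \<Longrightarrow> \<bar>f x\<bar> \<le> B" "\<eta> \<ge> 0"
  shows "\<bar>(fdiff \<eta> ^^ N) f s\<bar> \<le> 2 ^ N * B"
  using assms(1)
proof (induction N arbitrary: s)
  case (Suc N)
  have "\<bar>(fdiff \<eta> ^^ N) f s\<bar> \<le> 2 ^ N * B" "\<bar>(fdiff \<eta> ^^ N) f (s + \<eta>)\<bar> \<le> 2 ^ N * B"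
    using Suc.prems assms(2) by (intro Suc.IH; force)+
  then show ?case by (simp add: fdiff_funpow_Suc)
qed simp

text \<open>In the expansion of \<open>1 - (1 - T) ^ N\<close> only the shifts by \<open>\<eta>, \<dots>, N \<eta>\<close> survive.\<close>

lemma fdiff_funpow_minus_bound:
  assumes "B \<ge> 0" "\<And>j. 1 \<le> j \<Longrightarrow> j \<le> N \<Longrightarrow> \<bar>f (s + real j * \<eta>)\<bar> \<le> B"
  shows "\<bar>f s - (fdiff \<eta> ^^ N) f s\<bar> \<le> 2 ^ N * B"
proof -
  have *: "\<bar>(fdiff \<eta> ^^ n) f (s + real i * \<eta>)\<bar> \<le> 2 ^ n * B" if "1 \<le> i" "i + n \<le> N" for n i
    using that
  proof (induction n arbitrary: i)
    case (Suc n)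
    from Suc.IH[of i] Suc.IH[of "Suc i"] Suc.prems show ?case
      by (simp add: fdiff_funpow_Suc algebra_simps)
  qed (use assms in auto)
  have "\<bar>f s - (fdiff \<eta> ^^ n) f s\<bar> \<le> (2 ^ n - 1) * B" if "n \<le> N" for n
    using that
  proof (induction n)
    case (Suc n)
    from Suc.IH *[of 1 n] Suc.prems show ?case
      by (simp add: fdiff_funpow_Suc algebra_simps)
  qed simp
  from this[of N] have "\<bar>f s - (fdiff \<eta> ^^ N) f s\<bar> \<le> (2 ^ N - 1) * B" by simp
  moreover have "(2 ^ N - 1) * B \<le> 2 ^ N * B" using assms(1) by (simp add: algebra_simps)
  ultimately show ?thesis by linarith
qed

lemma power_le_exp:
  fixes x :: real
  assumes "x \<ge> 0"
  shows "x ^ k \<le> fact k * exp x"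
proof -
  have "x ^ k /\<^sub>R fact k \<le> (\<Sum>n. x ^ n /\<^sub>R fact n)"
    using sum_le_suminf[of "\<lambda>n. x ^ n /\<^sub>R fact n" "{k}"] summable_exp_generic[of x] assms by simp
  then show ?thesis by (simp add: exp_def field_simps)
qed

text \<open>For \<open>a = m / 2\<close>, \<open>b = 0\<close> and \<open>w = \<bar>x\<bar>\<^sup>2 / 2\<close> this is, up to a constant factor, the Gaussian density
  with variance \<open>s\<close> on \<open>m\<close>-dimensional space. The powers of \<open>w\<close> make the family closed under
  differentiation in \<open>s\<close>.\<close>

definition heat_kernel :: "real \<Rightarrow> nat \<Rightarrow> real \<Rightarrow> real \<Rightarrow> real"
  where "heat_kernel a b w s = s powr (- a) * w ^ b * exp (- w / s)"

lemma heat_kernel_deriv: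
  assumes "s > 0"
  shows "(heat_kernel a b w has_real_derivative
    - a * heat_kernel (a + 1) b w s + 1 * heat_kernel (a + 2) (Suc b) w s) (at s)"
proof -
  have e: "s powr (- a - 1) = s powr (- a) / s" "s powr (- a - 2) = s powr (- a) / s\<^sup>2"
      "s powr (- 1 - a) = s powr (- a) / s" "s powr (- 2 - a) = s powr (- a) / s\<^sup>2"
    using assms by (simp_all add: powr_diff powr_minus powr_numeral field_simps)
  show ?thesis unfolding heat_kernel_def[abs_def]
    using assms by (auto intro!: derivative_eq_intros simp: e field_simps power2_eq_square)
qed

text \<open>With \<open>x = w / s\<close> the claim becomes the boundedness of \<open>x\<^sup>b (1 + x) powr (a - b) exp (- x)\<close>.\<close>

lemma heat_kernel_bound:
  assumes "a \<ge> real b"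
  shows "\<exists>C\<ge>0. \<forall>w\<ge>0. \<forall>s>0. \<bar>heat_kernel a b w s\<bar> \<le> C * (s + w) powr (real b - a)"
proof -
  define k where "k = nat \<lceil>a\<rceil>"
  have k: "a \<le> real k" unfolding k_def by linarith
  have "\<bar>heat_kernel a b w s\<bar> \<le> (fact k * exp 1) * (s + w) powr (real b - a)" if "w \<ge> 0" "s > 0" for w s :: real
  proof -
    define x where "x = w / s"
    have x: "x \<ge> 0" "w = s * x" "s + w = s * (1 + x)" using that by (auto simp: x_def field_simps)
    have "x ^ b * (1 + x) powr (a - real b) \<le> (1 + x) ^ b * (1 + x) powr (a - real b)"
      using x by (intro mult_right_mono power_mono) auto
    also have "\<dots> = (1 + x) powr a" using x by (simp add: powr_realpow[symmetric] powr_add[symmetric])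
    also have "\<dots> \<le> (1 + x) powr (real k)" using x k by (intro powr_mono) auto
    also have "\<dots> \<le> fact k * exp (1 + x)" using x power_le_exp[of "1 + x" k] by (simp add: powr_realpow)
    finally have "x ^ b * (1 + x) powr (a - real b) * exp (- x) \<le> fact k * exp (1 + x) * exp (- x)"
      by (intro mult_right_mono) auto
    then have main: "x ^ b * (1 + x) powr (a - real b) * exp (- x) \<le> fact k * exp 1"
      by (simp add: mult.assoc exp_add[symmetric])
    have "\<bar>heat_kernel a b w s\<bar> = s powr (real b - a) * (x ^ b * exp (- x))"
      using that x(1) unfolding heat_kernel_def x(2)
      by (simp add: power_mult_distrib powr_diff powr_minus powr_realpow field_simps)
    also have "\<dots> = (s powr (real b - a) * (1 + x) powr (real b - a)) * (x ^ b * (1 + x) powr (a - real b) * exp (- x))"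
      using x(1) by (simp add: powr_diff field_simps)
    also have "\<dots> = (s + w) powr (real b - a) * (x ^ b * (1 + x) powr (a - real b) * exp (- x))"
      using that x by (simp add: powr_mult)
    also have "\<dots> \<le> (s + w) powr (real b - a) * (fact k * exp 1)"
      using main by (intro mult_left_mono) auto
    finally show ?thesis by (simp add: mult.commute)
  qed
  then show ?thesis by (intro exI[of _ "fact k * exp 1"]) auto
qed

text \<open>By the mean value theorem a difference is \<open>\<eta>\<close> times a derivative, and a derivative in \<open>s\<close> lowers the
  degree of homogeneity of the kernel in \<open>(s, w)\<close> by one. So \<open>N\<close> differences gain the factor
  \<open>(\<eta> / (s + w)) ^ N\<close>. This is the decay away from the diagonal that a frequency cut-off would give.\<close>

lemma fdiff_heat_kernel_bound:
  assumes "a \<ge> real b"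
  shows "\<exists>C\<ge>0. \<forall>w\<ge>0. \<forall>s>0. \<forall>\<eta>>0.
    \<bar>(fdiff \<eta> ^^ N) (heat_kernel a b w) s\<bar> \<le> C * \<eta> ^ N * (s + w) powr (real b - a - real N)"
  using assms
proof (induction N arbitrary: a b)
  case 0
  then show ?case using heat_kernel_bound[OF 0] by auto
next
  case (Suc N)
  obtain C1 where C1: "C1 \<ge> 0" "\<And>w s \<eta>. w \<ge> 0 \<Longrightarrow> s > 0 \<Longrightarrow> \<eta> > 0 \<Longrightarrow>
    \<bar>(fdiff \<eta> ^^ N) (heat_kernel (a + 1) b w) s\<bar> \<le> C1 * \<eta> ^ N * (s + w) powr (real b - (a + 1) - real N)"
    using Suc.IH[of b "a + 1"] Suc.prems by auto
  obtain C2 where C2: "C2 \<ge> 0" "\<And>w s \<eta>. w \<ge> 0 \<Longrightarrow> s > 0 \<Longrightarrow> \<eta> > 0 \<Longrightarrow>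
    \<bar>(fdiff \<eta> ^^ N) (heat_kernel (a + 2) (Suc b) w) s\<bar> \<le> C2 * \<eta> ^ N * (s + w) powr (real (Suc b) - (a + 2) - real N)"
    using Suc.IH[of "Suc b" "a + 2"] Suc.prems by auto
  have a: "a \<ge> 0" using Suc.prems by linarith
  have "\<bar>(fdiff \<eta> ^^ Suc N) (heat_kernel a b w) s\<bar>
      \<le> (a * C1 + C2) * \<eta> ^ Suc N * (s + w) powr (real b - a - real (Suc N))"
    if w: "w \<ge> 0" and s: "s > 0" and \<eta>: "\<eta> > 0" for w s \<eta> :: real
  proof -
    have triangle: "\<bar>- a * x + 1 * y\<bar> \<le> a * \<bar>x\<bar> + \<bar>y\<bar>" for x y
      using abs_triangle_ineq[of "- (a * x)" y] a by (simp add: abs_mult)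
    (* Both terms of the derivative have degree of homogeneity lower by one than the kernel itself. *)
    let ?f' = "\<lambda>s. - a * heat_kernel (a + 1) b w s + 1 * heat_kernel (a + 2) (Suc b) w s"
    have "\<exists>z>s. z < s + \<eta> \<and> (fdiff \<eta> ^^ N) (heat_kernel a b w) (s + \<eta>) - (fdiff \<eta> ^^ N) (heat_kernel a b w) s
        = (s + \<eta> - s) * (fdiff \<eta> ^^ N) ?f' z"
      using s \<eta> by (intro MVT2 fdiff_funpow_has_derivative heat_kernel_deriv) auto
    then obtain z where z: "z > s" "(fdiff \<eta> ^^ N) (heat_kernel a b w) (s + \<eta>) - (fdiff \<eta> ^^ N) (heat_kernel a b w) s
        = \<eta> * (fdiff \<eta> ^^ N) ?f' z" by auto
    let ?X = "(z + w) powr (real b - a - real (Suc N))"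
    have 1: "\<bar>(fdiff \<eta> ^^ N) (heat_kernel (a + 1) b w) z\<bar> \<le> C1 * \<eta> ^ N * ?X"
      using C1(2)[of w z \<eta>] z w s \<eta> by (simp add: algebra_simps)
    have 2: "\<bar>(fdiff \<eta> ^^ N) (heat_kernel (a + 2) (Suc b) w) z\<bar> \<le> C2 * \<eta> ^ N * ?X"
      using C2(2)[of w z \<eta>] z w s \<eta> by (simp add: algebra_simps)
    have "(fdiff \<eta> ^^ Suc N) (heat_kernel a b w) s = - (\<eta> * (fdiff \<eta> ^^ N) ?f' z)"
      unfolding fdiff_funpow_Suc using z(2) by linarith
    then have "\<bar>(fdiff \<eta> ^^ Suc N) (heat_kernel a b w) s\<bar> = \<eta> * \<bar>(fdiff \<eta> ^^ N) ?f' z\<bar>"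
      by (simp only: abs_minus_cancel abs_mult abs_of_pos[OF \<eta>])
    also have "\<dots> = \<eta> * \<bar>- a * (fdiff \<eta> ^^ N) (heat_kernel (a + 1) b w) z + 1 * (fdiff \<eta> ^^ N) (heat_kernel (a + 2) (Suc b) w) z\<bar>"
      by (subst fdiff_funpow_linear) simp
    also have "\<dots> \<le> \<eta> * (a * \<bar>(fdiff \<eta> ^^ N) (heat_kernel (a + 1) b w) z\<bar> + \<bar>(fdiff \<eta> ^^ N) (heat_kernel (a + 2) (Suc b) w) z\<bar>)"
      using \<eta> by (intro mult_left_mono triangle) auto
    also have "\<dots> \<le> \<eta> * (a * (C1 * \<eta> ^ N * ?X) + C2 * \<eta> ^ N * ?X)"
      using \<eta> a 1 2 by (intro mult_left_mono add_mono) auto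
    also have "\<dots> = (a * C1 + C2) * \<eta> ^ Suc N * ?X" by (simp add: algebra_simps)
    also have "\<dots> \<le> (a * C1 + C2) * \<eta> ^ Suc N * (s + w) powr (real b - a - real (Suc N))"
      using C1(1) C2(1) a \<eta> z s w Suc.prems by (intro mult_left_mono powr_mono2') auto
    finally show ?thesis .
  qed
  then show ?case using a C1(1) C2(1) by (intro exI[of _ "a * C1 + C2"]) auto
qed

lemma fdiff_funpow_cong:
  assumes "\<And>x. s \<le> x \<Longrightarrow> f x = g x" "\<eta> \<ge> 0"
  shows "(fdiff \<eta> ^^ N) f s = (fdiff \<eta> ^^ N) g s"
  using assms(1)
proof (induction N arbitrary: s)
  case (Suc N)
  then show ?case using assms(2) by (simp add: fdiff_funpow_Suc)
qed simp

section \<open>Averages over all graphs\<close>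

text \<open>Offset and slopes of one coordinate function of a graph. On bounded slopes the Gaussian weight is
  comparable to Lebesgue measure; it makes all averages explicit.\<close>

definition row_measure :: "'d set \<Rightarrow> (real \<times> ('d \<Rightarrow> real)) measure"
  where "row_measure I = lborel \<Otimes>\<^sub>M PiM I (\<lambda>_. std_gauss)"

text \<open>A parameter \<open>\<theta>\<close> stands for the graph \<open>x\<^sub>k = b\<^sub>k + \<Sum>\<^sub>i A\<^sub>k\<^sub>i x\<^sub>i\<close> over the coordinates in \<open>I\<close>, where
  \<open>\<theta> k = (b\<^sub>k, A\<^sub>k)\<close> for \<open>k \<notin> I\<close>.\<close>

definition graph_measure :: "'d::finite set \<Rightarrow> ('d \<Rightarrow> real \<times> ('d \<Rightarrow> real)) measure"
  where "graph_measure I = PiM (- I) (\<lambda>_. row_measure I)"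

text \<open>The vertical distance, in the direction of coordinate \<open>k\<close>, from \<open>p\<close> to the graph with parameter \<open>\<theta>\<close>.\<close>

definition defect :: "'d::finite set \<Rightarrow> ('d \<Rightarrow> real \<times> ('d \<Rightarrow> real)) \<Rightarrow> real ^ 'd \<Rightarrow> 'd \<Rightarrow> real"
  where "defect I \<theta> p k = p $ k - fst (\<theta> k) - (\<Sum>i\<in>I. snd (\<theta> k) i * p $ i)"

text \<open>A smooth substitute, of height about \<open>s powr (- m / 2)\<close>, for the indicator that \<open>p\<close> is within
  \<open>sqrt s\<close> of the graph.\<close>

definition bump :: "'d::finite set \<Rightarrow> real ^ 'd \<Rightarrow> real \<Rightarrow> ('d \<Rightarrow> real \<times> ('d \<Rightarrow> real)) \<Rightarrow> real"
  where "bump I p s \<theta> = (\<Prod>k\<in>-I. gauss s (defect I \<theta> p k))"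

definition pair_kernel :: "'d::finite set \<Rightarrow> real ^ 'd \<Rightarrow> real ^ 'd \<Rightarrow> real \<Rightarrow> real"
  where "pair_kernel I p q s = (\<Prod>k\<in>-I. gauss (s + (\<Sum>i\<in>I. (p $ i - q $ i)\<^sup>2)) (p $ k - q $ k))"

lemma bump_nonneg: "s > 0 \<Longrightarrow> bump I p s \<theta> \<ge> 0"
  by (auto simp: bump_def intro!: prod_nonneg less_imp_le[OF gauss_pos])

lemma prob_space_slopes: "prob_space (PiM I (\<lambda>_. std_gauss))"
  by (intro prob_space_PiM prob_space_normal_density) simp

lemma sigma_finite_row: "sigma_finite_measure (row_measure I)"
  unfolding row_measure_def
  by (intro sigma_finite_pair_measure prob_space_imp_sigma_finite prob_space_slopes
      lborel.sigma_finite_measure_axioms)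

lemma row_defect_measurable:
  "(\<lambda>r. x - fst r - (\<Sum>i\<in>I. snd r i * u i)) \<in> borel_measurable (row_measure I)"
proof -
  have [measurable]: "(\<lambda>r. snd r i) \<in> borel_measurable (row_measure I)" if "i \<in> I" for i
  proof -
    have "(\<lambda>a. a i) \<in> borel_measurable (PiM I (\<lambda>_. std_gauss))"
      using measurable_component_singleton[OF that, of "\<lambda>_. std_gauss"] by simp
    then show ?thesis unfolding row_measure_def by (rule measurable_compose[OF measurable_snd])
  qed
  have [measurable]: "fst \<in> borel_measurable (row_measure I)"
    using measurable_fst[of "lborel :: real measure"] by (simp add: row_measure_def)
  show ?thesis by measurable
qed

text \<open>Both points see the same offset and the same slopes. Averaging over the offset leaves a Gaussian in
  the difference of the two defects, and averaging over the slopes adds the squared horizontal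
  distance of the points to its variance.\<close>

lemma nn_integral_row:
  assumes "finite I" "s > 0" "s' > 0"
  shows "(\<integral>\<^sup>+r. ennreal (gauss s (x - fst r - (\<Sum>i\<in>I. snd r i * u i))
      * gauss s' (y - fst r - (\<Sum>i\<in>I. snd r i * v i))) \<partial>row_measure I)
    = ennreal (gauss (s + s' + (\<Sum>i\<in>I. (u i - v i)\<^sup>2)) (x - y))" (is "integral\<^sup>N _ ?f = _")
proof -
  interpret pair_sigma_finite "lborel :: real measure" "PiM I (\<lambda>_. std_gauss)"
    by (intro pair_sigma_finite.intro prob_space_imp_sigma_finite prob_space_slopes
      lborel.sigma_finite_measure_axioms)
  have meas: "?f \<in> borel_measurable (lborel \<Otimes>\<^sub>M PiM I (\<lambda>_. std_gauss))"
    using row_defect_measurable[where I = I] unfolding row_measure_def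
    by (intro measurable_compose[OF _ measurable_ennreal] borel_measurable_times measurable_compose[OF _ gauss_measurable])
  have "integral\<^sup>N (row_measure I) ?f = (\<integral>\<^sup>+a. (\<integral>\<^sup>+b. ?f (b, a) \<partial>lborel) \<partial>PiM I (\<lambda>_. std_gauss))"
    unfolding row_measure_def by (rule nn_integral_snd[OF meas, symmetric])
  also have "\<dots> = (\<integral>\<^sup>+a. ennreal (gauss (s + s') ((x - y) - (\<Sum>i\<in>I. a i * (u i - v i)))) \<partial>PiM I (\<lambda>_. std_gauss))"
  proof (rule nn_integral_cong)
    fix a :: "'a \<Rightarrow> real"
    have "(\<integral>\<^sup>+b. ?f (b, a) \<partial>lborel)
        = (\<integral>\<^sup>+b. ennreal (gauss s ((x - (\<Sum>i\<in>I. a i * u i)) - b) * gauss s' ((y - (\<Sum>i\<in>I. a i * v i)) - b)) \<partial>lborel)"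
      by (simp add: algebra_simps)
    also have "\<dots> = ennreal (gauss (s + s') ((x - (\<Sum>i\<in>I. a i * u i)) - (y - (\<Sum>i\<in>I. a i * v i))))"
      using assms by (intro nn_integral_gauss_mult) auto
    finally show "(\<integral>\<^sup>+b. ?f (b, a) \<partial>lborel) = ennreal (gauss (s + s') ((x - y) - (\<Sum>i\<in>I. a i * (u i - v i))))"
      by (simp add: right_diff_distrib sum_subtractf algebra_simps)
  qed
  also have "\<dots> = ennreal (gauss (s + s' + (\<Sum>i\<in>I. (u i - v i)\<^sup>2)) (x - y))"
    using assms by (intro nn_integral_gauss_slopes) auto
  finally show ?thesis .
qed

lemma product_sigma_finite_row: "product_sigma_finite (\<lambda>_. row_measure I)"
  by (intro product_sigma_finite.intro sigma_finite_row)

lemma defect_measurable [measurable]: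
  assumes "k \<in> - I"
  shows "(\<lambda>\<theta>. defect I \<theta> p k) \<in> borel_measurable (graph_measure I)"
  using assms unfolding defect_def graph_measure_def
  by (intro measurable_compose[OF _ row_defect_measurable, where f = "\<lambda>\<theta>. \<theta> k"])
     (rule measurable_component_singleton)

lemma bump_measurable [measurable]: "bump I p s \<in> borel_measurable (graph_measure I)"
  unfolding bump_def by (intro borel_measurable_prod measurable_compose[OF _ gauss_measurable] defect_measurable)

text \<open>The rows of a parameter are independent, so the average factors over the coordinates outside \<open>I\<close>.
  The point of this identity is that the two variances enter only through their sum.\<close>

lemma nn_integral_bump_mult:
  assumes "s > 0" "s' > 0"
  shows "(\<integral>\<^sup>+\<theta>. ennreal (bump I p s \<theta> * bump I q s' \<theta>) \<partial>graph_measure I) = ennreal (pair_kernel I p q (s + s'))"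
proof -
  interpret product_sigma_finite "\<lambda>_. row_measure I" by (rule product_sigma_finite_row)
  define f where "f k r = ennreal (gauss s (p $ k - fst r - (\<Sum>i\<in>I. snd r i * p $ i))
      * gauss s' (q $ k - fst r - (\<Sum>i\<in>I. snd r i * q $ i)))" for k and r :: "real \<times> ('a \<Rightarrow> real)"
  have pos: "0 \<le> gauss s a" "0 \<le> gauss s' a" for a using assms by (auto intro: less_imp_le gauss_pos)
  have [measurable]: "f k \<in> borel_measurable (row_measure I)" for k
    unfolding f_def
    by (intro measurable_compose[OF _ measurable_ennreal] borel_measurable_times
        measurable_compose[OF _ gauss_measurable] row_defect_measurable)
  have "(\<integral>\<^sup>+\<theta>. ennreal (bump I p s \<theta> * bump I q s' \<theta>) \<partial>graph_measure I)
      = (\<integral>\<^sup>+\<theta>. (\<Prod>k\<in>-I. f k (\<theta> k)) \<partial>graph_measure I)"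
    by (simp add: bump_def f_def defect_def prod.distrib[symmetric] prod_ennreal pos)
  also have "\<dots> = (\<Prod>k\<in>-I. integral\<^sup>N (row_measure I) (f k))"
    unfolding graph_measure_def by (rule product_nn_integral_prod) auto
  also have "\<dots> = (\<Prod>k\<in>-I. ennreal (gauss (s + s' + (\<Sum>i\<in>I. (p $ i - q $ i)\<^sup>2)) (p $ k - q $ k)))"
    unfolding f_def using assms by (intro prod.cong refl nn_integral_row) auto
  also have "\<dots> = ennreal (pair_kernel I p q (s + s'))"
    unfolding pair_kernel_def using assms
    by (intro prod_ennreal less_imp_le[OF gauss_pos] add_pos_nonneg sum_nonneg) auto
  finally show ?thesis .
qed

lemma
  assumes "s > 0" "s' > 0"
  shows integrable_bump_mult: "integrable (graph_measure I) (\<lambda>\<theta>. bump I p s \<theta> * bump I q s' \<theta>)"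
    and integral_bump_mult: "(\<integral>\<theta>. bump I p s \<theta> * bump I q s' \<theta> \<partial>graph_measure I) = pair_kernel I p q (s + s')"
proof -
  have pos: "0 \<le> pair_kernel I p q (s + s')"
    unfolding pair_kernel_def using assms
    by (intro prod_nonneg less_imp_le[OF gauss_pos] add_pos_nonneg sum_nonneg) auto
  have nn: "AE \<theta> in graph_measure I. 0 \<le> bump I p s \<theta> * bump I q s' \<theta>"
    using assms by (auto intro: bump_nonneg mult_nonneg_nonneg)
  show "integrable (graph_measure I) (\<lambda>\<theta>. bump I p s \<theta> * bump I q s' \<theta>)"
    using nn_integral_bump_mult[OF assms, of I p q] nn by (intro integrableI_nonneg) auto
  then show "(\<integral>\<theta>. bump I p s \<theta> * bump I q s' \<theta> \<partial>graph_measure I) = pair_kernel I p q (s + s')"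
    using nn_integral_bump_mult[OF assms, of I p q] nn pos
    by (subst integral_eq_nn_integral) auto
qed

text \<open>A pairing that depends only on \<open>s + s'\<close> turns differences in \<open>s\<close> and differences in \<open>s'\<close> into
  differences of one function of one variable.\<close>

lemma integral_fdiff_mult:
  fixes f g :: "real \<Rightarrow> 'a \<Rightarrow> real"
  assumes "\<And>s s'. s > 0 \<Longrightarrow> s' > 0 \<Longrightarrow> integrable M (\<lambda>x. f s x * g s' x)
      \<and> (\<integral>x. f s x * g s' x \<partial>M) = K (s + s')"
    and "\<eta> \<ge> 0" "s > 0" "s' > 0"
  shows "integrable M (\<lambda>x. (fdiff \<eta> ^^ a) (\<lambda>s. f s x) s * (fdiff \<eta> ^^ b) (\<lambda>s. g s x) s')
      \<and> (\<integral>x. (fdiff \<eta> ^^ a) (\<lambda>s. f s x) s * (fdiff \<eta> ^^ b) (\<lambda>s. g s x) s' \<partial>M)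
        = (fdiff \<eta> ^^ (a + b)) K (s + s')"
  using assms(3,4)
proof (induction a arbitrary: s s')
  case 0
  then show ?case
  proof (induction b arbitrary: s')
    case (Suc b)
    from Suc.IH[of s'] Suc.IH[of "s' + \<eta>"] Suc.prems assms(2) show ?case
      by (simp add: fdiff_funpow_Suc right_diff_distrib add.assoc[symmetric])
  qed (use assms(1) in auto)
next
  case (Suc a)
  from Suc.IH[of s s'] Suc.IH[of "s + \<eta>" s'] Suc.prems assms(2) show ?case
    by (simp add: fdiff_funpow_Suc left_diff_distrib add_ac)
qed

section \<open>Energy of the high part\<close>

lemma pair_kernel_eq_heat_kernel:
  assumes "s > 0"
  shows "pair_kernel I p q s = (2 * pi) powr (- real (card (- I)) / 2)
    * heat_kernel (real (card (- I)) / 2) 0 (\<Sum>k\<in>-I. (p $ k - q $ k)\<^sup>2 / 2) (s + (\<Sum>i\<in>I. (p $ i - q $ i)\<^sup>2))"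
proof -
  define S where "S = s + (\<Sum>i\<in>I. (p $ i - q $ i)\<^sup>2)"
  have S: "S > 0" unfolding S_def using assms by (intro add_pos_nonneg sum_nonneg) auto
  have g: "gauss S x = (2 * pi * S) powr (- 1 / 2) * exp (- ((x\<^sup>2 / 2) / S))" for x
    using S by (simp add: gauss_eq powr_minus powr_half_sqrt divide_simps)
  have "pair_kernel I p q s = ((2 * pi * S) powr (- 1 / 2)) ^ card (- I) * exp (\<Sum>k\<in>-I. - (((p $ k - q $ k)\<^sup>2 / 2) / S))"
    unfolding pair_kernel_def S_def[symmetric] g by (simp add: prod.distrib exp_sum)
  also have "((2 * pi * S) powr (- 1 / 2)) ^ card (- I) = (2 * pi) powr (- real (card (- I)) / 2) * S powr (- real (card (- I)) / 2)"
    using S by (simp add: powr_powr powr_mult powr_realpow[symmetric])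
  also have "(\<Sum>k\<in>-I. - (((p $ k - q $ k)\<^sup>2 / 2) / S)) = - (\<Sum>k\<in>-I. (p $ k - q $ k)\<^sup>2 / 2) / S"
    by (simp add: sum_negf sum_divide_distrib)
  finally show ?thesis by (simp add: heat_kernel_def S_def)
qed

lemma dist_square_split:
  fixes p q :: "real ^ 'd"
  shows "(dist p q)\<^sup>2 = (\<Sum>i\<in>I. (p $ i - q $ i)\<^sup>2) + (\<Sum>k\<in>-I. (p $ k - q $ k)\<^sup>2)"
proof -
  have "(dist p q)\<^sup>2 = (\<Sum>i\<in>UNIV. (p $ i - q $ i)\<^sup>2)"
    by (simp add: dist_vec_def L2_set_def dist_real_def sum_nonneg)
  also have "\<dots> = (\<Sum>i\<in>I. (p $ i - q $ i)\<^sup>2) + (\<Sum>k\<in>-I. (p $ k - q $ k)\<^sup>2)"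
    by (subst sum.union_disjoint[symmetric]) (auto intro: sum.cong)
  finally show ?thesis .
qed

lemma card_add_card_Compl: "real CARD('d) = real (card I) + real (card (- I))" for I :: "'d::finite set"
  by (metis Compl_partition card_Un_disjoint disjoint_eq_subset_Compl finite of_nat_add order_refl double_complement)

text \<open>The Riesz kernel of order \<open>m\<close> as a function of the distance \<open>e\<close>, cut off at scale \<open>\<rho>\<close>.\<close>

definition riesz :: "real \<Rightarrow> real \<Rightarrow> real \<Rightarrow> real \<Rightarrow> real"
  where "riesz m L \<rho> e = e powr (- m) * min 1 ((\<rho> / e) powr L)"

text \<open>The kernel is a heat kernel at variance \<open>2 \<delta>\<^sup>2\<close> plus the squared horizontal distance, with \<open>w\<close> half of
  the squared vertical distance. These add up to at least \<open>e\<^sup>2 / 2\<close>, so the kernel has size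
  \<open>e powr (- m)\<close>, and the differences gain \<open>(\<rho> / e) powr (2 N)\<close> as soon as \<open>e\<close> exceeds \<open>\<rho>\<close>.\<close>

lemma fdiff_pair_kernel_bound:
  fixes I :: "'d::finite set"
  defines "m \<equiv> real (card (- I))"
  shows "\<exists>C\<ge>0. \<forall>p q. \<forall>\<delta>>0. \<forall>\<rho>>0. let e = max \<delta> (dist p q) in
    \<bar>(fdiff (\<rho>\<^sup>2) ^^ N) (pair_kernel I p q) (2 * \<delta>\<^sup>2)\<bar> \<le> C * (riesz m (2 * real N) \<rho> e)"
proof -
  obtain C0 where C0: "C0 \<ge> 0" "\<And>w s. w \<ge> 0 \<Longrightarrow> s > 0 \<Longrightarrow>
      \<bar>heat_kernel (m / 2) 0 w s\<bar> \<le> C0 * (s + w) powr (- m / 2)"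
    using heat_kernel_bound[of 0 "m / 2"] by (auto simp: m_def)
  obtain C1 where C1: "C1 \<ge> 0" "\<And>w s \<eta>. w \<ge> 0 \<Longrightarrow> s > 0 \<Longrightarrow> \<eta> > 0 \<Longrightarrow>
      \<bar>(fdiff \<eta> ^^ N) (heat_kernel (m / 2) 0 w) s\<bar> \<le> C1 * \<eta> ^ N * (s + w) powr (- m / 2 - real N)"
    using fdiff_heat_kernel_bound[of 0 "m / 2" N] by (auto simp: m_def)
  define A where "A = (2 * pi) powr (- m / 2)"
  define C where "C = A * (2 ^ N * C0 * 2 powr (m / 2) + C1 * 2 powr (m / 2 + real N))"
  have A: "A \<ge> 0" by (simp add: A_def)
  have "\<bar>(fdiff (\<rho>\<^sup>2) ^^ N) (pair_kernel I p q) (2 * \<delta>\<^sup>2)\<bar> \<le> C * (riesz m (2 * real N) \<rho> e)"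
    if \<delta>: "\<delta> > 0" and \<rho>: "\<rho> > 0" and e_def: "e = max \<delta> (dist p q)" for p q :: "real ^ 'd" and \<delta> \<rho> e
  proof -
    define \<sigma> where "\<sigma> = (\<Sum>i\<in>I. (p $ i - q $ i)\<^sup>2)"
    define w where "w = (\<Sum>k\<in>-I. (p $ k - q $ k)\<^sup>2 / 2)"
    have nn: "\<sigma> \<ge> 0" "w \<ge> 0" by (auto simp: \<sigma>_def w_def intro!: sum_nonneg)
    have e: "e > 0" using \<delta> by (simp add: e_def)
    define s where "s = 2 * \<delta>\<^sup>2 + \<sigma>"
    have s: "s > 0" using \<delta> nn by (simp add: s_def add_pos_nonneg)
    have "(dist p q)\<^sup>2 = \<sigma> + 2 * w"
      unfolding dist_square_split[of p q I] by (simp add: \<sigma>_def w_def sum_divide_distrib[symmetric])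
    then have "e\<^sup>2 / 2 \<le> s + w" using nn by (auto simp: e_def s_def max_def)
    then have dec: "(s + w) powr (- u) \<le> (e\<^sup>2 / 2) powr (- u)" if "u \<ge> 0" for u
      using that e by (intro powr_mono2') auto
    have e2: "(e\<^sup>2 / 2) powr (- u) = 2 powr u * e powr (- (2 * u))" for u
    proof -
      have "e\<^sup>2 powr (- u) = e powr (2 * (- u))"
        using e by (subst powr_powr[symmetric]) (simp add: powr_numeral)
      then show ?thesis using e by (simp add: powr_divide powr_minus divide_simps)
    qed
    have "(fdiff (\<rho>\<^sup>2) ^^ N) (pair_kernel I p q) (2 * \<delta>\<^sup>2)
        = (fdiff (\<rho>\<^sup>2) ^^ N) (\<lambda>x. A * heat_kernel (m / 2) 0 w (x + \<sigma>) + 0 * (\<lambda>_. 0) x) (2 * \<delta>\<^sup>2)"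
    proof (rule fdiff_funpow_cong)
      fix x assume "2 * \<delta>\<^sup>2 \<le> x"
      then have "x > 0" using \<delta> by (meson less_le_trans mult_pos_pos zero_less_numeral zero_less_power)
      from pair_kernel_eq_heat_kernel[OF this, of I p q]
      show "pair_kernel I p q x = A * heat_kernel (m / 2) 0 w (x + \<sigma>) + 0 * (\<lambda>_. 0) x"
        by (simp add: A_def m_def w_def \<sigma>_def)
    qed simp
    also have "\<dots> = A * (fdiff (\<rho>\<^sup>2) ^^ N) (heat_kernel (m / 2) 0 w) s"
      by (subst fdiff_funpow_linear) (simp add: fdiff_funpow_shift s_def)
    finally have eq: "\<bar>(fdiff (\<rho>\<^sup>2) ^^ N) (pair_kernel I p q) (2 * \<delta>\<^sup>2)\<bar> = A * \<bar>(fdiff (\<rho>\<^sup>2) ^^ N) (heat_kernel (m / 2) 0 w) s\<bar>"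
      using A by (simp add: abs_mult)
    have "\<bar>(fdiff (\<rho>\<^sup>2) ^^ N) (heat_kernel (m / 2) 0 w) s\<bar> \<le> 2 ^ N * (C0 * (s + w) powr (- m / 2))"
    proof (rule fdiff_funpow_bound)
      fix x assume x: "s \<le> x"
      have "\<bar>heat_kernel (m / 2) 0 w x\<bar> \<le> C0 * (x + w) powr (- m / 2)" using C0(2)[of w x] x s nn by simp
      also have "\<dots> \<le> C0 * (s + w) powr (- m / 2)"
        using C0(1) x s nn by (intro mult_left_mono powr_mono2') (auto simp: m_def)
      finally show "\<bar>heat_kernel (m / 2) 0 w x\<bar> \<le> C0 * (s + w) powr (- m / 2)" .
    qed simp
    also have "\<dots> \<le> 2 ^ N * (C0 * (2 powr (m / 2) * e powr (- m)))"
      using dec[of "m / 2"] e2[of "m / 2"] C0(1) by (intro mult_left_mono) (auto simp: m_def)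
    finally have b0: "\<bar>(fdiff (\<rho>\<^sup>2) ^^ N) (heat_kernel (m / 2) 0 w) s\<bar> \<le> (2 ^ N * C0 * 2 powr (m / 2)) * e powr (- m)"
      by (simp add: mult_ac)
    have "\<bar>(fdiff (\<rho>\<^sup>2) ^^ N) (heat_kernel (m / 2) 0 w) s\<bar> \<le> C1 * (\<rho>\<^sup>2) ^ N * (s + w) powr (- m / 2 - real N)"
      using C1(2) nn s \<rho> by simp
    also have "\<dots> \<le> C1 * (\<rho>\<^sup>2) ^ N * (2 powr (m / 2 + real N) * e powr (- (m + 2 * real N)))"
    proof -
      have "- m / 2 - real N = - (m / 2 + real N)" "2 * (m / 2 + real N) = m + 2 * real N" by simp_all
      note ex = this
      have "(s + w) powr (- (m / 2 + real N)) \<le> 2 powr (m / 2 + real N) * e powr (- (m + 2 * real N))"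
        using dec[of "m / 2 + real N"] unfolding e2 ex(2) by (simp add: m_def)
      then show ?thesis unfolding ex(1) using C1(1) by (intro mult_left_mono) auto
    qed
    also have "\<dots> = (C1 * 2 powr (m / 2 + real N)) * (e powr (- m) * (\<rho> / e) powr (2 * real N))"
    proof -
      have h1: "(\<rho>\<^sup>2) ^ N = \<rho> powr (2 * real N)"
        using powr_realpow[OF \<rho>, of "2 * N"] by (simp add: power_mult)
      have h2: "e powr (- (m + 2 * real N)) = e powr (- m) * e powr (- (2 * real N))"
        by (simp add: powr_add[symmetric])
      have h3: "(\<rho> / e) powr (2 * real N) = \<rho> powr (2 * real N) * e powr (- (2 * real N))"
        using e \<rho> by (simp add: powr_divide powr_minus_divide)
      show ?thesis unfolding h1 h2 h3 by (simp only: mult_ac)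
    qed
    finally have b1: "\<bar>(fdiff (\<rho>\<^sup>2) ^^ N) (heat_kernel (m / 2) 0 w) s\<bar>
        \<le> (C1 * 2 powr (m / 2 + real N)) * (e powr (- m) * (\<rho> / e) powr (2 * real N))" .
    have "\<bar>(fdiff (\<rho>\<^sup>2) ^^ N) (heat_kernel (m / 2) 0 w) s\<bar>
        \<le> (2 ^ N * C0 * 2 powr (m / 2) + C1 * 2 powr (m / 2 + real N)) * (riesz m (2 * real N) \<rho> e)"
    proof (cases "(\<rho> / e) powr (2 * real N) \<le> 1")
      case True
      have "0 \<le> (2 ^ N * C0 * 2 powr (m / 2)) * (e powr (- m) * (\<rho> / e) powr (2 * real N))" using C0(1) by simp
      with b1 True show ?thesis by (simp add: riesz_def min_def algebra_simps)
    next
      case False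
      have "0 \<le> (C1 * 2 powr (m / 2 + real N)) * e powr (- m)" using C1(1) by simp
      with b0 False show ?thesis by (simp add: riesz_def min_def algebra_simps)
    qed
    from mult_left_mono[OF this A] show ?thesis unfolding eq C_def by (simp add: mult.assoc)
  qed
  moreover have "C \<ge> 0" using A C0(1) C1(1) by (simp add: C_def)
  ultimately show ?thesis by (intro exI[of _ C]) (auto simp: Let_def)
qed

text \<open>At \<open>s = \<delta>\<^sup>2\<close> this is, up to the factor \<open>\<delta> powr (- m)\<close>, a smoothed count of the points of \<open>P\<close> in the
  \<open>\<delta>\<close>-neighbourhood of a graph.\<close>

definition profile :: "'d::finite set \<Rightarrow> (real ^ 'd) set \<Rightarrow> ('d \<Rightarrow> real \<times> ('d \<Rightarrow> real)) \<Rightarrow> real \<Rightarrow> real"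
  where "profile I P \<theta> s = (\<Sum>p\<in>P. bump I p s \<theta>)"

definition high_part :: "'d::finite set \<Rightarrow> (real ^ 'd) set \<Rightarrow> real \<Rightarrow> real \<Rightarrow> nat \<Rightarrow> ('d \<Rightarrow> real \<times> ('d \<Rightarrow> real)) \<Rightarrow> real"
  where "high_part I P \<delta> \<rho> N \<theta> = (fdiff (\<rho>\<^sup>2) ^^ N) (profile I P \<theta>) (\<delta>\<^sup>2)"

text \<open>The square of the \<open>N\<close>-th difference pairs the profile with itself, so its integral is a double sum over
  \<open>P\<close> of \<open>2 N\<close>-th differences of the pair kernel at variance \<open>\<delta>\<^sup>2 + \<delta>\<^sup>2\<close>.\<close>

lemma high_part_energy:
  fixes I :: "'d::finite set"
  defines "m \<equiv> real (card (- I))"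
  shows "\<exists>C\<ge>0. \<forall>P. \<forall>\<delta>>0. \<forall>\<rho>>0.
    integrable (graph_measure I) (\<lambda>\<theta>. (high_part I P \<delta> \<rho> N \<theta>)\<^sup>2) \<and>
    (\<integral>\<theta>. (high_part I P \<delta> \<rho> N \<theta>)\<^sup>2 \<partial>graph_measure I)
      \<le> C * (\<Sum>p\<in>P. \<Sum>q\<in>P. riesz m (4 * real N) \<rho> (max \<delta> (dist p q)))"
proof -
  obtain C where C: "C \<ge> 0" "\<And>p q \<delta> \<rho>. \<delta> > 0 \<Longrightarrow> \<rho> > 0 \<Longrightarrow>
    \<bar>(fdiff (\<rho>\<^sup>2) ^^ (N + N)) (pair_kernel I p q) (2 * \<delta>\<^sup>2)\<bar>
      \<le> C * (riesz m (4 * real N) \<rho> (max \<delta> (dist p q)))"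
    using fdiff_pair_kernel_bound[where I = I and N = "N + N"] by (auto simp: m_def Let_def)
  have main: "integrable (graph_measure I) (\<lambda>\<theta>. (high_part I P \<delta> \<rho> N \<theta>)\<^sup>2) \<and>
    (\<integral>\<theta>. (high_part I P \<delta> \<rho> N \<theta>)\<^sup>2 \<partial>graph_measure I)
      \<le> C * (\<Sum>p\<in>P. \<Sum>q\<in>P. riesz m (4 * real N) \<rho> (max \<delta> (dist p q)))"
    if \<delta>: "0 < \<delta>" and \<rho>: "0 < \<rho>" for P \<delta> \<rho>
  proof -
    have prof: "profile I P \<theta> s * profile I P \<theta> s' = (\<Sum>p\<in>P. \<Sum>q\<in>P. bump I p s \<theta> * bump I q s' \<theta>)" for \<theta> s s'
      by (simp add: profile_def sum_product)
    have "integrable (graph_measure I) (\<lambda>\<theta>. profile I P \<theta> s * profile I P \<theta> s')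
      \<and> (\<integral>\<theta>. profile I P \<theta> s * profile I P \<theta> s' \<partial>graph_measure I) = (\<Sum>p\<in>P. \<Sum>q\<in>P. pair_kernel I p q (s + s'))"
      if "s > 0" "s' > 0" for s s'
      unfolding prof using that by (simp add: integrable_bump_mult integral_bump_mult)
    from integral_fdiff_mult[of "graph_measure I" "\<lambda>s \<theta>. profile I P \<theta> s" "\<lambda>s \<theta>. profile I P \<theta> s"
        "\<lambda>s. \<Sum>p\<in>P. \<Sum>q\<in>P. pair_kernel I p q s" "\<rho>\<^sup>2" "\<delta>\<^sup>2" "\<delta>\<^sup>2" N N, OF this] \<delta>
    have "integrable (graph_measure I) (\<lambda>\<theta>. (high_part I P \<delta> \<rho> N \<theta>)\<^sup>2)"
      and eq: "(\<integral>\<theta>. (high_part I P \<delta> \<rho> N \<theta>)\<^sup>2 \<partial>graph_measure I)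
        = (\<Sum>p\<in>P. \<Sum>q\<in>P. (fdiff (\<rho>\<^sup>2) ^^ (N + N)) (pair_kernel I p q) (2 * \<delta>\<^sup>2))"
      by (simp_all add: high_part_def power2_eq_square[of "(fdiff _ ^^ _) _ _"] fdiff_funpow_sum)
    moreover have "(\<Sum>p\<in>P. \<Sum>q\<in>P. (fdiff (\<rho>\<^sup>2) ^^ (N + N)) (pair_kernel I p q) (2 * \<delta>\<^sup>2))
      \<le> C * (\<Sum>p\<in>P. \<Sum>q\<in>P. riesz m (4 * real N) \<rho> (max \<delta> (dist p q)))"
      unfolding sum_distrib_left using C(2)[OF \<delta> \<rho>] by (intro sum_mono) (blast intro: order.trans[OF abs_ge_self])
    ultimately show ?thesis by simp
  qed
  show ?thesis by (intro exI[of _ C] conjI[OF C(1)] allI impI main)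
qed

section \<open>Frostman sets\<close>

text \<open>Each point is charged to one shell, and the shells sum to a geometric series.\<close>

lemma sum_dyadic_shells:
  fixes w e :: "'a \<Rightarrow> real" and c R :: "nat \<Rightarrow> real"
  assumes "finite P" "\<And>j. c j \<ge> 0"
    and shell: "\<And>q. q \<in> P \<Longrightarrow> \<exists>j. e q \<le> R j \<and> w q \<le> c j"
    and count: "\<And>j. c j * real (card {q\<in>P. e q \<le> R j}) \<le> A * x ^ j"
    and "A \<ge> 0" "0 \<le> x" "x < 1"
  shows "(\<Sum>q\<in>P. w q) \<le> A / (1 - x)"
proof -
  obtain j where j: "\<And>q. q \<in> P \<Longrightarrow> e q \<le> R (j q) \<and> w q \<le> c (j q)" using shell by metis
  define J where "J = Suc (Max (j ` P))"
  have J: "j q < J" if "q \<in> P" for q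
    using that assms(1) by (auto simp: J_def less_Suc_eq_le)
  have "(\<Sum>q\<in>P. w q) \<le> (\<Sum>q\<in>P. \<Sum>i<J. if e q \<le> R i then c i else 0)"
  proof (rule sum_mono)
    fix q assume q: "q \<in> P"
    have "w q \<le> (if e q \<le> R (j q) then c (j q) else 0)" using j[OF q] by simp
    also have "\<dots> \<le> (\<Sum>i<J. if e q \<le> R i then c i else 0)"
      using J[OF q] assms(2) by (intro member_le_sum) auto
    finally show "w q \<le> (\<Sum>i<J. if e q \<le> R i then c i else 0)" .
  qed
  also have "\<dots> = (\<Sum>i<J. \<Sum>q\<in>P. if e q \<le> R i then c i else 0)" by (rule sum.swap)
  also have "\<dots> = (\<Sum>i<J. c i * real (card {q\<in>P. e q \<le> R i}))"
    using assms(1) by (simp add: sum.If_cases mult.commute Int_def)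
  also have "\<dots> \<le> (\<Sum>i<J. A * x ^ i)" by (intro sum_mono count)
  also have "\<dots> = A * ((1 - x ^ J) / (1 - x))"
    using assms by (simp add: sum_distrib_left[symmetric] sum_gp_strict)
  also have "\<dots> \<le> A * (1 / (1 - x))"
    using assms by (intro mult_left_mono divide_right_mono) auto
  finally show ?thesis by simp
qed

lemma dyadic_scale:
  fixes y :: real
  assumes "y \<ge> 1"
  shows "\<exists>j::nat. 2 ^ j \<le> y \<and> y < 2 ^ Suc j"
proof -
  define n where "n = (LEAST n. y < 2 ^ n)"
  have ex: "\<exists>n. y < 2 ^ n" using real_arch_pow[of 2 y] by auto
  then have n: "y < 2 ^ n" unfolding n_def by (rule LeastI_ex)
  then have "n \<noteq> 0" using assms by (cases n) auto
  then obtain j where j: "n = Suc j" by (cases n) auto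
  have "\<not> y < 2 ^ j" using not_less_Least[of j "\<lambda>n. y < 2 ^ n"] j unfolding n_def by auto
  with n j show ?thesis by force
qed

text \<open>A Riesz potential with a cut-off at scale \<open>\<rho>\<close>. The dyadic shell of radius \<open>r\<close> contributes
  \<open>B r powr (t - m)\<close> inside the cut-off, which decreases geometrically towards \<open>r = 0\<close> because \<open>m < t\<close>,
  and has the additional factor \<open>(\<rho> / r) powr L\<close> outside, which wins because \<open>t < m + L\<close>. So the
  shell at \<open>\<rho>\<close> dominates.\<close>

lemma potential_bound:
  fixes P :: "'a::metric_space set" and m t L :: real
  assumes fin: "finite P" and m: "m < t" "t < m + L" "0 \<le> m" and \<delta>: "0 < \<delta>" "\<delta> \<le> \<rho>" and B: "B \<ge> 0"
    and count: "\<And>r. \<delta> \<le> r \<Longrightarrow> real (card {q\<in>P. dist p q \<le> r}) \<le> B * r powr t"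
    and e: "\<And>q. e q = max \<delta> (dist p q)"
  shows "(\<Sum>q\<in>P. riesz m L \<rho> (e q))
    \<le> (2 powr m / (1 - 2 powr (m - t)) + 2 powr t / (1 - 2 powr (t - m - L))) * B * \<rho> powr (t - m)"
proof -
  let ?w = "\<lambda>q. e q powr (- m) * min 1 ((\<rho> / e q) powr L)"
  have epos: "e q > 0" "\<delta> \<le> e q" for q using \<delta> by (auto simp: e)
  have \<rho>: "\<rho> > 0" using \<delta> by simp
  (* Every e q is at least \<delta>, so radii below \<delta>, for which count says nothing, give empty shells. *)
  have cnt: "real (card {q\<in>P. Q q \<and> e q \<le> r}) \<le> B * r powr t" if "r > 0" for r Q
  proof (cases "\<delta> \<le> r")
    case True
    have "card {q\<in>P. Q q \<and> e q \<le> r} \<le> card {q\<in>P. dist p q \<le> r}"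
      using fin by (intro card_mono) (auto simp: e)
    with count[OF True] show ?thesis by linarith
  next
    case False
    then have none: "{q\<in>P. Q q \<and> e q \<le> r} = {}" by (auto simp: e)
    show ?thesis using B unfolding none by simp
  qed
  have pw: "2 powr (u * real j) = (2 powr u) ^ j" for u :: real and j :: nat
    by (simp add: powr_powr[symmetric] powr_realpow)
  have near: "(\<Sum>q\<in>{q\<in>P. e q \<le> \<rho>}. ?w q) \<le> (2 powr m * B * \<rho> powr (t - m)) / (1 - 2 powr (m - t))"
  proof (rule sum_dyadic_shells[where e = e and R = "\<lambda>j. \<rho> / 2 ^ j" and c = "\<lambda>j. (\<rho> / 2 ^ Suc j) powr (- m)"])
    fix q assume q: "q \<in> {q\<in>P. e q \<le> \<rho>}"
    then have "1 \<le> \<rho> / e q" using epos by (simp add: field_simps)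
    then obtain j :: nat where j: "2 ^ j \<le> \<rho> / e q" "\<rho> / e q < 2 ^ Suc j" using dyadic_scale by blast
    then have j: "e q \<le> \<rho> / 2 ^ j" "\<rho> / 2 ^ Suc j \<le> e q" using epos[of q] by (simp_all add: field_simps)
    have "?w q \<le> e q powr (- m)" by (simp add: mult_left_le)
    also have "\<dots> \<le> (\<rho> / 2 ^ Suc j) powr (- m)" using j(2) m \<rho> by (intro powr_mono2') auto
    finally show "\<exists>j. e q \<le> \<rho> / 2 ^ j \<and> ?w q \<le> (\<rho> / 2 ^ Suc j) powr (- m)" using j(1) by blast
  next
    fix j :: nat
    have "{q \<in> {q\<in>P. e q \<le> \<rho>}. e q \<le> \<rho> / 2 ^ j} = {q\<in>P. e q \<le> \<rho> \<and> e q \<le> \<rho> / 2 ^ j}" by auto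
    then have "(\<rho> / 2 ^ Suc j) powr (- m) * real (card {q \<in> {q\<in>P. e q \<le> \<rho>}. e q \<le> \<rho> / 2 ^ j})
        \<le> (\<rho> / 2 ^ Suc j) powr (- m) * (B * (\<rho> / 2 ^ j) powr t)"
      using cnt[of "\<rho> / 2 ^ j" "\<lambda>q. e q \<le> \<rho>"] \<rho> by (intro mult_left_mono) auto
    also have "\<dots> = 2 powr m * B * \<rho> powr (t - m) * (2 powr (m - t)) ^ j"
      using \<rho> unfolding pw[symmetric]
      by (simp add: powr_divide powr_mult powr_realpow[symmetric] powr_powr powr_minus powr_diff
          powr_add algebra_simps divide_simps del: power_Suc)
    finally show "(\<rho> / 2 ^ Suc j) powr (- m) * real (card {q \<in> {q\<in>P. e q \<le> \<rho>}. e q \<le> \<rho> / 2 ^ j})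
        \<le> 2 powr m * B * \<rho> powr (t - m) * (2 powr (m - t)) ^ j" .
  qed (use fin B m in \<open>auto simp: powr_less_one\<close>)
  have far: "(\<Sum>q\<in>{q\<in>P. \<not> e q \<le> \<rho>}. ?w q) \<le> (2 powr t * B * \<rho> powr (t - m)) / (1 - 2 powr (t - m - L))"
  proof (rule sum_dyadic_shells[where e = e and R = "\<lambda>j. \<rho> * 2 ^ Suc j"
        and c = "\<lambda>j. (\<rho> * 2 ^ j) powr (- m - L) * \<rho> powr L"])
    fix q assume q: "q \<in> {q\<in>P. \<not> e q \<le> \<rho>}"
    then have "1 \<le> e q / \<rho>" using \<rho> by (simp add: field_simps)
    then obtain j :: nat where j: "2 ^ j \<le> e q / \<rho>" "e q / \<rho> < 2 ^ Suc j" using dyadic_scale by blast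
    then have j: "e q \<le> \<rho> * 2 ^ Suc j" "\<rho> * 2 ^ j \<le> e q" using \<rho> by (simp_all add: field_simps)
    have "?w q \<le> e q powr (- m) * (\<rho> / e q) powr L" by (intro mult_left_mono) auto
    also have "\<dots> = e q powr (- m - L) * \<rho> powr L"
      using epos[of q] \<rho> by (simp add: powr_divide powr_diff)
    also have "\<dots> \<le> (\<rho> * 2 ^ j) powr (- m - L) * \<rho> powr L"
      using j(2) m \<rho> by (intro mult_right_mono powr_mono2') auto
    finally show "\<exists>j. e q \<le> \<rho> * 2 ^ Suc j \<and> ?w q \<le> (\<rho> * 2 ^ j) powr (- m - L) * \<rho> powr L" using j(1) by blast
  next
    fix j :: nat
    have "{q \<in> {q\<in>P. \<not> e q \<le> \<rho>}. e q \<le> \<rho> * 2 ^ Suc j} = {q\<in>P. \<not> e q \<le> \<rho> \<and> e q \<le> \<rho> * 2 ^ Suc j}" by auto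
    then have "((\<rho> * 2 ^ j) powr (- m - L) * \<rho> powr L) * real (card {q \<in> {q\<in>P. \<not> e q \<le> \<rho>}. e q \<le> \<rho> * 2 ^ Suc j})
        \<le> ((\<rho> * 2 ^ j) powr (- m - L) * \<rho> powr L) * (B * (\<rho> * 2 ^ Suc j) powr t)"
      using cnt[of "\<rho> * 2 ^ Suc j" "\<lambda>q. \<not> e q \<le> \<rho>"] \<rho> by (intro mult_left_mono) auto
    also have "\<dots> = 2 powr t * B * \<rho> powr (t - m) * (2 powr (t - m - L)) ^ j"
      using \<rho> unfolding pw[symmetric]
      by (simp add: powr_divide powr_mult powr_realpow[symmetric] powr_powr powr_minus powr_diff
          powr_add algebra_simps divide_simps del: power_Suc)
    finally show "((\<rho> * 2 ^ j) powr (- m - L) * \<rho> powr L) * real (card {q \<in> {q\<in>P. \<not> e q \<le> \<rho>}. e q \<le> \<rho> * 2 ^ Suc j})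
        \<le> 2 powr t * B * \<rho> powr (t - m) * (2 powr (t - m - L)) ^ j" .
  qed (use fin B m in \<open>auto simp: powr_less_one\<close>)
  have "(\<Sum>q\<in>P. ?w q) = (\<Sum>q\<in>{q\<in>P. e q \<le> \<rho>}. ?w q) + (\<Sum>q\<in>{q\<in>P. \<not> e q \<le> \<rho>}. ?w q)"
    using fin by (subst sum.union_disjoint[symmetric]) (auto intro!: sum.cong)
  with near far show ?thesis by (simp add: riesz_def algebra_simps)
qed

text \<open>A cube of side \<open>\<delta> / (CARD('d) + 1)\<close> has diameter less than \<open>\<delta>\<close>, so a grid of such cubes has at most
  one point of \<open>P\<close> in each cell.\<close>

lemma separated_cball_count:
  fixes P :: "(real ^ 'd) set"
  assumes "delta_separated dist \<delta> P" "\<delta> > 0"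
  shows "finite (P \<inter> cball x (real M * \<delta>)) \<and> card (P \<inter> cball x (real M * \<delta>)) \<le> (2 * (M * Suc CARD('d)) + 1) ^ CARD('d)"
proof -
  define L where "L = Suc CARD('d)"
  define g where "g p = (\<lambda>i. \<lfloor>(p $ i - x $ i) * real L / \<delta>\<rfloor>)" for p :: "real ^ 'd"
  define Q where "Q = P \<inter> cball x (real M * \<delta>)"
  define T where "T = PiE (UNIV :: 'd set) (\<lambda>_. {- int (M * L)..int (M * L)})"
  have L: "L > 0" by (simp add: L_def)
  have inj: "inj_on g Q"
  proof (rule inj_onI, rule ccontr)
    fix p q assume pq: "p \<in> Q" "q \<in> Q" "g p = g q" "p \<noteq> q"
    have "\<bar>p $ i - q $ i\<bar> \<le> \<delta> / real L" for i
    proof -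
      have "\<lfloor>(p $ i - x $ i) * real L / \<delta>\<rfloor> = \<lfloor>(q $ i - x $ i) * real L / \<delta>\<rfloor>"
        using pq(3) by (simp add: g_def fun_eq_iff)
      then have "\<bar>(p $ i - x $ i) * real L / \<delta> - (q $ i - x $ i) * real L / \<delta>\<bar> \<le> 1" by linarith
      also have "(p $ i - x $ i) * real L / \<delta> - (q $ i - x $ i) * real L / \<delta> = (p $ i - q $ i) * (real L / \<delta>)"
        by (simp add: algebra_simps diff_divide_distrib)
      finally show ?thesis using L assms(2) by (simp add: abs_mult divide_simps)
    qed
    then have "(\<Sum>i\<in>UNIV. \<bar>(p - q) $ i\<bar>) \<le> (\<Sum>i\<in>(UNIV :: 'd set). \<delta> / real L)" by (intro sum_mono) simp
    then have "dist p q \<le> real CARD('d) * (\<delta> / real L)"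
      unfolding dist_norm using norm_le_l1_cart[of "p - q"] by simp
    also have "\<dots> < \<delta>" using assms(2) by (simp add: L_def field_simps)
    finally have "dist p q < \<delta>" .
    moreover have "\<delta> \<le> dist p q" using assms(1) pq by (auto simp: delta_separated_def Q_def)
    ultimately show False by simp
  qed
  have img: "g ` Q \<subseteq> T"
  proof -
    have "g p i \<in> {- int (M * L)..int (M * L)}" if p: "p \<in> Q" for p i
    proof -
    have "\<bar>(p - x) $ i\<bar> \<le> norm (p - x)" by (rule component_le_norm_cart)
    also have "\<dots> \<le> real M * \<delta>" using p by (simp add: Q_def dist_norm norm_minus_commute)
    finally have "\<bar>p $ i - x $ i\<bar> \<le> real M * \<delta>" by simp
    then have "\<bar>(p $ i - x $ i) * real L / \<delta>\<bar> \<le> real (M * L)"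
      using assms(2) L by (simp add: abs_mult divide_simps mult_ac)
    then have "- real (M * L) \<le> (p $ i - x $ i) * real L / \<delta>" "(p $ i - x $ i) * real L / \<delta> \<le> real (M * L)" by linarith+
    then show ?thesis by (simp add: g_def le_floor_iff floor_le_iff)
    qed
    then show ?thesis by (auto simp: T_def)
  qed
  have finT: "finite T" unfolding T_def by (intro finite_PiE) auto
  then have "finite Q" using inj img by (meson finite_imageD finite_subset)
  moreover have "card Q \<le> card T" using inj img finT by (rule card_inj_on_le)
  moreover have "card T = (2 * (M * L) + 1) ^ CARD('d)"
    by (simp add: T_def card_PiE nat_add_distrib nat_mult_distrib mult.commute)
  ultimately show ?thesis by (simp add: Q_def L_def)
qed

lemma separated_finite:
  fixes P :: "(real ^ 'd) set"
  assumes "delta_separated dist \<delta> P" "\<delta> > 0" "bounded P"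
  shows "finite P"
proof -
  obtain r where "\<forall>x\<in>P. norm x \<le> r" using assms(3) by (auto simp: bounded_iff)
  then have r: "P \<subseteq> cball 0 r" by auto
  obtain M :: nat where "r / \<delta> \<le> real M" using real_arch_simple by blast
  then have "r \<le> real M * \<delta>" using assms(2) by (simp add: field_simps)
  then have "P \<inter> cball 0 (real M * \<delta>) = P" using r by auto
  with separated_cball_count[OF assms(1,2), of 0 M] show ?thesis by simp
qed

text \<open>For a \<open>\<delta>\<close>-separated set the covering number at scale \<open>\<delta>\<close> is comparable to the cardinality, because
  a ball of radius \<open>\<delta>\<close> has boundedly many points. Radii above 1 are covered by the trivial bound
  \<open>card P\<close>.\<close>

lemma frostman_count:
  fixes P :: "(real ^ 'd) set"
  assumes sep: "delta_separated dist \<delta> P" and \<delta>: "0 < \<delta>" "\<delta> < 1" and "delta_s_set \<delta> t C\<^sub>F P"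
    and CF: "C\<^sub>F \<ge> 1" and t: "t \<ge> 0" and r: "\<delta> \<le> r"
  shows "real (card (P \<inter> cball x r)) \<le> real ((2 * CARD('d) + 3) ^ CARD('d)) * C\<^sub>F * real (card P) * r powr t"
proof -
  define c where "c = real ((2 * CARD('d) + 3) ^ CARD('d))"
  have c: "c \<ge> 1" by (simp add: c_def one_le_power)
  have fin: "finite P" using separated_finite sep \<delta> assms(4) by (auto simp: delta_s_set_def)
  show ?thesis
  proof (cases "r \<le> 1")
    case False
    have "real (card (P \<inter> cball x r)) \<le> 1 * 1 * real (card P) * 1"
      using fin by (simp add: card_mono)
    also have "\<dots> \<le> c * C\<^sub>F * real (card P) * r powr t"
      using c CF t False by (intro mult_mono ge_one_powr_ge_zero) auto
    finally show ?thesis by (simp add: c_def)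
  next
    case True
    have P: "covering_number \<delta> P \<le> of_nat (card P)"
      unfolding covering_number_def using fin \<delta> by (intro INF_lower2[of P]) auto
    have "ennreal (real (card (P \<inter> cball x r)) / c) \<le> covering_number \<delta> (P \<inter> cball x r)"
      unfolding covering_number_def
    proof (rule INF_greatest)
      fix F assume "F \<in> {F. finite F \<and> P \<inter> cball x r \<subseteq> (\<Union>x\<in>F. cball x \<delta>)}"
      then have F: "finite F" "P \<inter> cball x r \<subseteq> (\<Union>y\<in>F. P \<inter> cball y \<delta>)" by auto
      have "card (P \<inter> cball x r) \<le> card (\<Union>y\<in>F. P \<inter> cball y \<delta>)"
        using F fin by (intro card_mono) auto
      also have "\<dots> \<le> (\<Sum>y\<in>F. card (P \<inter> cball y \<delta>))" using F(1) by (rule card_UN_le)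
      also have "\<dots> \<le> (\<Sum>y\<in>F. (2 * CARD('d) + 3) ^ CARD('d))"
        using separated_cball_count[OF sep \<delta>(1), of _ 1] by (intro sum_mono) (simp add: numeral_3_eq_3)
      finally have "card (P \<inter> cball x r) \<le> card F * (2 * CARD('d) + 3) ^ CARD('d)" by simp
      then have "real (card (P \<inter> cball x r)) \<le> real (card F * (2 * CARD('d) + 3) ^ CARD('d))" by (rule of_nat_mono)
      then have "real (card (P \<inter> cball x r)) \<le> real (card F) * c" by (simp only: c_def of_nat_mult)
      then have "real (card (P \<inter> cball x r)) / c \<le> real (card F)" using c by (simp add: divide_simps)
      then show "ennreal (real (card (P \<inter> cball x r)) / c) \<le> of_nat (card F)"
        unfolding ennreal_of_nat_eq_real_of_nat by (rule ennreal_leI)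
    qed
    also have "\<dots> \<le> ennreal C\<^sub>F * covering_number \<delta> P * ennreal (r powr t)"
      using assms(4) r True by (auto simp: delta_s_set_def)
    also have "\<dots> \<le> ennreal C\<^sub>F * of_nat (card P) * ennreal (r powr t)"
      using P by (intro mult_right_mono mult_left_mono) auto
    also have "\<dots> = ennreal (C\<^sub>F * real (card P) * r powr t)"
      using CF by (simp add: ennreal_mult ennreal_of_nat_eq_real_of_nat)
    finally have "real (card (P \<inter> cball x r)) / c \<le> C\<^sub>F * real (card P) * r powr t"
      using CF by (simp add: ennreal_le_iff)
    then show ?thesis using c unfolding c_def[symmetric] by (simp add: divide_simps mult_ac)
  qed
qed

section \<open>Pointwise bound for the low part\<close>

lemma int_lattice_sum_bounded:
  "\<exists>S\<ge>0. \<forall>Z :: int set. finite Z \<longrightarrow> (\<Sum>z\<in>Z. 1 / (1 + (real_of_int z)\<^sup>2)) \<le> S"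
proof -
  let ?f = "\<lambda>n::nat. 1 / (1 + (real n)\<^sup>2)"
  have sm: "summable ?f"
  proof (rule summable_comparison_test)
    show "\<exists>N. \<forall>n\<ge>N. norm (?f n) \<le> inverse (real n ^ 2)"
      by (intro exI[of _ 1]) (auto simp: inverse_eq_divide intro!: divide_left_mono mult_pos_pos add_pos_nonneg)
    show "summable (\<lambda>n. inverse (real n ^ 2))" by (rule inverse_power_summable) simp
  qed
  have sym: "(\<Sum>z\<in>{- int N..int N}. 1 / (1 + (real_of_int z)\<^sup>2)) \<le> 2 * (\<Sum>n\<le>N. ?f n)" for N
  proof (induction N)
    case (Suc N)
    have "{- int (Suc N)..int (Suc N)} = insert (- int (Suc N)) (insert (int (Suc N)) {- int N..int N})"
      by auto
    moreover have "(- 1 - real N)\<^sup>2 = (1 + real N)\<^sup>2" by (simp add: power2_eq_square algebra_simps)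
    ultimately show ?case using Suc.IH by simp
  qed simp
  have "(\<Sum>z\<in>Z. 1 / (1 + (real_of_int z)\<^sup>2)) \<le> 2 * suminf ?f" if "finite Z" for Z :: "int set"
  proof -
    have "\<exists>N. Z \<subseteq> {- int N..int N}"
    proof (intro exI subsetI)
      fix z assume "z \<in> Z"
      then have "nat \<bar>z\<bar> \<le> Max ((\<lambda>z. nat \<bar>z\<bar>) ` Z)" using that by simp
      then show "z \<in> {- int (Max ((\<lambda>z. nat \<bar>z\<bar>) ` Z))..int (Max ((\<lambda>z. nat \<bar>z\<bar>) ` Z))}" by auto
    qed
    then obtain N where N: "Z \<subseteq> {- int N..int N}" by blast
    have "(\<Sum>z\<in>Z. 1 / (1 + (real_of_int z)\<^sup>2)) \<le> (\<Sum>z\<in>{- int N..int N}. 1 / (1 + (real_of_int z)\<^sup>2))"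
      using N by (intro sum_mono2) auto
    also have "\<dots> \<le> 2 * (\<Sum>n\<le>N. ?f n)" by (rule sym)
    also have "\<dots> \<le> 2 * suminf ?f" using sm by (intro mult_left_mono sum_le_suminf) auto
    finally show ?thesis .
  qed
  moreover have "2 * suminf ?f \<ge> 0" using sm by (simp add: suminf_nonneg)
  ultimately show ?thesis by blast
qed

text \<open>Only the summability of the weight over the integers matters, and quadratic decay is enough for that.\<close>

lemma gauss_le_lattice_weight:
  assumes \<rho>: "0 < \<rho>" and s: "\<rho>\<^sup>2 \<le> s" "s \<le> M * \<rho>\<^sup>2" and M: "1 \<le> M"
  shows "gauss s x \<le> (6 * M / (1 + (real_of_int \<lfloor>x / \<rho>\<rfloor>)\<^sup>2)) / \<rho>"
proof -
  have s0: "s > 0" using s(1) \<rho> by (meson less_le_trans zero_less_power)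
  define y where "y = x / \<rho>"
  have "\<rho> = sqrt (\<rho>\<^sup>2)" using \<rho> by simp
  also have "\<dots> \<le> sqrt (2 * pi * s)"
  proof (rule real_sqrt_le_mono)
    have "1 * s \<le> 2 * pi * s" using s0 pi_gt3 by (intro mult_right_mono) auto
    then show "\<rho>\<^sup>2 \<le> 2 * pi * s" using s(1) by simp
  qed
  finally have "gauss s x \<le> exp (- x\<^sup>2 / (2 * s)) / \<rho>"
    using s0 \<rho> by (simp add: gauss_eq frac_le)
  moreover have "exp (- x\<^sup>2 / (2 * s)) \<le> 6 * M / (1 + (real_of_int \<lfloor>y\<rfloor>)\<^sup>2)"
  proof -
    have "y\<^sup>2 / (2 * M) = x\<^sup>2 / (2 * (M * \<rho>\<^sup>2))" by (simp add: y_def power_divide)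
    also have "\<dots> \<le> x\<^sup>2 / (2 * s)" using s s0 \<rho> M by (intro divide_left_mono mult_pos_pos) auto
    finally have "1 + y\<^sup>2 / (2 * M) \<le> exp (x\<^sup>2 / (2 * s))"
      using exp_ge_add_one_self[of "x\<^sup>2 / (2 * s)"] by linarith
    moreover have "0 < 1 + y\<^sup>2 / (2 * M)" using M by (intro add_pos_nonneg) auto
    ultimately have "exp (- x\<^sup>2 / (2 * s)) \<le> 1 / (1 + y\<^sup>2 / (2 * M))"
      by (simp add: exp_minus inverse_eq_divide frac_le)
    also have "\<dots> = 2 * M / (2 * M + y\<^sup>2)" using M by (simp add: field_simps)
    also have "\<dots> \<le> 2 * M / (1 + y\<^sup>2)" using M by (intro divide_left_mono mult_pos_pos add_pos_nonneg) auto
    also have "\<dots> \<le> 2 * M * (3 / (1 + (real_of_int \<lfloor>y\<rfloor>)\<^sup>2))"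
    proof -
      have arith: "a \<le> 2 * b + 2 \<Longrightarrow> 0 \<le> b \<Longrightarrow> 1 + a \<le> 3 * (1 + b)" for a b :: real by simp
      have "\<bar>real_of_int \<lfloor>y\<rfloor>\<bar> \<le> \<bar>y\<bar> + 1" by linarith
      then have "(real_of_int \<lfloor>y\<rfloor>)\<^sup>2 \<le> (\<bar>y\<bar> + 1)\<^sup>2" by (metis abs_ge_zero power2_abs power_mono)
      also have "\<dots> \<le> 2 * y\<^sup>2 + 2" using zero_le_power2[of "\<bar>y\<bar> - 1"] by (simp add: power2_eq_square algebra_simps)
      finally have "1 + (real_of_int \<lfloor>y\<rfloor>)\<^sup>2 \<le> 3 * (1 + y\<^sup>2)"
        by (rule arith) simp
      moreover have "0 < 1 + y\<^sup>2" "0 < 1 + (real_of_int \<lfloor>y\<rfloor>)\<^sup>2" by (auto intro: add_pos_nonneg)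
      ultimately have "1 / (1 + y\<^sup>2) \<le> 3 / (1 + (real_of_int \<lfloor>y\<rfloor>)\<^sup>2)" by (simp add: divide_simps mult.commute)
      then have "2 * M * (1 / (1 + y\<^sup>2)) \<le> 2 * M * (3 / (1 + (real_of_int \<lfloor>y\<rfloor>)\<^sup>2))" using M by (intro mult_left_mono) auto
      then show ?thesis by simp
    qed
    finally show ?thesis by simp
  qed
  ultimately show ?thesis using \<rho> unfolding y_def[symmetric] by (meson divide_right_mono less_imp_le order.trans)
qed

text \<open>Cells are cut out by the integer parts of the horizontal coordinates and of the defects, both divided
  by \<open>\<rho>\<close>. A cell has diameter of order \<open>\<rho>\<close>, hence at most \<open>B\<close> points. Each horizontal direction has
  \<open>O(1 / \<rho>)\<close> cells over the unit ball, and each vertical direction contributes the sum of a Gaussian of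
  height \<open>1 / \<rho>\<close> over a grid of its own width, which is \<open>O(1 / \<rho>)\<close> as well.\<close>

lemma profile_le:
  fixes I :: "'d::finite set" and c R M :: real
  assumes "c \<ge> 0" "R > 0" "M \<ge> 1"
  shows "\<exists>C\<ge>0. \<forall>P B \<rho> s \<theta>. finite P \<longrightarrow> P \<subseteq> cball 0 1 \<longrightarrow> 0 < \<rho> \<longrightarrow> \<rho> \<le> R \<longrightarrow> \<rho>\<^sup>2 \<le> s \<longrightarrow> s \<le> M * \<rho>\<^sup>2
    \<longrightarrow> (\<forall>k\<in>-I. \<forall>i\<in>I. \<bar>snd (\<theta> k) i\<bar> \<le> c)
    \<longrightarrow> (\<forall>x. real (card (P \<inter> cball x (real CARD('d) * (1 + real CARD('d) * c) * \<rho>))) \<le> B)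
    \<longrightarrow> profile I P \<theta> s \<le> C * B / \<rho> ^ CARD('d)"
proof -
  obtain S where S: "S \<ge> 0" "\<And>Z :: int set. finite Z \<Longrightarrow> (\<Sum>z\<in>Z. 1 / (1 + (real_of_int z)\<^sup>2)) \<le> S"
    using int_lattice_sum_bounded by blast
  define C1 where "C1 = max (2 + 2 * R) (6 * M * S)"
  have C1: "C1 \<ge> 0" using assms by (simp add: C1_def)
  have main: "profile I P \<theta> s \<le> C1 ^ CARD('d) * B / \<rho> ^ CARD('d)"
    if fin: "finite P" and P: "P \<subseteq> cball 0 1" and \<rho>: "0 < \<rho>" "\<rho> \<le> R" and s: "\<rho>\<^sup>2 \<le> s" "s \<le> M * \<rho>\<^sup>2"
      and slopes: "\<forall>k\<in>-I. \<forall>i\<in>I. \<bar>snd (\<theta> k) i\<bar> \<le> c"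
      and B: "\<forall>x. real (card (P \<inter> cball x (real CARD('d) * (1 + real CARD('d) * c) * \<rho>))) \<le> B"
    for P B \<rho> s \<theta>
  proof -
    define z where "z i p = \<lfloor>(if i \<in> I then p $ i else defect I \<theta> p i) / \<rho>\<rfloor>" for i and p :: "real ^ 'd"
    define cell where "cell p = (\<lambda>i. z i p)" for p
    define H where "H i n = (if i \<in> I then 1 else (6 * M / (1 + (real_of_int n)\<^sup>2)) / \<rho>)" for i :: 'd and n
    have H0: "H i n \<ge> 0" for i n using assms \<rho> by (auto simp: H_def intro!: divide_nonneg_nonneg add_nonneg_nonneg)
    have s0: "s > 0" using s(1) \<rho> by (meson less_le_trans zero_less_power)
    have B0: "B \<ge> 0" using B by (meson of_nat_0_le_iff order.trans)
    (* H is 1 in the horizontal coordinates, so that the product over all coordinates is the bound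
       for the bump; the sum over all cells then factors over the coordinates. *)
    have "bump I p s \<theta> \<le> (\<Prod>i\<in>UNIV. H i (cell p i))" for p
    proof -
      have "bump I p s \<theta> \<le> (\<Prod>k\<in>-I. H k (cell p k))"
        unfolding bump_def using s0 gauss_le_lattice_weight[OF \<rho>(1) s assms(3)]
        by (intro prod_mono) (auto simp: H_def cell_def z_def less_imp_le[OF gauss_pos])
      also have "\<dots> = (\<Prod>i\<in>UNIV. H i (cell p i))"
        by (rule prod.mono_neutral_left) (auto simp: H_def)
      finally show ?thesis .
    qed
    then have "profile I P \<theta> s \<le> (\<Sum>p\<in>P. \<Prod>i\<in>UNIV. H i (cell p i))"
      unfolding profile_def by (intro sum_mono)
    also have "\<dots> = (\<Sum>\<kappa>\<in>cell ` P. \<Sum>p\<in>{p\<in>P. cell p = \<kappa>}. \<Prod>i\<in>UNIV. H i (cell p i))"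
      using fin by (rule sum.image_gen)
    also have "\<dots> \<le> (\<Sum>\<kappa>\<in>cell ` P. B * (\<Prod>i\<in>UNIV. H i (\<kappa> i)))"
    proof (rule sum_mono)
      fix \<kappa> assume "\<kappa> \<in> cell ` P"
      then obtain p where p: "p \<in> P" "\<kappa> = cell p" by blast
      have "{q\<in>P. cell q = \<kappa>} \<subseteq> P \<inter> cball p (real CARD('d) * (1 + real CARD('d) * c) * \<rho>)"
      proof
        fix q assume "q \<in> {q\<in>P. cell q = \<kappa>}"
        then have q: "q \<in> P" "\<And>i. z i p = z i q" using p by (auto simp: cell_def fun_eq_iff)
        have close: "\<bar>x - y\<bar> \<le> \<rho>" if "\<lfloor>x / \<rho>\<rfloor> = \<lfloor>y / \<rho>\<rfloor>" for x y
        proof -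
          have "\<bar>x / \<rho> - y / \<rho>\<bar> \<le> 1" using that by linarith
          then show ?thesis using \<rho> by (simp add: diff_divide_distrib[symmetric] abs_divide)
        qed
        have I: "\<bar>p $ i - q $ i\<bar> \<le> \<rho>" if "i \<in> I" for i
          using close[of "p $ i" "q $ i"] q(2)[of i] that by (simp add: z_def)
        have all: "\<bar>p $ k - q $ k\<bar> \<le> (1 + real CARD('d) * c) * \<rho>" for k
        proof (cases "k \<in> I")
          case True
          have "1 * \<rho> \<le> (1 + real CARD('d) * c) * \<rho>" using assms \<rho> by (intro mult_right_mono) auto
          with I[OF True] show ?thesis by simp
        next
          case False
          have d: "\<bar>defect I \<theta> p k - defect I \<theta> q k\<bar> \<le> \<rho>"
            using close[of "defect I \<theta> p k" "defect I \<theta> q k"] q(2)[of k] False by (simp add: z_def)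
          have "\<bar>\<Sum>i\<in>I. snd (\<theta> k) i * (p $ i - q $ i)\<bar> \<le> (\<Sum>i\<in>I. c * \<rho>)"
          proof (intro order.trans[OF sum_abs] sum_mono)
            fix i assume "i \<in> I"
            then show "\<bar>snd (\<theta> k) i * (p $ i - q $ i)\<bar> \<le> c * \<rho>"
              unfolding abs_mult using slopes False I assms by (intro mult_mono) auto
          qed
          also have "\<dots> \<le> real CARD('d) * (c * \<rho>)"
            using assms \<rho> by (simp add: card_mono mult_right_mono)
          finally have "\<bar>\<Sum>i\<in>I. snd (\<theta> k) i * (p $ i - q $ i)\<bar> \<le> real CARD('d) * (c * \<rho>)" .
          moreover have "p $ k - q $ k = (defect I \<theta> p k - defect I \<theta> q k) + (\<Sum>i\<in>I. snd (\<theta> k) i * (p $ i - q $ i))"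
            by (simp add: defect_def right_diff_distrib sum_subtractf)
          ultimately show ?thesis using d by (simp add: algebra_simps)
        qed
        have "dist p q \<le> (\<Sum>k\<in>UNIV. \<bar>(p - q) $ k\<bar>)" unfolding dist_norm by (rule norm_le_l1_cart)
        also have "\<dots> \<le> (\<Sum>k\<in>(UNIV :: 'd set). (1 + real CARD('d) * c) * \<rho>)" using all by (intro sum_mono) simp
        finally show "q \<in> P \<inter> cball p (real CARD('d) * (1 + real CARD('d) * c) * \<rho>)" using q(1) by simp
      qed
      then have "card {q\<in>P. cell q = \<kappa>} \<le> card (P \<inter> cball p (real CARD('d) * (1 + real CARD('d) * c) * \<rho>))"
        using fin by (intro card_mono) auto
      then have "real (card {q\<in>P. cell q = \<kappa>}) \<le> B" using B by (meson of_nat_le_iff order.trans)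
      then show "(\<Sum>p\<in>{p\<in>P. cell p = \<kappa>}. \<Prod>i\<in>UNIV. H i (cell p i)) \<le> B * (\<Prod>i\<in>UNIV. H i (\<kappa> i))"
        using H0 by (auto intro!: mult_right_mono prod_nonneg)
    qed
    also have "\<dots> = B * (\<Sum>\<kappa>\<in>cell ` P. \<Prod>i\<in>UNIV. H i (\<kappa> i))" by (simp add: sum_distrib_left)
    also have "\<dots> \<le> B * (\<Sum>\<kappa>\<in>PiE UNIV (\<lambda>i. z i ` P). \<Prod>i\<in>UNIV. H i (\<kappa> i))"
      using B0 fin H0 by (intro mult_left_mono sum_mono2 finite_PiE prod_nonneg) (auto simp: cell_def)
    also have "\<dots> = B * (\<Prod>i\<in>UNIV. \<Sum>n\<in>z i ` P. H i n)"
      using fin by (subst prod_sum_PiE) auto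
    also have "\<dots> \<le> B * (\<Prod>i\<in>(UNIV :: 'd set). C1 / \<rho>)"
    proof (intro mult_left_mono[OF _ B0] prod_mono conjI)
      fix i :: 'd
      show "0 \<le> (\<Sum>n\<in>z i ` P. H i n)" using H0 by (intro sum_nonneg)
      show "(\<Sum>n\<in>z i ` P. H i n) \<le> C1 / \<rho>"
      proof (cases "i \<in> I")
        case True
        have "z i ` P \<subseteq> {\<lfloor>- 1 / \<rho>\<rfloor>..\<lfloor>1 / \<rho>\<rfloor>}"
        proof
          fix n assume "n \<in> z i ` P"
          then obtain p where p: "p \<in> P" "n = \<lfloor>p $ i / \<rho>\<rfloor>" using True by (auto simp: z_def)
          have "\<bar>p $ i\<bar> \<le> norm p" by (rule component_le_norm_cart)
          also have "norm p \<le> 1" using P p by auto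
          finally have "- 1 \<le> p $ i" "p $ i \<le> 1" by auto
          then show "n \<in> {\<lfloor>- 1 / \<rho>\<rfloor>..\<lfloor>1 / \<rho>\<rfloor>}"
            using \<rho> unfolding p(2) by (auto intro!: floor_mono divide_right_mono simp del: divide_minus_left)
        qed
        then have "card (z i ` P) \<le> card {\<lfloor>- 1 / \<rho>\<rfloor>..\<lfloor>1 / \<rho>\<rfloor>}" by (intro card_mono) auto
        also have "\<dots> = nat (\<lfloor>1 / \<rho>\<rfloor> - \<lfloor>- 1 / \<rho>\<rfloor> + 1)" by simp
        finally have "real (card (z i ` P)) \<le> real (nat (\<lfloor>1 / \<rho>\<rfloor> - \<lfloor>- 1 / \<rho>\<rfloor> + 1))" by linarith
        moreover have "\<lfloor>- 1 / \<rho>\<rfloor> \<le> \<lfloor>1 / \<rho>\<rfloor>" using \<rho> by (intro floor_mono) (simp add: divide_simps)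
        moreover have "- 1 / \<rho> = - (1 / \<rho>)" by simp
        ultimately have "real (card (z i ` P)) \<le> 2 * (1 / \<rho>) + 2" by linarith
        also have "\<dots> \<le> (2 + 2 * R) / \<rho>" using \<rho> by (simp add: field_simps)
        also have "\<dots> \<le> C1 / \<rho>" using \<rho> by (intro divide_right_mono) (auto simp: C1_def)
        finally show ?thesis using True by (simp add: H_def)
      next
        case False
        have "(\<Sum>n\<in>z i ` P. H i n) = (6 * M / \<rho>) * (\<Sum>n\<in>z i ` P. 1 / (1 + (real_of_int n)\<^sup>2))"
          using False by (simp add: H_def sum_distrib_left mult.commute)
        also have "\<dots> \<le> (6 * M / \<rho>) * S" using S(2) fin assms \<rho> by (intro mult_left_mono) auto
        also have "\<dots> = (6 * M * S) / \<rho>" by simp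
        also have "\<dots> \<le> C1 / \<rho>" using \<rho> by (intro divide_right_mono) (auto simp: C1_def)
        finally show ?thesis .
      qed
    qed
    finally show ?thesis by (simp add: power_divide mult.commute)
  qed
  show ?thesis using C1 by (intro exI[of _ "C1 ^ CARD('d)"] conjI allI impI main) auto
qed

section \<open>Cubes of parameters\<close>

definition param_cube :: "'d::finite set \<Rightarrow> ('d \<Rightarrow> real \<times> ('d \<Rightarrow> real)) \<Rightarrow> real \<Rightarrow> ('d \<Rightarrow> real \<times> ('d \<Rightarrow> real)) set"
  where "param_cube I \<theta> r = (\<Pi>\<^sub>E k\<in>-I. {fst (\<theta> k) - r<..<fst (\<theta> k) + r} \<times>
    (\<Pi>\<^sub>E i\<in>I. {snd (\<theta> k) i - r<..<snd (\<theta> k) i + r}))"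

lemma std_gauss_interval:
  assumes "0 < r" "r \<le> 1" "\<bar>x\<bar> \<le> c"
  shows "ennreal (2 * r * std_normal_density (c + 1)) \<le> emeasure std_gauss {x - r<..<x + r}"
    and "0 < r' \<Longrightarrow> emeasure std_gauss {x - r'<..<x + r'} \<le> ennreal (2 * r')"
proof -
  have em: "emeasure std_gauss {x - r<..<x + r}
      = (\<integral>\<^sup>+y. ennreal (std_normal_density y) * indicator {x - r<..<x + r} y \<partial>lborel)" for r
    by (subst emeasure_density) auto
  have const: "(\<integral>\<^sup>+y. ennreal u * indicator {x - r<..<x + r} y \<partial>lborel) = ennreal (2 * r * u)"
    if "r > 0" "u \<ge> 0" for r u
    using that by (subst nn_integral_cmult_indicator) (auto simp: ennreal_mult'[symmetric] mult.commute)
  have "ennreal (2 * r * std_normal_density (c + 1))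
      = (\<integral>\<^sup>+y. ennreal (std_normal_density (c + 1)) * indicator {x - r<..<x + r} y \<partial>lborel)"
    using assms by (subst const) auto
  also have "\<dots> \<le> (\<integral>\<^sup>+y. ennreal (std_normal_density y) * indicator {x - r<..<x + r} y \<partial>lborel)"
  proof (rule nn_integral_mono)
    fix y :: real
    have "std_normal_density (c + 1) \<le> std_normal_density y" if "y \<in> {x - r<..<x + r}"
    proof -
      have "\<bar>y\<bar> \<le> c + 1" using that assms by auto
      then have "y\<^sup>2 \<le> (c + 1)\<^sup>2" by (metis abs_ge_zero power2_abs power_mono)
      then show ?thesis by (simp add: std_normal_density_def divide_right_mono)
    qed
    then show "ennreal (std_normal_density (c + 1)) * indicator {x - r<..<x + r} y
        \<le> ennreal (std_normal_density y) * indicator {x - r<..<x + r} y"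
      by (auto simp: indicator_def intro: ennreal_leI)
  qed
  finally show "ennreal (2 * r * std_normal_density (c + 1)) \<le> emeasure std_gauss {x - r<..<x + r}"
    by (simp only: em)
  assume r': "0 < r'"
  have "emeasure std_gauss {x - r'<..<x + r'} \<le> (\<integral>\<^sup>+y. ennreal 1 * indicator {x - r'<..<x + r'} y \<partial>lborel)"
    unfolding em
  proof (rule nn_integral_mono)
    fix y :: real
    have "exp (- y\<^sup>2 / 2) \<le> 1" by simp
    moreover have "1 \<le> sqrt (2 * pi)" using pi_gt3 by simp
    ultimately have "exp (- y\<^sup>2 / 2) / sqrt (2 * pi) \<le> 1 / 1" by (intro frac_le) auto
    then have "std_normal_density y \<le> 1" by (simp add: std_normal_density_def)
    then show "ennreal (std_normal_density y) * indicator {x - r'<..<x + r'} y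
        \<le> ennreal 1 * indicator {x - r'<..<x + r'} y"
      by (intro mult_right_mono ennreal_leI) auto
  qed
  also have "\<dots> = ennreal (2 * r')" using r' by (subst const) auto
  finally show "emeasure std_gauss {x - r'<..<x + r'} \<le> ennreal (2 * r')" .
qed

lemma row_cube_sets: "{b - r<..<b + r} \<times> (\<Pi>\<^sub>E i\<in>I. {a i - r<..<a i + r}) \<in> sets (row_measure I)"
  if "finite I" for a :: "'d \<Rightarrow> real"
  unfolding row_measure_def using that by (intro pair_measureI sets_PiM_I_finite) auto

lemma emeasure_row_cube:
  assumes "finite I"
  shows "emeasure (row_measure I) ({b - r<..<b + r} \<times> (\<Pi>\<^sub>E i\<in>I. {a i - r<..<a i + r}))
    = emeasure lborel {b - r<..<b + r} * (\<Prod>i\<in>I. emeasure std_gauss {a i - r<..<a i + r})"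
proof -
  interpret S: product_sigma_finite "\<lambda>_. std_gauss"
    by (intro product_sigma_finite.intro prob_space_imp_sigma_finite prob_space_normal_density) simp
  interpret sigma_finite_measure "PiM I (\<lambda>_. std_gauss)"
    by (intro prob_space_imp_sigma_finite prob_space_slopes)
  show ?thesis unfolding row_measure_def
    using assms by (subst emeasure_pair_measure_Times) (auto intro!: sets_PiM_I_finite simp: S.emeasure_PiM)
qed

lemma param_cube_sets: "param_cube I \<theta> r \<in> sets (graph_measure I)"
  unfolding param_cube_def graph_measure_def by (intro sets_PiM_I_finite row_cube_sets) auto

lemma param_cube_emeasure:
  "emeasure (graph_measure I) (param_cube I \<theta> r)
    = (\<Prod>k\<in>-I. emeasure lborel {fst (\<theta> k) - r<..<fst (\<theta> k) + r}
        * (\<Prod>i\<in>I. emeasure std_gauss {snd (\<theta> k) i - r<..<snd (\<theta> k) i + r}))"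
proof -
  interpret product_sigma_finite "\<lambda>_. row_measure I" by (rule product_sigma_finite_row)
  show ?thesis unfolding param_cube_def graph_measure_def
    by (subst emeasure_PiM) (auto intro!: row_cube_sets simp: emeasure_row_cube)
qed

lemma prod_mono_ennreal: "(\<And>i. i \<in> A \<Longrightarrow> f i \<le> g i) \<Longrightarrow> prod f A \<le> (prod g A :: ennreal)"
  by (induction A rule: infinite_finite_induct) (auto intro: mult_mono)

lemma param_cube_measure_le:
  assumes "r > 0"
  shows "emeasure (graph_measure I) (param_cube I \<theta> r) \<le> ennreal ((2 * r) ^ (card (- I) * Suc (card I)))"
proof -
  have "emeasure (graph_measure I) (param_cube I \<theta> r) \<le> (\<Prod>k\<in>-I. ennreal (2 * r) * (\<Prod>i\<in>I. ennreal (2 * r)))"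
    unfolding param_cube_emeasure using assms std_gauss_interval(2)[of 1]
    by (intro prod_mono_ennreal mult_mono) auto
  also have "\<dots> = (\<Prod>k\<in>-I. ennreal ((2 * r) ^ Suc (card I)))"
  proof -
    have "ennreal u * (\<Prod>i\<in>I. ennreal u) = ennreal (u ^ Suc (card I))" if "u \<ge> 0" for u
      using that by (simp add: ennreal_mult ennreal_power)
    then show ?thesis using assms by (metis (no_types, lifting) less_imp_le mult_pos_pos prod.cong zero_less_numeral)
  qed
  also have "\<dots> = ennreal ((2 * r) ^ (card (- I) * Suc (card I)))"
  proof -
    have pw: "(\<Prod>k\<in>-I. ennreal (u ^ Suc (card I))) = ennreal (u ^ (card (- I) * Suc (card I)))" if "u \<ge> 0" for u
      unfolding prod_constant mult.commute[of "card (- I)"] power_mult using that by (intro ennreal_power) simp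
    show ?thesis by (rule pw) (use assms in simp)
  qed
  finally show ?thesis .
qed

text \<open>The lower bound needs bounded slopes, where the Gaussian density does not degenerate.\<close>

lemma param_cube_measure_ge:
  assumes "0 < r" "r \<le> 1" "\<And>k i. k \<in> - I \<Longrightarrow> i \<in> I \<Longrightarrow> \<bar>snd (\<theta> k) i\<bar> \<le> c"
  shows "std_normal_density (c + 1) ^ (card (- I) * card I) * (2 * r) ^ (card (- I) * Suc (card I))
    \<le> measure (graph_measure I) (param_cube I \<theta> r)"
proof -
  let ?g = "std_normal_density (c + 1)"
  have "ennreal (?g ^ (card (- I) * card I) * (2 * r) ^ (card (- I) * Suc (card I)))
      = (\<Prod>k\<in>-I. ennreal (2 * r * (2 * r * ?g) ^ card I))"
    using assms by (subst prod_ennreal)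
      (auto simp: power_mult[symmetric] power_mult_distrib power_mult[of _ "card (- I)"] mult_ac power_add intro!: arg_cong[of _ _ ennreal])
  also have "\<dots> = (\<Prod>k\<in>-I. ennreal (2 * r) * (\<Prod>i\<in>I. ennreal (2 * r * ?g)))"
  proof -
    have "ennreal (2 * r * (2 * r * ?g) ^ card I) = ennreal (2 * r) * (\<Prod>i\<in>I. ennreal (2 * r * ?g))"
      using assms by (subst ennreal_mult) (auto simp: ennreal_power[symmetric])
    then show ?thesis by simp
  qed
  also have "\<dots> \<le> emeasure (graph_measure I) (param_cube I \<theta> r)"
    unfolding param_cube_emeasure using assms std_gauss_interval(1)[of r _ c]
    by (intro prod_mono_ennreal mult_mono) auto
  finally have le: "ennreal (?g ^ (card (- I) * card I) * (2 * r) ^ (card (- I) * Suc (card I)))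
      \<le> emeasure (graph_measure I) (param_cube I \<theta> r)" .
  moreover have "emeasure (graph_measure I) (param_cube I \<theta> r) < \<infinity>"
    using param_cube_measure_le[OF assms(1), of I \<theta>] by (auto intro: le_less_trans)
  ultimately have "enn2real (ennreal (?g ^ (card (- I) * card I) * (2 * r) ^ (card (- I) * Suc (card I))))
      \<le> measure (graph_measure I) (param_cube I \<theta> r)"
    unfolding measure_def by (intro enn2real_mono) auto
  then show ?thesis using assms(1) by (subst (asm) enn2real_ennreal) auto
qed

lemma param_cubeD:
  assumes "x \<in> param_cube I \<theta> r" "k \<in> - I"
  shows "\<bar>fst (x k) - fst (\<theta> k)\<bar> < r" and "i \<in> I \<Longrightarrow> \<bar>snd (x k) i - snd (\<theta> k) i\<bar> < r"
    and "i \<notin> I \<Longrightarrow> snd (x k) i = undefined"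
proof -
  have "x k \<in> {fst (\<theta> k) - r<..<fst (\<theta> k) + r} \<times> (\<Pi>\<^sub>E i\<in>I. {snd (\<theta> k) i - r<..<snd (\<theta> k) i + r})"
    using assms unfolding param_cube_def by (rule PiE_mem)
  then have *: "fst (x k) \<in> {fst (\<theta> k) - r<..<fst (\<theta> k) + r}"
    "snd (x k) \<in> (\<Pi>\<^sub>E i\<in>I. {snd (\<theta> k) i - r<..<snd (\<theta> k) i + r})"
    by (simp_all only: mem_Times_iff)
  then show "\<bar>fst (x k) - fst (\<theta> k)\<bar> < r" by auto
  show "\<bar>snd (x k) i - snd (\<theta> k) i\<bar> < r" if "i \<in> I" using PiE_mem[OF *(2) that] by auto
  show "snd (x k) i = undefined" if "i \<notin> I" using *(2) that by (rule PiE_arb)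
qed

lemma param_cube_disjoint:
  assumes "(\<exists>k\<in>-I. 2 * r \<le> \<bar>fst (\<theta> k) - fst (\<theta>' k)\<bar>) \<or> (\<exists>k\<in>-I. \<exists>i\<in>I. 2 * r \<le> \<bar>snd (\<theta> k) i - snd (\<theta>' k) i\<bar>)"
  shows "param_cube I \<theta> r \<inter> param_cube I \<theta>' r = {}"
proof (rule ccontr)
  assume "param_cube I \<theta> r \<inter> param_cube I \<theta>' r \<noteq> {}"
  then obtain x where x: "x \<in> param_cube I \<theta> r" "x \<in> param_cube I \<theta>' r" by blast
  from assms show False
  proof (elim disjE bexE)
    fix k assume "k \<in> - I" "2 * r \<le> \<bar>fst (\<theta> k) - fst (\<theta>' k)\<bar>"
    then show False using param_cubeD(1)[OF x(1), of k] param_cubeD(1)[OF x(2), of k] by linarith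
  next
    fix k i assume "k \<in> - I" "i \<in> I" "2 * r \<le> \<bar>snd (\<theta> k) i - snd (\<theta>' k) i\<bar>"
    then show False using param_cubeD(2)[OF x(1), of k i] param_cubeD(2)[OF x(2), of k i] by linarith
  qed
qed

lemma sum_weights_disjoint_le:
  fixes w :: "'b \<Rightarrow> real"
  assumes "finite T" and disj: "disjoint_family_on A T" and sets: "\<And>\<theta>. \<theta> \<in> T \<Longrightarrow> A \<theta> \<in> sets M"
    and fin: "\<And>\<theta>. \<theta> \<in> T \<Longrightarrow> emeasure M (A \<theta>) < \<top>"
    and G: "integrable M G" "\<And>x. 0 \<le> G x" and w: "\<And>\<theta> x. \<theta> \<in> T \<Longrightarrow> x \<in> A \<theta> \<Longrightarrow> w \<theta> \<le> G x"
  shows "(\<Sum>\<theta>\<in>T. w \<theta> * measure M (A \<theta>)) \<le> (\<integral>x. G x \<partial>M)"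
proof -
  have int: "integrable M (\<lambda>x. w \<theta> * indicator (A \<theta>) x)" if "\<theta> \<in> T" for \<theta>
    using sets[OF that] fin[OF that] by auto
  have "(\<Sum>\<theta>\<in>T. w \<theta> * measure M (A \<theta>)) = (\<integral>x. (\<Sum>\<theta>\<in>T. w \<theta> * indicator (A \<theta>) x) \<partial>M)"
    using int sets by (subst Bochner_Integration.integral_sum) (auto intro!: sum.cong)
  also have "\<dots> \<le> (\<integral>x. G x \<partial>M)"
  proof (rule integral_mono)
    fix x
    show "(\<Sum>\<theta>\<in>T. w \<theta> * indicator (A \<theta>) x) \<le> G x"
    proof (cases "\<exists>\<theta>\<in>T. x \<in> A \<theta>")
      case True
      then obtain \<theta> where \<theta>: "\<theta> \<in> T" "x \<in> A \<theta>" by blast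
      have "(\<Sum>\<theta>'\<in>T. w \<theta>' * indicator (A \<theta>') x) = (\<Sum>\<theta>'\<in>T. if \<theta>' = \<theta> then w \<theta> else 0)"
      proof (intro sum.cong refl)
        fix \<theta>' assume "\<theta>' \<in> T"
        then show "w \<theta>' * indicator (A \<theta>') x = (if \<theta>' = \<theta> then w \<theta> else 0)"
          using disj \<theta> by (auto simp: disjoint_family_on_def indicator_def)
      qed
      then show ?thesis using assms(1) \<theta> w by simp
    next
      case False
      then have "(\<Sum>\<theta>\<in>T. w \<theta> * indicator (A \<theta>) x) = 0" by (intro sum.neutral) auto
      then show ?thesis using G(2) by simp
    qed
  qed (use int G in auto)
  finally show ?thesis .
qed

text \<open>Changing each parameter by at most \<open>\<delta>\<close> moves a graph by at most \<open>(1 + CARD('d)) \<delta>\<close> over the unit ball.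
  So a point counted for the centre \<open>\<theta>\<close> has defects at most \<open>(a + 1 + CARD('d)) \<delta>\<close> for all parameters
  in the cube, and a Gaussian of width \<open>\<delta>\<close> is at least \<open>gauss 1 (a + 1 + CARD('d)) / \<delta>\<close> there.\<close>

lemma incidence_count_le_profile:
  fixes I :: "'d::finite set" and P :: "(real ^ 'd) set"
  assumes fin: "finite P" and P: "P \<subseteq> cball 0 1" and \<delta>: "0 < \<delta>" and r: "r \<le> \<delta>"
    and x: "x \<in> param_cube I \<theta> r"
  shows "real (card {p\<in>P. \<forall>k\<in>-I. \<bar>defect I \<theta> p k\<bar> \<le> a * \<delta>})
      * (gauss 1 (a + 1 + real CARD('d)) / \<delta>) ^ card (- I) \<le> profile I P x (\<delta>\<^sup>2)"
proof -
  define g where "g = gauss 1 (a + 1 + real CARD('d))"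
  let ?Q = "{p\<in>P. \<forall>k\<in>-I. \<bar>defect I \<theta> p k\<bar> \<le> a * \<delta>}"
  have "(g / \<delta>) ^ card (- I) \<le> bump I p (\<delta>\<^sup>2) x" if p: "p \<in> ?Q" for p
  proof -
    have "g / \<delta> \<le> gauss (\<delta>\<^sup>2) (defect I x p k)" if k: "k \<in> - I" for k
    proof -
      have "\<bar>\<Sum>i\<in>I. (snd (x k) i - snd (\<theta> k) i) * p $ i\<bar> \<le> (\<Sum>i\<in>I. \<delta> * 1)"
      proof (intro order.trans[OF sum_abs] sum_mono)
        fix i assume "i \<in> I"
        have "\<bar>p $ i\<bar> \<le> norm p" by (rule component_le_norm_cart)
        then have "\<bar>p $ i\<bar> \<le> 1" using P p by auto
        then show "\<bar>(snd (x k) i - snd (\<theta> k) i) * p $ i\<bar> \<le> \<delta> * 1"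
          unfolding abs_mult using param_cubeD(2)[OF x k \<open>i \<in> I\<close>] r \<delta> by (intro mult_mono) auto
      qed
      also have "\<dots> \<le> real CARD('d) * \<delta>" using \<delta> by (simp add: card_mono)
      finally have "\<bar>\<Sum>i\<in>I. (snd (x k) i - snd (\<theta> k) i) * p $ i\<bar> \<le> real CARD('d) * \<delta>" .
      moreover have "defect I x p k = defect I \<theta> p k - (fst (x k) - fst (\<theta> k)) - (\<Sum>i\<in>I. (snd (x k) i - snd (\<theta> k) i) * p $ i)"
        by (simp add: defect_def left_diff_distrib sum_subtractf)
      moreover have "\<bar>defect I \<theta> p k\<bar> \<le> a * \<delta>" using p k by auto
      ultimately have "\<bar>defect I x p k\<bar> \<le> a * \<delta> + \<delta> + real CARD('d) * \<delta>" using param_cubeD(1)[OF x k] r by linarith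
      then have "\<bar>defect I x p k\<bar> \<le> (a + 1 + real CARD('d)) * \<delta>" by (simp add: algebra_simps)
      then have "(defect I x p k)\<^sup>2 \<le> ((a + 1 + real CARD('d)) * \<delta>)\<^sup>2" by (metis abs_ge_zero power2_abs power_mono)
      then have "(defect I x p k)\<^sup>2 / (2 * \<delta>\<^sup>2) \<le> (a + 1 + real CARD('d))\<^sup>2 / 2"
        using \<delta> by (simp add: power_mult_distrib divide_simps)
      then have "exp (- ((a + 1 + real CARD('d))\<^sup>2 / 2)) \<le> exp (- ((defect I x p k)\<^sup>2 / (2 * \<delta>\<^sup>2)))" by simp
      then have "exp (- ((a + 1 + real CARD('d))\<^sup>2 / 2)) / (sqrt (2 * pi) * \<delta>)
          \<le> exp (- ((defect I x p k)\<^sup>2 / (2 * \<delta>\<^sup>2))) / (sqrt (2 * pi) * \<delta>)"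
        using \<delta> by (intro divide_right_mono) auto
      then show ?thesis using \<delta> by (simp add: g_def gauss_eq real_sqrt_mult)
    qed
    then have "(\<Prod>k\<in>-I. g / \<delta>) \<le> bump I p (\<delta>\<^sup>2) x"
      unfolding bump_def using \<delta> by (intro prod_mono) (auto simp: g_def intro!: divide_nonneg_nonneg less_imp_le[OF gauss_pos])
    then show ?thesis by simp
  qed
  then have "(\<Sum>p\<in>?Q. (g / \<delta>) ^ card (- I)) \<le> (\<Sum>p\<in>?Q. bump I p (\<delta>\<^sup>2) x)" by (intro sum_mono)
  also have "\<dots> \<le> profile I P x (\<delta>\<^sup>2)"
    unfolding profile_def using fin \<delta> by (intro sum_mono2) (auto intro: bump_nonneg)
  finally show ?thesis by (simp add: g_def)
qed

definition bounded_params :: "'d::finite set \<Rightarrow> real \<Rightarrow> ('d \<Rightarrow> real \<times> ('d \<Rightarrow> real)) \<Rightarrow> bool"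
  where "bounded_params I c \<theta> \<longleftrightarrow> (\<forall>k\<in>-I. \<bar>fst (\<theta> k)\<bar> \<le> c \<and> (\<forall>i\<in>I. \<bar>snd (\<theta> k) i\<bar> \<le> c))"

definition separated_params :: "'d::finite set \<Rightarrow> real \<Rightarrow> ('d \<Rightarrow> real \<times> ('d \<Rightarrow> real)) \<Rightarrow> ('d \<Rightarrow> real \<times> ('d \<Rightarrow> real)) \<Rightarrow> bool"
  where "separated_params I r \<theta> \<theta>' \<longleftrightarrow> (\<exists>k\<in>-I. r \<le> \<bar>fst (\<theta> k) - fst (\<theta>' k)\<bar>)
    \<or> (\<exists>k\<in>-I. \<exists>i\<in>I. r \<le> \<bar>snd (\<theta> k) i - snd (\<theta>' k) i\<bar>)"

definition separated_family :: "'d::finite set \<Rightarrow> real \<Rightarrow> real \<Rightarrow> ('d \<Rightarrow> real \<times> ('d \<Rightarrow> real)) set \<Rightarrow> bool"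
  where "separated_family I c r T \<longleftrightarrow> finite T \<and> (\<forall>\<theta>\<in>T. bounded_params I c \<theta>)
    \<and> (\<forall>\<theta>\<in>T. \<forall>\<theta>'\<in>T. \<theta> \<noteq> \<theta>' \<longrightarrow> separated_params I r \<theta> \<theta>')"

lemma param_cubes_disjoint_family:
  assumes "separated_family I c (2 * r) T"
  shows "disjoint_family_on (\<lambda>\<theta>. param_cube I \<theta> r) T"
  unfolding disjoint_family_on_def
proof (intro ballI impI)
  fix \<theta> \<theta>' assume "\<theta> \<in> T" "\<theta>' \<in> T" "\<theta> \<noteq> \<theta>'"
  then have "separated_params I (2 * r) \<theta> \<theta>'" using assms by (simp add: separated_family_def)
  then show "param_cube I \<theta> r \<inter> param_cube I \<theta>' r = {}"
    unfolding separated_params_def by (rule param_cube_disjoint)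
qed

lemma param_cube_emeasure_finite: "r > 0 \<Longrightarrow> emeasure (graph_measure I) (param_cube I \<theta> r) < \<top>"
  using param_cube_measure_le[of r I \<theta>] by (auto intro: le_less_trans)

lemma param_cube_measure_real_le:
  assumes "r > 0"
  shows "measure (graph_measure I) (param_cube I \<theta> r) \<le> (2 * r) ^ (card (- I) * Suc (card I))"
proof -
  have "measure (graph_measure I) (param_cube I \<theta> r) \<le> enn2real (ennreal ((2 * r) ^ (card (- I) * Suc (card I))))"
    unfolding measure_def by (rule enn2real_mono[OF param_cube_measure_le[OF assms] ennreal_less_top])
  also have "\<dots> = (2 * r) ^ (card (- I) * Suc (card I))"
    by (rule enn2real_ennreal, rule zero_le_power) (use assms in simp)
  finally show ?thesis .
qed

lemma param_cube_bounded:
  assumes "x \<in> param_cube I \<theta> r" "bounded_params I c \<theta>" "r \<le> 1"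
  shows "x \<in> param_cube I (\<lambda>_. (0, \<lambda>_. 0)) (c + 1)" "bounded_params I (c + 1) x"
proof -
  have b: "\<bar>fst (x k)\<bar> < c + 1" if k: "k \<in> - I" for k
  proof -
    have "\<bar>fst (\<theta> k)\<bar> \<le> c" using assms(2) k by (simp add: bounded_params_def)
    with param_cubeD(1)[OF assms(1) k] assms(3) show ?thesis by linarith
  qed
  have a: "\<bar>snd (x k) i\<bar> < c + 1" if k: "k \<in> - I" and i: "i \<in> I" for k i
  proof -
    have "\<bar>snd (\<theta> k) i\<bar> \<le> c" using assms(2) k i by (simp add: bounded_params_def)
    with param_cubeD(2)[OF assms(1) k i] assms(3) show ?thesis by linarith
  qed
  show "bounded_params I (c + 1) x"
    unfolding bounded_params_def using a b by (simp add: less_imp_le)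
  have "x k \<in> {- (c + 1)<..<c + 1} \<times> (\<Pi>\<^sub>E i\<in>I. {- (c + 1)<..<c + 1})" if k: "k \<in> - I" for k
    unfolding mem_Times_iff
  proof (intro conjI PiE_I)
    show "fst (x k) \<in> {- (c + 1)<..<c + 1}" using b[OF k] by auto
    show "snd (x k) i \<in> {- (c + 1)<..<c + 1}" if "i \<in> I" for i using a[OF k that] by auto
    show "snd (x k) i = undefined" if "i \<notin> I" for i using param_cubeD(3)[OF assms(1) k that] .
  qed
  moreover have "x \<in> extensional (- I)" using assms(1) by (simp add: param_cube_def PiE_def)
  ultimately show "x \<in> param_cube I (\<lambda>_. (0, \<lambda>_. 0)) (c + 1)"
    by (simp add: param_cube_def PiE_iff)
qed

text \<open>Volume packing: the disjoint small cubes lie in one large cube.\<close>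

lemma separated_params_card_le:
  assumes sep: "separated_family I c (2 * r) T" and r: "0 < r" "r \<le> 1" and c: "c \<ge> 0"
  shows "real (card T) * (std_normal_density (c + 1) ^ (card (- I) * card I) * (2 * r) ^ (card (- I) * Suc (card I)))
    \<le> (2 * (c + 1)) ^ (card (- I) * Suc (card I))"
proof -
  let ?M = "graph_measure I" and ?Q = "param_cube I (\<lambda>_. (0, \<lambda>_. 0)) (c + 1)"
  have T: "finite T" "\<forall>\<theta>\<in>T. bounded_params I c \<theta>" using sep by (auto simp: separated_family_def)
  have "real (card T) * (std_normal_density (c + 1) ^ (card (- I) * card I) * (2 * r) ^ (card (- I) * Suc (card I)))
      = (\<Sum>\<theta>\<in>T. std_normal_density (c + 1) ^ (card (- I) * card I) * (2 * r) ^ (card (- I) * Suc (card I)))"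
    by simp
  also have "\<dots> \<le> (\<Sum>\<theta>\<in>T. 1 * measure ?M (param_cube I \<theta> r))"
    unfolding mult_1 using r T(2) by (intro sum_mono param_cube_measure_ge) (auto simp: bounded_params_def)
  also have "\<dots> \<le> (\<integral>x. indicator ?Q x \<partial>?M)"
  proof (rule sum_weights_disjoint_le[OF T(1)])
    show "disjoint_family_on (\<lambda>\<theta>. param_cube I \<theta> r) T" by (rule param_cubes_disjoint_family[OF sep])
    show "integrable ?M (indicat_real ?Q)"
      using param_cube_emeasure_finite[of "c + 1" I] c by (intro integrable_real_indicator param_cube_sets) auto
    fix \<theta> x assume "\<theta> \<in> T" "x \<in> param_cube I \<theta> r"
    then have "x \<in> ?Q" using T(2) r(2) by (intro param_cube_bounded(1)[where c = c and r = r and \<theta> = \<theta>]) auto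
    then show "1 \<le> indicat_real ?Q x" by simp
  next
    show "0 \<le> indicat_real ?Q x" for x by simp
  qed (use r in \<open>simp_all only: param_cube_sets param_cube_emeasure_finite\<close>)
  also have "\<dots> = measure ?M ?Q" by (simp add: Int_absorb2 sets.sets_into_space[OF param_cube_sets])
  also have "\<dots> \<le> (2 * (c + 1)) ^ (card (- I) * Suc (card I))"
    by (rule param_cube_measure_real_le) (use c in linarith)
  finally show ?thesis .
qed

lemma weighted_cubes_le_integral:
  fixes I :: "'d::finite set" and w :: "('d \<Rightarrow> real \<times> ('d \<Rightarrow> real)) \<Rightarrow> real"
  assumes T: "finite T" and r: "0 < r"
    and disj: "disjoint_family_on (\<lambda>\<theta>. param_cube I \<theta> r) T"
    and H: "integrable (graph_measure I) H" "\<And>x. 0 \<le> H x" and L: "L \<ge> 0"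
    and w: "\<And>\<theta> x. \<theta> \<in> T \<Longrightarrow> x \<in> param_cube I \<theta> r \<Longrightarrow> w \<theta> \<le> L + H x"
  shows "(\<Sum>\<theta>\<in>T. w \<theta> * measure (graph_measure I) (param_cube I \<theta> r))
    \<le> L * (real (card T) * (2 * r) ^ (card (- I) * Suc (card I))) + (\<integral>x. H x \<partial>graph_measure I)"
proof -
  let ?M = "graph_measure I"
  have ind: "integrable ?M (\<lambda>x. L * indicat_real (param_cube I \<theta> r) x)" for \<theta>
    using param_cube_emeasure_finite[OF r, of I \<theta>]
    by (intro integrable_mult_right integrable_real_indicator param_cube_sets) auto
  have "(\<Sum>\<theta>\<in>T. w \<theta> * measure ?M (param_cube I \<theta> r))
      \<le> (\<integral>x. (\<Sum>\<theta>\<in>T. L * indicat_real (param_cube I \<theta> r) x) + H x \<partial>?M)"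
  proof (rule sum_weights_disjoint_le[OF T disj])
    show "integrable ?M (\<lambda>x. (\<Sum>\<theta>\<in>T. L * indicat_real (param_cube I \<theta> r) x) + H x)"
      using ind H(1) by (intro Bochner_Integration.integrable_add Bochner_Integration.integrable_sum)
    show "0 \<le> (\<Sum>\<theta>\<in>T. L * indicat_real (param_cube I \<theta> r) x) + H x" for x
      using H(2) L by (intro add_nonneg_nonneg sum_nonneg) auto
    fix \<theta> x assume x: "\<theta> \<in> T" "x \<in> param_cube I \<theta> r"
    have "L * indicat_real (param_cube I \<theta> r) x \<le> (\<Sum>\<theta>\<in>T. L * indicat_real (param_cube I \<theta> r) x)"
      using T x(1) L by (intro member_le_sum) auto
    then show "w \<theta> \<le> (\<Sum>\<theta>\<in>T. L * indicat_real (param_cube I \<theta> r) x) + H x" using w[OF x] x(2) by simp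
  qed (use r in \<open>simp_all only: param_cube_sets param_cube_emeasure_finite\<close>)
  also have "\<dots> = (\<Sum>\<theta>\<in>T. L * measure ?M (param_cube I \<theta> r)) + (\<integral>x. H x \<partial>?M)"
  proof -
    have "(\<integral>x. (\<Sum>\<theta>\<in>T. L * indicat_real (param_cube I \<theta> r) x) \<partial>?M)
        = (\<Sum>\<theta>\<in>T. \<integral>x. L * indicat_real (param_cube I \<theta> r) x \<partial>?M)"
      using ind by (intro Bochner_Integration.integral_sum)
    also have "\<dots> = (\<Sum>\<theta>\<in>T. L * measure ?M (param_cube I \<theta> r))"
      using param_cube_sets[of I] by simp
    finally show ?thesis
      using ind H(1) by (subst Bochner_Integration.integral_add) (auto intro: Bochner_Integration.integrable_sum)
  qed
  also have "(\<Sum>\<theta>\<in>T. L * measure ?M (param_cube I \<theta> r)) \<le> (\<Sum>\<theta>\<in>T. L * (2 * r) ^ (card (- I) * Suc (card I)))"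
    using L by (intro sum_mono mult_left_mono param_cube_measure_real_le r)
  finally show ?thesis by (simp add: mult_ac)
qed

section \<open>Balancing the high and the low part\<close>

text \<open>In the application \<open>B\<close> is a constant times \<open>C\<^sub>F card P\<close>.\<close>

definition frostman_bound :: "real \<Rightarrow> real \<Rightarrow> real \<Rightarrow> (real ^ 'd) set \<Rightarrow> bool"
  where "frostman_bound \<delta> t B P \<longleftrightarrow> finite P \<and> P \<subseteq> cball 0 1 \<and> real (card P) \<le> B
    \<and> (\<forall>x r. \<delta> \<le> r \<longrightarrow> real (card (P \<inter> cball x r)) \<le> B * r powr t)"

lemma profile_frostman:
  fixes I :: "'d::finite set" and c R M t :: real
  assumes "c \<ge> 0" "R > 0" "M \<ge> 1"
  shows "\<exists>C\<ge>0. \<forall>P B \<delta> \<rho> s \<theta>. frostman_bound \<delta> t B P \<longrightarrow> 0 < \<delta> \<longrightarrow> \<delta> \<le> \<rho> \<longrightarrow> \<rho> \<le> R \<longrightarrow> \<rho>\<^sup>2 \<le> s \<longrightarrow> s \<le> M * \<rho>\<^sup>2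
    \<longrightarrow> bounded_params I c \<theta> \<longrightarrow> profile I P \<theta> s \<le> C * B * \<rho> powr (t - real CARD('d))"
proof -
  define c' where "c' = real CARD('d) * (1 + real CARD('d) * c)"
  have "1 * 1 \<le> c'" unfolding c'_def using assms(1) by (intro mult_mono) (auto simp: Suc_leI)
  then have c': "c' \<ge> 1" by simp
  obtain C where C: "C \<ge> 0" "\<And>P B \<rho> s \<theta>. finite P \<Longrightarrow> P \<subseteq> cball 0 1 \<Longrightarrow> 0 < \<rho> \<Longrightarrow> \<rho> \<le> R \<Longrightarrow> \<rho>\<^sup>2 \<le> s
    \<Longrightarrow> s \<le> M * \<rho>\<^sup>2 \<Longrightarrow> (\<forall>k\<in>-I. \<forall>i\<in>I. \<bar>snd (\<theta> k) i\<bar> \<le> c)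
    \<Longrightarrow> (\<forall>x. real (card (P \<inter> cball x (c' * \<rho>))) \<le> B)
    \<Longrightarrow> profile I P \<theta> s \<le> C * B / \<rho> ^ CARD('d)"
    using profile_le[OF assms, of I] unfolding c'_def[symmetric] by metis
  have main: "profile I P \<theta> s \<le> (C * c' powr t) * B * \<rho> powr (t - real CARD('d))"
    if P: "frostman_bound \<delta> t B P" and \<rho>: "0 < \<delta>" "\<delta> \<le> \<rho>" "\<rho> \<le> R" and s: "\<rho>\<^sup>2 \<le> s" "s \<le> M * \<rho>\<^sup>2"
      and \<theta>: "bounded_params I c \<theta>" for P B \<delta> \<rho> s \<theta>
  proof -
    have "1 * \<rho> \<le> c' * \<rho>" using c' \<rho> by (intro mult_right_mono) auto
    then have "\<delta> \<le> c' * \<rho>" using \<rho> by linarith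
    then have "\<forall>x. real (card (P \<inter> cball x (c' * \<rho>))) \<le> B * (c' * \<rho>) powr t"
      using P by (simp add: frostman_bound_def)
    then have "profile I P \<theta> s \<le> C * (B * (c' * \<rho>) powr t) / \<rho> ^ CARD('d)"
      using P \<rho> s \<theta> by (intro C(2)) (auto simp: frostman_bound_def bounded_params_def)
    also have "\<dots> = (C * c' powr t) * B * \<rho> powr (t - real CARD('d))"
      using \<rho> c' by (simp add: powr_mult powr_diff powr_realpow)
    finally show ?thesis .
  qed
  show ?thesis
  proof (intro exI[of _ "C * c' powr t"] conjI allI impI)
    show "0 \<le> C * c' powr t" using C(1) by simp
  qed (rule main; assumption)
qed

text \<open>The number \<open>N = CARD('d)\<close> of differences gives the pair kernel the decay \<open>L = 4 CARD('d)\<close>, which exceeds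
  \<open>t - m\<close>.\<close>

lemma high_part_frostman:
  fixes I :: "'d::finite set" and t :: real
  assumes t: "real (card (- I)) < t" "t \<le> real CARD('d)"
  shows "\<exists>C\<ge>0. \<forall>P B \<delta> \<rho>. frostman_bound \<delta> t B P \<longrightarrow> 0 < \<delta> \<longrightarrow> \<delta> \<le> \<rho> \<longrightarrow>
    integrable (graph_measure I) (\<lambda>\<theta>. (high_part I P \<delta> \<rho> CARD('d) \<theta>)\<^sup>2) \<and>
    (\<integral>\<theta>. (high_part I P \<delta> \<rho> CARD('d) \<theta>)\<^sup>2 \<partial>graph_measure I)
      \<le> C * B\<^sup>2 * \<rho> powr (t - real (card (- I)))"
proof -
  define m where "m = real (card (- I))"
  define L where "L = 4 * real CARD('d)"
  from high_part_energy[where N = "CARD('d)" and I = I]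
  obtain C where C: "C \<ge> 0" "\<forall>P. \<forall>\<delta>>0. \<forall>\<rho>>0.
    integrable (graph_measure I) (\<lambda>\<theta>. (high_part I P \<delta> \<rho> CARD('d) \<theta>)\<^sup>2) \<and>
    (\<integral>\<theta>. (high_part I P \<delta> \<rho> CARD('d) \<theta>)\<^sup>2 \<partial>graph_measure I)
      \<le> C * (\<Sum>p\<in>P. \<Sum>q\<in>P. riesz m L \<rho> (max \<delta> (dist p q)))"
    unfolding m_def[symmetric] L_def[symmetric] by (elim exE conjE) (rule that)
  define C2 where "C2 = 2 powr m / (1 - 2 powr (m - t)) + 2 powr t / (1 - 2 powr (t - m - L))"
  have mtL: "m < t" "t < m + L" "0 \<le> m" using t by (auto simp: m_def L_def)
  have C2: "C2 \<ge> 0" unfolding C2_def using mtL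
    by (intro add_nonneg_nonneg divide_nonneg_nonneg) (auto simp: powr_less_one less_imp_le)
  have main: "(\<Sum>p\<in>P. \<Sum>q\<in>P. riesz m L \<rho> (max \<delta> (dist p q)))
      \<le> C2 * B\<^sup>2 * \<rho> powr (t - m)"
    if P: "frostman_bound \<delta> t B P" and \<rho>: "0 < \<delta>" "\<delta> \<le> \<rho>" for P :: "(real ^ 'd) set" and B \<delta> \<rho>
  proof -
    have fin: "finite P" and cP: "real (card P) \<le> B"
      and count: "\<And>x r. \<delta> \<le> r \<Longrightarrow> real (card (P \<inter> cball x r)) \<le> B * r powr t"
      using P by (auto simp: frostman_bound_def)
    have B: "B \<ge> 0" using cP by (meson of_nat_0_le_iff order.trans)
    have "(\<Sum>p\<in>P. \<Sum>q\<in>P. riesz m L \<rho> (max \<delta> (dist p q)))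
        \<le> (\<Sum>p\<in>P. C2 * B * \<rho> powr (t - m))"
    proof (rule sum_mono)
      fix p
      have "{q\<in>P. dist p q \<le> r} = P \<inter> cball p r" for r by auto
      then show "(\<Sum>q\<in>P. riesz m L \<rho> (max \<delta> (dist p q))) \<le> C2 * B * \<rho> powr (t - m)"
        unfolding C2_def using fin mtL \<rho> B count
        by (intro potential_bound[where \<delta> = \<delta> and p = p]) auto
    qed
    also have "\<dots> = real (card P) * (C2 * B * \<rho> powr (t - m))" by simp
    also have "\<dots> \<le> B * (C2 * B * \<rho> powr (t - m))" using cP B C2 by (intro mult_right_mono) auto
    finally show ?thesis by (simp add: power2_eq_square mult_ac)
  qed
  have result: "integrable (graph_measure I) (\<lambda>\<theta>. (high_part I P \<delta> \<rho> CARD('d) \<theta>)\<^sup>2) \<and>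
    (\<integral>\<theta>. (high_part I P \<delta> \<rho> CARD('d) \<theta>)\<^sup>2 \<partial>graph_measure I)
      \<le> (C * C2) * B\<^sup>2 * \<rho> powr (t - real (card (- I)))"
    if P: "frostman_bound \<delta> t B P" and \<rho>: "0 < \<delta>" "\<delta> \<le> \<rho>" for P B \<delta> \<rho>
  proof -
    have "\<rho> > 0" using \<rho> by simp
    note 1 = C(2)[rule_format, OF \<rho>(1) this, of P]
    have "C * (\<Sum>p\<in>P. \<Sum>q\<in>P. riesz m L \<rho> (max \<delta> (dist p q)))
        \<le> C * (C2 * B\<^sup>2 * \<rho> powr (t - m))" using main[OF P \<rho>] C(1) by (rule mult_left_mono)
    also have "\<dots> = (C * C2) * B\<^sup>2 * \<rho> powr (t - real (card (- I)))" by (simp add: m_def mult_ac)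
    finally show ?thesis using 1 by (meson order.trans)
  qed
  show ?thesis
  proof (rule exI[of _ "C * C2"], rule conjI)
    show "0 \<le> C * C2" using C(1) C2 by simp
    show "\<forall>P B \<delta> \<rho>. frostman_bound \<delta> t B P \<longrightarrow> 0 < \<delta> \<longrightarrow> \<delta> \<le> \<rho> \<longrightarrow>
      integrable (graph_measure I) (\<lambda>\<theta>. (high_part I P \<delta> \<rho> CARD('d) \<theta>)\<^sup>2) \<and>
      (\<integral>\<theta>. (high_part I P \<delta> \<rho> CARD('d) \<theta>)\<^sup>2 \<partial>graph_measure I)
        \<le> (C * C2) * B\<^sup>2 * \<rho> powr (t - real (card (- I)))"
      by (intro allI impI result)
  qed
qed

text \<open>The first bound is the splitting at scale \<open>\<rho>\<close>: the low part is bounded pointwise, and the high part \<open>h\<close>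
  enters through \<open>h \<le> \<Lambda> + h\<^sup>2 / \<Lambda>\<close> with \<open>\<Lambda> = B \<rho> powr (t - d)\<close>, the size of the low part. The second
  bound uses the pointwise estimate at scale \<open>\<delta>\<close> only.\<close>

lemma weighted_cubes_bound:
  fixes I :: "'d::finite set" and c R t :: real
  assumes c: "c \<ge> 0" and R: "R > 0" and t: "real (card (- I)) < t" "t \<le> real CARD('d)"
  defines "D \<equiv> card (- I) * Suc (card I)"
  shows "\<exists>C\<ge>0. \<forall>P B \<delta> \<rho> r T w. frostman_bound \<delta> t B P \<longrightarrow> 0 < B \<longrightarrow> 0 < \<delta> \<longrightarrow> \<delta> \<le> \<rho> \<longrightarrow> \<rho> \<le> R
    \<longrightarrow> 0 < r \<longrightarrow> r \<le> 1 \<longrightarrow> separated_family I c (2 * r) T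
    \<longrightarrow> (\<forall>\<theta>\<in>T. \<forall>x\<in>param_cube I \<theta> r. w \<theta> \<le> profile I P x (\<delta>\<^sup>2))
    \<longrightarrow> (\<Sum>\<theta>\<in>T. w \<theta> * measure (graph_measure I) (param_cube I \<theta> r))
        \<le> C * B * (\<rho> powr (t - real CARD('d)) * (real (card T) * (2 * r) ^ D) + \<rho> powr real (card I))
      \<and> (\<Sum>\<theta>\<in>T. w \<theta> * measure (graph_measure I) (param_cube I \<theta> r))
        \<le> C * B * (\<delta> powr (t - real CARD('d)) * (real (card T) * (2 * r) ^ D))"
proof -
  define N where "N = CARD('d)"
  have "0 \<le> c + 1" "1 \<le> 1 + real N" using c by simp_all
  from profile_frostman[OF this(1) R this(2), of t I]
  obtain C1 where C1: "C1 \<ge> 0" "\<forall>P B \<delta> \<rho> s \<theta>. frostman_bound \<delta> t B P \<longrightarrow> 0 < \<delta> \<longrightarrow> \<delta> \<le> \<rho> \<longrightarrow> \<rho> \<le> R \<longrightarrow> \<rho>\<^sup>2 \<le> s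
    \<longrightarrow> s \<le> (1 + real N) * \<rho>\<^sup>2 \<longrightarrow> bounded_params I (c + 1) \<theta> \<longrightarrow> profile I P \<theta> s \<le> C1 * B * \<rho> powr (t - real CARD('d))"
    by (elim exE conjE) (rule that)
  from high_part_frostman[OF t, folded N_def]
  obtain C2 where C2: "C2 \<ge> 0" "\<forall>P B \<delta> \<rho>. frostman_bound \<delta> t B P \<longrightarrow> 0 < \<delta> \<longrightarrow> \<delta> \<le> \<rho> \<longrightarrow>
    integrable (graph_measure I) (\<lambda>\<theta>. (high_part I P \<delta> \<rho> N \<theta>)\<^sup>2) \<and>
    (\<integral>\<theta>. (high_part I P \<delta> \<rho> N \<theta>)\<^sup>2 \<partial>graph_measure I)
      \<le> C2 * B\<^sup>2 * \<rho> powr (t - real (card (- I)))"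
    by (elim exE conjE) (rule that)
  define C where "C = 2 ^ N * C1 + 1 + C2"
  have C: "C \<ge> 0" using C1(1) C2(1) by (simp add: C_def)
  have dims: "real CARD('d) = real (card I) + real (card (- I))" by (rule card_add_card_Compl)
  have main: "(\<Sum>\<theta>\<in>T. w \<theta> * measure (graph_measure I) (param_cube I \<theta> r))
        \<le> C * B * (\<rho> powr (t - real CARD('d)) * (real (card T) * (2 * r) ^ D) + \<rho> powr real (card I))"
      "(\<Sum>\<theta>\<in>T. w \<theta> * measure (graph_measure I) (param_cube I \<theta> r))
        \<le> C * B * (\<delta> powr (t - real CARD('d)) * (real (card T) * (2 * r) ^ D))"
    if P: "frostman_bound \<delta> t B P" and B: "0 < B" and \<rho>: "0 < \<delta>" "\<delta> \<le> \<rho>" "\<rho> \<le> R" and r: "0 < r" "r \<le> 1"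
      and sep: "separated_family I c (2 * r) T"
      and w: "\<forall>\<theta>\<in>T. \<forall>x\<in>param_cube I \<theta> r. w \<theta> \<le> profile I P x (\<delta>\<^sup>2)" for P B \<delta> \<rho> r T w
  proof -
    let ?M = "graph_measure I"
    let ?S = "(\<Sum>\<theta>\<in>T. w \<theta> * measure ?M (param_cube I \<theta> r))"
    define e where "e = real (card T) * (2 * r) ^ D"
    have e: "e \<ge> 0" using r by (simp add: e_def)
    have T: "finite T" "\<forall>\<theta>\<in>T. bounded_params I c \<theta>" using sep by (auto simp: separated_family_def)
    have disj: "disjoint_family_on (\<lambda>\<theta>. param_cube I \<theta> r) T" using sep by (rule param_cubes_disjoint_family)
    have bnd: "bounded_params I (c + 1) x" if "\<theta> \<in> T" "x \<in> param_cube I \<theta> r" for \<theta> x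
      using that T(2) r(2) by (intro param_cube_bounded(2)[where \<theta> = \<theta> and r = r]) auto
    (* The size of the low part; it also serves as the threshold in the bound for the high part. *)
    define \<Lambda> where "\<Lambda> = B * \<rho> powr (t - real CARD('d))"
    have \<Lambda>: "\<Lambda> > 0" using B \<rho> by (simp add: \<Lambda>_def)
    define h where "h = high_part I P \<delta> \<rho> N"
    have h: "integrable ?M (\<lambda>x. (h x)\<^sup>2)" "(\<integral>x. (h x)\<^sup>2 \<partial>?M) \<le> C2 * B\<^sup>2 * \<rho> powr (t - real (card (- I)))"
      using C2(2)[rule_format, OF P \<rho>(1,2)] by (simp_all add: h_def)
    have "?S
        \<le> (2 ^ N * C1 * \<Lambda> + \<Lambda>) * (real (card T) * (2 * r) ^ (card (- I) * Suc (card I))) + (\<integral>x. (h x)\<^sup>2 / \<Lambda> \<partial>?M)"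
    proof (rule weighted_cubes_le_integral[OF T(1) r(1) disj])
      show "integrable ?M (\<lambda>x. (h x)\<^sup>2 / \<Lambda>)" using h(1) by simp
      show "0 \<le> (h x)\<^sup>2 / \<Lambda>" for x using \<Lambda> by simp
      show "0 \<le> 2 ^ N * C1 * \<Lambda> + \<Lambda>" using C1(1) \<Lambda> by simp
      fix \<theta> x assume x: "\<theta> \<in> T" "x \<in> param_cube I \<theta> r"
      have "\<bar>profile I P x (\<delta>\<^sup>2) - h x\<bar> \<le> 2 ^ N * (C1 * \<Lambda>)"
        unfolding h_def high_part_def
      proof (rule fdiff_funpow_minus_bound)
        show "0 \<le> C1 * \<Lambda>" using C1(1) \<Lambda> by simp
        (* The low part sees the variances \<delta>\<^sup>2 + j \<rho>\<^sup>2 only, all between \<rho>\<^sup>2 and (1 + N) \<rho>\<^sup>2. *)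
        fix j :: nat assume j: "1 \<le> j" "j \<le> N"
        have sq: "\<delta>\<^sup>2 \<le> \<rho>\<^sup>2" using \<rho> by (simp add: power_mono)
        have "1 * \<rho>\<^sup>2 \<le> real j * \<rho>\<^sup>2" "real j * \<rho>\<^sup>2 \<le> real N * \<rho>\<^sup>2" using j by (intro mult_right_mono; simp)+
        then have "\<rho>\<^sup>2 \<le> \<delta>\<^sup>2 + real j * \<rho>\<^sup>2" "\<delta>\<^sup>2 + real j * \<rho>\<^sup>2 \<le> (1 + real N) * \<rho>\<^sup>2"
          using sq by (simp_all add: distrib_right add_increasing)
        from C1(2)[rule_format, OF P \<rho> this bnd[OF x]]
        have "profile I P x (\<delta>\<^sup>2 + real j * \<rho>\<^sup>2) \<le> C1 * \<Lambda>" by (simp add: \<Lambda>_def mult_ac)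
        moreover have "0 < \<delta>\<^sup>2 + real j * \<rho>\<^sup>2" using \<rho> by (intro add_pos_nonneg) auto
        then have "0 \<le> profile I P x (\<delta>\<^sup>2 + real j * \<rho>\<^sup>2)"
          unfolding profile_def by (intro sum_nonneg bump_nonneg)
        ultimately show "\<bar>profile I P x (\<delta>\<^sup>2 + real j * \<rho>\<^sup>2)\<bar> \<le> C1 * \<Lambda>" by simp
      qed
      moreover have "h x \<le> \<Lambda> + (h x)\<^sup>2 / \<Lambda>"
      proof (cases "h x \<le> \<Lambda>")
        case True
        have "0 \<le> (h x)\<^sup>2 / \<Lambda>" using \<Lambda> by simp
        with True show ?thesis by linarith
      next
        case False
        then have "h x * \<Lambda> \<le> (h x)\<^sup>2" using \<Lambda> by (simp add: power2_eq_square)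
        then have "h x \<le> (h x)\<^sup>2 / \<Lambda>" using \<Lambda> by (simp add: field_simps)
        with \<Lambda> show ?thesis by linarith
      qed
      moreover have "w \<theta> \<le> profile I P x (\<delta>\<^sup>2)" using w x by blast
      ultimately show "w \<theta> \<le> (2 ^ N * C1 * \<Lambda> + \<Lambda>) + (h x)\<^sup>2 / \<Lambda>" by (simp add: mult_ac abs_le_iff)
    qed
    also have "(\<integral>x. (h x)\<^sup>2 / \<Lambda> \<partial>?M) = (\<integral>x. (h x)\<^sup>2 \<partial>?M) / \<Lambda>" by simp
    also have "\<dots> \<le> (C2 * B\<^sup>2 * \<rho> powr (t - real (card (- I)))) / \<Lambda>"
      using h(2) \<Lambda> by (intro divide_right_mono) auto
    also have "\<dots> = C2 * B * \<rho> powr real (card I)"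
    proof -
      have "\<rho> powr (t - real (card (- I))) = \<rho> powr (t - real CARD('d)) * \<rho> powr real (card I)"
        by (simp add: powr_add[symmetric] dims)
      then show ?thesis using B \<rho> by (simp add: \<Lambda>_def power2_eq_square)
    qed
    finally have "?S
        \<le> (2 ^ N * C1 * \<Lambda> + \<Lambda>) * e + C2 * B * \<rho> powr real (card I)" by (simp add: e_def D_def)
    also have "\<dots> \<le> C * \<Lambda> * e + C * B * \<rho> powr real (card I)"
    proof (intro add_mono mult_right_mono)
      show "2 ^ N * C1 * \<Lambda> + \<Lambda> \<le> C * \<Lambda>" using C2(1) \<Lambda> by (simp add: C_def algebra_simps)
      show "C2 \<le> C" using C1(1) by (simp add: C_def)
    qed (use e B in auto)
    also have "\<dots> = C * B * (\<rho> powr (t - real CARD('d)) * e + \<rho> powr real (card I))"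
      by (simp add: \<Lambda>_def algebra_simps)
    finally show "?S
        \<le> C * B * (\<rho> powr (t - real CARD('d)) * (real (card T) * (2 * r) ^ D) + \<rho> powr real (card I))"
      by (simp only: e_def)
    have "?S
        \<le> (C1 * B * \<delta> powr (t - real CARD('d))) * (real (card T) * (2 * r) ^ (card (- I) * Suc (card I))) + (\<integral>x. 0 \<partial>?M)"
    proof (rule weighted_cubes_le_integral[OF T(1) r(1) disj])
      show "0 \<le> C1 * B * \<delta> powr (t - real CARD('d))" using C1(1) B by simp
      fix \<theta> x assume x: "\<theta> \<in> T" "x \<in> param_cube I \<theta> r"
      have "\<delta>\<^sup>2 \<le> (1 + real N) * \<delta>\<^sup>2" by (simp add: distrib_right)
      from C1(2)[rule_format, OF P \<rho>(1) order_refl _ order_refl this bnd[OF x]] \<rho>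
      show "w \<theta> \<le> C1 * B * \<delta> powr (t - real CARD('d)) + 0" using w x by force
    qed auto
    also have "\<dots> = C1 * (B * \<delta> powr (t - real CARD('d)) * e)" by (simp add: e_def D_def)
    also have "\<dots> \<le> C * (B * \<delta> powr (t - real CARD('d)) * e)"
    proof (rule mult_right_mono)
      have "1 * C1 \<le> 2 ^ N * C1" using C1(1) by (intro mult_right_mono) auto
      then show "C1 \<le> C" using C2(1) by (simp add: C_def)
    qed (use B e in auto)
    finally show "?S
        \<le> C * B * (\<delta> powr (t - real CARD('d)) * (real (card T) * (2 * r) ^ D))"
      by (simp add: e_def mult_ac)
  qed
  show ?thesis
  proof (intro exI[of _ C] conjI allI impI)
    show "0 \<le> C" by (rule C)
  qed (rule main; assumption)+
qed

text \<open>For the maximal number \<open>N = \<delta> powr (- (d - n) (n + 1))\<close> of separated planes near the unit ball this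
  is \<open>\<delta> powr (- n (d - n)) = N \<delta> powr (d - n)\<close>, the rate for uniformly distributed points.\<close>

definition incidence_rate :: "real \<Rightarrow> real \<Rightarrow> real \<Rightarrow> real \<Rightarrow> nat \<Rightarrow> real"
  where "incidence_rate d n t \<delta> N
    = real N powr (n / (d + n - t)) * \<delta> powr (n * (t + 1 - d) * (d - n) / (d + n - t))"

lemma incidence_rate_nonneg: "0 \<le> incidence_rate d n t \<delta> N"
  by (simp add: incidence_rate_def)

lemma incidence_rate_mono: "t \<le> d \<Longrightarrow> 0 \<le> n \<Longrightarrow> M \<le> N \<Longrightarrow> incidence_rate d n t \<delta> M \<le> incidence_rate d n t \<delta> N"
  unfolding incidence_rate_def by (intro mult_right_mono powr_mono2) auto

lemma incidence_exponent:
  fixes n d t q :: real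
  assumes "q = d + n - t" "q \<noteq> 0"
  shows "(d - n) - (d - n) * (n + 1) + (d - n) * (n + 1) * (n / q) = n * (t + 1 - d) * (d - n) / q"
proof -
  have t: "t = d + n - q" using assms(1) by simp
  show ?thesis unfolding t using assms(2) by (simp add: field_simps)
qed

text \<open>The bound is applied to the count at each parameter, as a weight on its cube, with the scale
  \<open>\<rho> = e powr (1 / q)\<close>, \<open>q = d + n - t\<close>, which makes \<open>e \<rho> powr (t - d)\<close> and \<open>\<rho> powr n\<close> both equal to
  \<open>e powr (n / q)\<close>. Here \<open>e\<close> is an upper bound for the volume of all cubes. Packing bounds \<open>e\<close>, and
  hence \<open>\<rho>\<close>, by a constant. If \<open>\<rho> < \<delta>\<close>, then \<open>e \<delta> powr (t - d)\<close> is already at most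
  \<open>e powr (n / q)\<close>, since \<open>t \<le> d\<close>.\<close>

lemma incidence_bound_graphs:
  fixes I :: "'d::finite set" and a c \<kappa> t :: real
  assumes I: "I \<noteq> {}" and t: "real (card (- I)) < t" "t \<le> real CARD('d)"
    and c: "c \<ge> 0" and \<kappa>: "0 < \<kappa>" "\<kappa> \<le> 1"
  defines "n \<equiv> real (card I)" and "d \<equiv> real CARD('d)"
  shows "\<exists>K\<ge>0. \<forall>P B \<delta> T. frostman_bound \<delta> t B P \<longrightarrow> 0 < \<delta> \<longrightarrow> \<delta> < 1
    \<longrightarrow> separated_family I c (2 * (\<kappa> * \<delta>)) T
    \<longrightarrow> (\<Sum>\<theta>\<in>T. real (card {p\<in>P. \<forall>k\<in>-I. \<bar>defect I \<theta> p k\<bar> \<le> a * \<delta>}))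
      \<le> K * B * incidence_rate d n t \<delta> (card T)"
proof -
  define q where "q = d + n - t"
  define m where "m = card (- I)"
  define D where "D = m * Suc (card I)"
  define g where "g = gauss 1 (a + 1 + d)"
  define g2 where "g2 = std_normal_density (c + 1) ^ (m * card I)"
  have n: "n \<ge> 1" using I by (simp add: n_def Suc_leI card_gt_0_iff)
  have q: "q \<ge> 1" using n t by (simp add: q_def d_def)
  have dm: "d = n + real m"
    unfolding d_def n_def m_def by (rule card_add_card_Compl)
  have g: "g > 0" "g2 > 0" by (simp_all add: g_def g2_def gauss_pos normal_density_pos)
  (* The packing bound for the volume e of all cubes. *)
  define E where "E = (2 * (c + 1)) ^ D / g2"
  define R where "R = max 1 (E powr (1 / q))"
  have "R > 0" by (simp add: R_def)
  from weighted_cubes_bound[OF c this t, folded m_def, folded D_def]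
  obtain C where C: "C \<ge> 0" "\<forall>P B \<delta> \<rho> r T w. frostman_bound \<delta> t B P \<longrightarrow> 0 < B \<longrightarrow> 0 < \<delta> \<longrightarrow> \<delta> \<le> \<rho> \<longrightarrow> \<rho> \<le> R
    \<longrightarrow> 0 < r \<longrightarrow> r \<le> 1 \<longrightarrow> separated_family I c (2 * r) T
    \<longrightarrow> (\<forall>\<theta>\<in>T. \<forall>x\<in>param_cube I \<theta> r. w \<theta> \<le> profile I P x (\<delta>\<^sup>2))
    \<longrightarrow> (\<Sum>\<theta>\<in>T. w \<theta> * measure (graph_measure I) (param_cube I \<theta> r))
        \<le> C * B * (\<rho> powr (t - real CARD('d)) * (real (card T) * (2 * r) ^ D) + \<rho> powr real (card I))
      \<and> (\<Sum>\<theta>\<in>T. w \<theta> * measure (graph_measure I) (param_cube I \<theta> r))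
        \<le> C * B * (\<delta> powr (t - real CARD('d)) * (real (card T) * (2 * r) ^ D))"
    by (elim exE conjE) (rule that)
  define K where "K = 2 * C / (g ^ m * g2) * (2 * \<kappa>) powr (real D * (n / q) - real D)"
  have K: "K \<ge> 0" using C(1) g by (simp add: K_def)
  have main: "(\<Sum>\<theta>\<in>T. real (card {p\<in>P. \<forall>k\<in>-I. \<bar>defect I \<theta> p k\<bar> \<le> a * \<delta>}))
      \<le> K * B * incidence_rate d n t \<delta> (card T)"
    if P: "frostman_bound \<delta> t B P" and \<delta>: "0 < \<delta>" "\<delta> < 1" and T: "separated_family I c (2 * (\<kappa> * \<delta>)) T"
    for P B \<delta> T
  proof -
    let ?N = "\<lambda>\<theta>. real (card {p\<in>P. \<forall>k\<in>-I. \<bar>defect I \<theta> p k\<bar> \<le> a * \<delta>})"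
    have fin: "finite P" "P \<subseteq> cball 0 1" "real (card P) \<le> B" using P by (auto simp: frostman_bound_def)
    show ?thesis
    proof (cases "T = {} \<or> P = {}")
      case True
      have "B \<ge> 0" using fin(3) by (meson of_nat_0_le_iff order.trans)
      then have "0 \<le> K * B * incidence_rate d n t \<delta> (card T)" using K by (simp add: incidence_rate_nonneg)
      moreover have "(\<Sum>\<theta>\<in>T. ?N \<theta>) = 0" using True by auto
      ultimately show ?thesis by linarith
    next
      case False
      then have "card P > 0" "card T > 0" using fin T by (auto simp: card_gt_0_iff separated_family_def)
      then have B: "B > 0" and cT: "real (card T) > 0" using fin(3) by linarith+
      define r where "r = \<kappa> * \<delta>"
      have "\<kappa> * \<delta> \<le> 1 * 1" using \<kappa> \<delta> by (intro mult_mono) auto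
      then have r: "0 < r" "r \<le> 1" using \<kappa> \<delta> by (simp_all add: r_def)
      have r\<delta>: "r \<le> \<delta>" using \<kappa> \<delta> by (simp add: r_def mult_left_le_one_le)
      have sep: "separated_family I c (2 * r) T" using T by (simp add: r_def)
      define e where "e = real (card T) * (2 * r) ^ D"
      have e: "e > 0" using cT r by (simp add: e_def)
      define w where "w \<theta> = ?N \<theta> * (g / \<delta>) ^ m" for \<theta>
      have w: "\<forall>\<theta>\<in>T. \<forall>x\<in>param_cube I \<theta> r. w \<theta> \<le> profile I P x (\<delta>\<^sup>2)"
        using incidence_count_le_profile[OF fin(1,2) \<delta>(1) r\<delta>, of _ I _ a]
        by (auto simp: w_def g_def m_def d_def)
      let ?S = "\<Sum>\<theta>\<in>T. w \<theta> * measure (graph_measure I) (param_cube I \<theta> r)"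
      have "e * g2 \<le> (2 * (c + 1)) ^ D"
        using separated_params_card_le[OF sep r c] by (simp add: e_def g2_def D_def m_def mult_ac)
      then have eE: "e \<le> E" using g by (simp add: E_def field_simps)
      have S: "?S \<le> 2 * C * B * e powr (n / q)"
      proof (cases "e powr (1 / q) \<ge> \<delta>")
        case True
        define \<rho> where "\<rho> = e powr (1 / q)"
        have "\<rho> \<le> R" unfolding \<rho>_def R_def using e eE q by (intro max.coboundedI2 powr_mono2) auto
        have "?S \<le> C * B * (\<rho> powr (t - d) * e + \<rho> powr n)"
          unfolding d_def n_def e_def
          by (rule C(2)[rule_format, OF P B \<delta>(1) True[folded \<rho>_def] \<open>\<rho> \<le> R\<close> r sep, of w, THEN conjunct1])
             (use w in auto)
        also have "\<rho> powr n = e powr (n / q)" using q by (simp add: \<rho>_def powr_powr)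
        also have "\<rho> powr (t - d) * e = e powr (n / q)"
        proof -
          have "\<rho> powr (t - d) * e = e powr ((t - d) / q) * e powr 1" using e by (simp add: \<rho>_def powr_powr)
          also have "\<dots> = e powr ((t - d) / q + 1)" by (simp add: powr_add)
          also have "(t - d) / q + 1 = n / q" using q by (simp add: field_simps) (simp add: q_def)
          finally show ?thesis .
        qed
        finally show ?thesis by simp
      next
        case False
        have "\<delta> \<le> R" using \<delta> by (simp add: R_def)
        have "?S \<le> C * B * (\<delta> powr (t - d) * e)"
          unfolding d_def n_def e_def
          by (rule C(2)[rule_format, OF P B \<delta>(1) order_refl \<open>\<delta> \<le> R\<close> r sep, of w, THEN conjunct2])
             (use w in auto)
        also have "\<dots> \<le> C * B * e powr (n / q)"
        proof (rule mult_left_mono)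
          have "\<delta> powr (t - d) * e \<le> (e powr (1 / q)) powr (t - d) * e"
            using False e t by (intro mult_right_mono powr_mono2') (auto simp: d_def)
          also have "\<dots> = e powr ((t - d) / q) * e powr 1" using e by (simp add: powr_powr)
          also have "\<dots> = e powr ((t - d) / q + 1)" by (simp add: powr_add)
          also have "(t - d) / q + 1 = n / q" using q by (simp add: field_simps) (simp add: q_def)
          finally show "\<delta> powr (t - d) * e \<le> e powr (n / q)" .
        qed (use C B in simp)
        also have "\<dots> \<le> 2 * C * B * e powr (n / q)" using C(1) B by simp
        finally show ?thesis .
      qed
      have "(\<Sum>\<theta>\<in>T. ?N \<theta>) * ((g / \<delta>) ^ m * (g2 * (2 * r) ^ D)) = (\<Sum>\<theta>\<in>T. w \<theta> * (g2 * (2 * r) ^ D))"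
        unfolding w_def sum_distrib_right by (simp only: mult_ac)
      also have "\<dots> \<le> ?S"
      proof (intro sum_mono mult_left_mono)
        fix \<theta> assume "\<theta> \<in> T"
        then show "g2 * (2 * r) ^ D \<le> measure (graph_measure I) (param_cube I \<theta> r)"
          using sep param_cube_measure_ge[OF r, of I \<theta> c]
          by (auto simp: g2_def D_def m_def bounded_params_def separated_family_def)
        show "0 \<le> w \<theta>" using g \<delta> by (simp add: w_def)
      qed
      also note S
      finally have "(\<Sum>\<theta>\<in>T. ?N \<theta>) \<le> 2 * C * B * e powr (n / q) / ((g / \<delta>) ^ m * (g2 * (2 * r) ^ D))"
        using g \<delta> r by (subst pos_le_divide_eq) auto
      also have "\<dots> = K * B * real (card T) powr (n / q) * \<delta> powr (real m - real D + real D * (n / q))"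
      proof -
        have 1: "(2 * r) ^ D = (2 * \<kappa>) powr real D * \<delta> powr real D"
          using \<kappa> \<delta> by (simp add: r_def powr_realpow power_mult_distrib)
        have 2: "e powr (n / q) = real (card T) powr (n / q) * ((2 * \<kappa>) powr (real D * (n / q)) * \<delta> powr (real D * (n / q)))"
          unfolding e_def 1 using \<kappa> \<delta> by (simp add: powr_mult powr_powr)
        have 3: "(g / \<delta>) ^ m = g ^ m / \<delta> powr real m" using \<delta> by (simp add: power_divide powr_realpow)
        show ?thesis unfolding 1 2 3 K_def
          using \<kappa> \<delta> g by (simp add: powr_diff powr_add field_simps)
      qed
      also have "real m - real D + real D * (n / q) = n * (t + 1 - d) * (d - n) / q"
        using incidence_exponent[of q d n t] q by (simp add: q_def dm D_def n_def algebra_simps)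
      finally show ?thesis by (simp only: q_def incidence_rate_def mult.assoc)
    qed
  qed
  show ?thesis
  proof (intro exI[of _ K] conjI allI impI)
    show "0 \<le> K" by (rule K)
  qed (rule main; assumption)
qed

section \<open>Affine planes as graphs\<close>

text \<open>Gaussian elimination with pivoting. A vector \<open>u \<in> U\<close> is normalised at its largest coordinate \<open>i0\<close>; the
  vectors of \<open>U\<close> that vanish at \<open>i0\<close> have a basis of the required form by induction; and \<open>u\<close> is cleared
  at the pivots of that basis. Pivoting at the largest coordinate is what bounds the entries in terms
  of the dimension alone.\<close>

lemma bounded_graph_basis:
  "\<exists>c\<ge>0. \<forall>U :: (real ^ 'd) set. subspace U \<and> dim U = n \<longrightarrow>
    (\<exists>I v. card I = n \<and> (\<forall>i\<in>I. v i \<in> U \<and> v i $ i = 1 \<and> (\<forall>j\<in>I - {i}. v i $ j = 0) \<and> (\<forall>k. \<bar>v i $ k\<bar> \<le> c))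
      \<and> (\<forall>x\<in>U. x = (\<Sum>i\<in>I. x $ i *\<^sub>R v i)))"
proof (induction n)
  case 0
  have "\<exists>I v. card I = 0 \<and> (\<forall>i\<in>I. v i \<in> U \<and> v i $ i = 1 \<and> (\<forall>j\<in>I - {i}. v i $ j = 0) \<and> (\<forall>k. \<bar>v i $ k\<bar> \<le> 0))
      \<and> (\<forall>x\<in>U. x = (\<Sum>i\<in>I. x $ i *\<^sub>R v i))" if "subspace U" "dim U = 0" for U :: "(real ^ 'd) set"
    using that by (intro exI[of _ "{}"]) auto
  then show ?case by (intro exI[of _ 0]) auto
next
  case (Suc n)
  then obtain c where c: "c \<ge> 0" "\<And>U :: (real ^ 'd) set. subspace U \<Longrightarrow> dim U = n \<Longrightarrow>
    (\<exists>I v. card I = n \<and> (\<forall>i\<in>I. v i \<in> U \<and> v i $ i = 1 \<and> (\<forall>j\<in>I - {i}. v i $ j = 0) \<and> (\<forall>k. \<bar>v i $ k\<bar> \<le> c))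
      \<and> (\<forall>x\<in>U. x = (\<Sum>i\<in>I. x $ i *\<^sub>R v i)))"
    by blast
  define c' where "c' = 1 + real n * c + c"
  have "\<exists>I v. card I = Suc n \<and> (\<forall>i\<in>I. v i \<in> U \<and> v i $ i = 1 \<and> (\<forall>j\<in>I - {i}. v i $ j = 0) \<and> (\<forall>k. \<bar>v i $ k\<bar> \<le> c'))
      \<and> (\<forall>x\<in>U. x = (\<Sum>i\<in>I. x $ i *\<^sub>R v i))" if U: "subspace U" "dim U = Suc n" for U :: "(real ^ 'd) set"
  proof -
    have "\<not> U \<subseteq> {0}" using U(2) by (metis dim_eq_0 nat.distinct(1))
    then obtain u0 where u0: "u0 \<in> U" "u0 \<noteq> 0" by auto
    have "Max (range (\<lambda>k. \<bar>u0 $ k\<bar>)) \<in> range (\<lambda>k. \<bar>u0 $ k\<bar>)" by (intro Max_in) auto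
    then obtain i0 where "Max (range (\<lambda>k. \<bar>u0 $ k\<bar>)) = \<bar>u0 $ i0\<bar>" by (rule imageE)
    moreover have "\<bar>u0 $ k\<bar> \<le> Max (range (\<lambda>k. \<bar>u0 $ k\<bar>))" for k by (intro Max_ge) auto
    ultimately have i0: "\<bar>u0 $ k\<bar> \<le> \<bar>u0 $ i0\<bar>" for k by simp
    have nz: "u0 $ i0 \<noteq> 0" using u0(2) i0 by (auto simp: vec_eq_iff)
    define u where "u = (1 / u0 $ i0) *\<^sub>R u0"
    have u: "u \<in> U" "u $ i0 = 1" "\<bar>u $ k\<bar> \<le> 1" for k
      using u0 U(1) nz i0[of k] by (auto simp: u_def subspace_scale divide_simps)
    define U' where "U' = {x\<in>U. x $ i0 = 0}"
    have U': "subspace U'" using U(1) by (auto simp: U'_def subspace_def)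
    have "u \<notin> U'" using u by (simp add: U'_def)
    have dec: "x - (x $ i0) *\<^sub>R u \<in> U'" if "x \<in> U" for x
      using that u U(1) by (simp add: U'_def subspace_diff subspace_scale)
    have "span (insert u U') = U"
    proof
      show "span (insert u U') \<subseteq> U" using u(1) U(1) by (intro span_minimal) (auto simp: U'_def)
      show "U \<subseteq> span (insert u U')"
      proof
        fix x assume "x \<in> U"
        then have "x = (x - (x $ i0) *\<^sub>R u) + (x $ i0) *\<^sub>R u" "x - (x $ i0) *\<^sub>R u \<in> U'" using dec by auto
        then show "x \<in> span (insert u U')"
          by (metis insertCI span_add span_base span_scale)
      qed
    qed
    then have "dim (insert u U') = Suc n" using U(2) by (metis dim_span)
    moreover have "u \<notin> span U'" using \<open>u \<notin> U'\<close> U' by (simp add: span_eq_iff[THEN iffD2])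
    ultimately have "dim U' = n" by (simp add: dim_insert)
    from c(2)[OF U' this] obtain I v where Iv: "card I = n \<and> (\<forall>i\<in>I. v i \<in> U' \<and> v i $ i = 1
        \<and> (\<forall>j\<in>I - {i}. v i $ j = 0) \<and> (\<forall>k. \<bar>v i $ k\<bar> \<le> c)) \<and> (\<forall>x\<in>U'. x = (\<Sum>i\<in>I. x $ i *\<^sub>R v i))"
      by (elim exE) (rule that)
    then have I: "card I = n" by (rule conjunct1)
    have v: "v i \<in> U' \<and> v i $ i = 1 \<and> (\<forall>j\<in>I - {i}. v i $ j = 0) \<and> (\<forall>k. \<bar>v i $ k\<bar> \<le> c)" if "i \<in> I" for i
      using Iv that by (elim conjE) (rule bspec)
    have rep: "x = (\<Sum>i\<in>I. x $ i *\<^sub>R v i)" if "x \<in> U'" for x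
      using Iv that by (elim conjE) (rule bspec)
    have i0I: "i0 \<notin> I" using v by (force simp: U'_def)
    define v0 where "v0 = u - (\<Sum>i\<in>I. u $ i *\<^sub>R v i)"
    have vi0: "v i $ i0 = 0" "v i \<in> U" if "i \<in> I" for i using v[OF that] by (auto simp: U'_def)
    have v0: "v0 \<in> U" unfolding v0_def using u(1) U(1) vi0
      by (intro subspace_diff subspace_sum subspace_scale) auto
    have v0i0: "v0 $ i0 = 1" unfolding v0_def using u(2) vi0 by (simp add: sum_component)
    have v0j: "v0 $ j = 0" if j: "j \<in> I" for j
    proof -
      have "(\<Sum>i\<in>I. u $ i * v i $ j) = (\<Sum>i\<in>I. if i = j then u $ j else 0)"
        using v j by (intro sum.cong) auto
      then show ?thesis using j by (simp add: v0_def sum_component)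
    qed
    have v0k: "\<bar>v0 $ k\<bar> \<le> c'" for k
    proof -
      have "\<bar>\<Sum>i\<in>I. u $ i * v i $ k\<bar> \<le> (\<Sum>i\<in>I. 1 * c)"
        unfolding abs_mult[symmetric]
      proof (intro order.trans[OF sum_abs] sum_mono)
        fix i assume "i \<in> I"
        then show "\<bar>u $ i * v i $ k\<bar> \<le> 1 * c"
          unfolding abs_mult using v[of i] u(3)[of i] by (intro mult_mono) auto
      qed
      then show ?thesis using u(3)[of k] c(1) I by (simp add: v0_def sum_component c'_def)
    qed
    define w where "w = v(i0 := v0)"
    have "x = (\<Sum>i\<in>insert i0 I. x $ i *\<^sub>R w i)" if x: "x \<in> U" for x
    proof -
      have "x - (x $ i0) *\<^sub>R u = (\<Sum>i\<in>I. (x - (x $ i0) *\<^sub>R u) $ i *\<^sub>R v i)" by (rule rep[OF dec[OF x]])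
      also have "\<dots> = (\<Sum>i\<in>I. x $ i *\<^sub>R v i) - (x $ i0) *\<^sub>R (\<Sum>i\<in>I. u $ i *\<^sub>R v i)"
        by (simp add: scaleR_left_diff_distrib sum_subtractf scaleR_sum_right)
      finally have "x = (x $ i0) *\<^sub>R v0 + (\<Sum>i\<in>I. x $ i *\<^sub>R v i)"
        by (simp add: v0_def algebra_simps)
      also have "(\<Sum>i\<in>I. x $ i *\<^sub>R v i) = (\<Sum>i\<in>I. x $ i *\<^sub>R w i)"
        using i0I by (intro sum.cong) (auto simp: w_def)
      finally show ?thesis using i0I by (simp add: w_def)
    qed
    moreover have "\<forall>i\<in>insert i0 I. w i \<in> U \<and> w i $ i = 1 \<and> (\<forall>j\<in>insert i0 I - {i}. w i $ j = 0) \<and> (\<forall>k. \<bar>w i $ k\<bar> \<le> c')"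
    proof
      fix i assume "i \<in> insert i0 I"
      have "c \<le> c'" using c(1) by (simp add: c'_def)
      show "w i \<in> U \<and> w i $ i = 1 \<and> (\<forall>j\<in>insert i0 I - {i}. w i $ j = 0) \<and> (\<forall>k. \<bar>w i $ k\<bar> \<le> c')"
      proof (cases "i = i0")
        case True
        then show ?thesis using v0 v0i0 v0j v0k by (auto simp: w_def)
      next
        case False
        then have iI: "i \<in> I" using \<open>i \<in> insert i0 I\<close> by simp
        have "\<bar>v i $ k\<bar> \<le> c'" for k using v[OF iI] \<open>c \<le> c'\<close> by (metis order.trans)
        then show ?thesis using v[OF iI] vi0[OF iI] False by (auto simp: w_def)
      qed
    qed
    moreover have "card (insert i0 I) = Suc n" using i0I I by simp
    ultimately show ?thesis by blast
  qed
  moreover have "c' \<ge> 0" using c(1) by (simp add: c'_def)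
  ultimately show ?case by blast
qed

lemma orth_proj_add:
  assumes "subspace U"
  shows "orth_proj U (x + y) = orth_proj U x + orth_proj U y"
proof (rule orth_proj_eqI[OF assms])
  show "orth_proj U x + orth_proj U y \<in> U" using orth_proj_props[OF assms] assms by (simp add: subspace_add)
  have "(x - orth_proj U x) + (y - orth_proj U y) \<in> U\<^sup>\<bottom>"
    using orth_proj_props[OF assms] by (intro subspace_add subspace_orthogonal_comp)
  then show "x + y - (orth_proj U x + orth_proj U y) \<in> U\<^sup>\<bottom>" by (simp add: algebra_simps)
qed

lemma orth_proj_inner:
  assumes "subspace U" "u \<in> U"
  shows "u \<bullet> (x - orth_proj U x) = 0"
  using orth_proj_props(2)[OF assms(1), of x] assms(2) by (auto simp: orthogonal_comp_def orthogonal_def inner_commute)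

lemma orth_proj_norms:
  assumes "subspace U"
  shows "norm (orth_proj U x) \<le> norm x" "norm (x - orth_proj U x) \<le> norm x"
proof -
  have "orthogonal (orth_proj U x) (x - orth_proj U x)"
    using orth_proj_inner[OF assms orth_proj_props(1)[OF assms], of x x] by (simp add: orthogonal_def)
  from norm_add_Pythagorean[OF this]
  have "(norm x)\<^sup>2 = (norm (orth_proj U x))\<^sup>2 + (norm (x - orth_proj U x))\<^sup>2" by simp
  then have "(norm (orth_proj U x))\<^sup>2 \<le> (norm x)\<^sup>2" "(norm (x - orth_proj U x))\<^sup>2 \<le> (norm x)\<^sup>2" by simp_all
  then show "norm (orth_proj U x) \<le> norm x" "norm (x - orth_proj U x) \<le> norm x"
    by (simp_all add: power2_le_iff_abs_le)
qed

lemma orth_proj_best: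
  assumes "subspace U" "u \<in> U"
  shows "norm (x - orth_proj U x) \<le> norm (x - u)"
proof -
  have eq: "x - u - orth_proj U (x - u) = x - orth_proj U x"
  proof -
    have "orth_proj U (x - u + u) = orth_proj U (x - u) + orth_proj U u" by (rule orth_proj_add[OF assms(1)])
    moreover have "orth_proj U u = u"
      using assms by (intro orth_proj_eqI) (auto simp: orthogonal_comp_def orthogonal_def)
    ultimately show ?thesis by (simp add: algebra_simps)
  qed
  show ?thesis using orth_proj_norms(2)[OF assms(1), of "x - u"] unfolding eq .
qed

text \<open>Let \<open>P\<close> and \<open>Q\<close> be the projections. Then \<open>P x - Q x = (P x - Q (P x)) - Q (x - P x)\<close>. The first
  term is the distance from \<open>P x \<in> U\<close> to \<open>W\<close>. For the second, \<open>w = Q (x - P x)\<close> satisfies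
  \<open>\<bar>w\<bar>\<^sup>2 = w \<bullet> (x - P x)\<close>, and \<open>w\<close> is close to a vector of \<open>U\<close>, which is orthogonal to \<open>x - P x\<close>.\<close>

lemma orth_proj_diff_le:
  assumes U: "subspace U" and W: "subspace W" and e: "e \<ge> 0"
    and UW: "\<And>u. u \<in> U \<Longrightarrow> \<exists>w\<in>W. norm (u - w) \<le> e * norm u"
    and WU: "\<And>w. w \<in> W \<Longrightarrow> \<exists>u\<in>U. norm (w - u) \<le> e * norm w"
  shows "norm (orth_proj U x - orth_proj W x) \<le> 2 * e * norm x"
proof -
  let ?P = "orth_proj U" and ?Q = "orth_proj W"
  define x' where "x' = x - ?P x"
  have x': "norm x' \<le> norm x" unfolding x'_def by (rule orth_proj_norms(2)[OF U])
  have 1: "norm (?P x - ?Q (?P x)) \<le> e * norm x"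
  proof -
    obtain w where w: "w \<in> W" "norm (?P x - w) \<le> e * norm (?P x)" using UW[OF orth_proj_props(1)[OF U]] by blast
    have "norm (?P x - ?Q (?P x)) \<le> norm (?P x - w)" by (rule orth_proj_best[OF W w(1)])
    also have "\<dots> \<le> e * norm (?P x)" by (rule w(2))
    also have "\<dots> \<le> e * norm x" using orth_proj_norms(1)[OF U] e by (intro mult_left_mono)
    finally show ?thesis .
  qed
  have 2: "norm (?Q x') \<le> e * norm x"
  proof -
    let ?w = "?Q x'"
    have w: "?w \<in> W" by (rule orth_proj_props(1)[OF W])
    obtain u where u: "u \<in> U" "norm (?w - u) \<le> e * norm ?w" using WU[OF w] by blast
    have "?w \<bullet> x' = ?w \<bullet> ?w" using orth_proj_inner[OF W w, of x'] by (simp add: inner_diff_right)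
    moreover have "u \<bullet> x' = 0" unfolding x'_def by (rule orth_proj_inner[OF U u(1)])
    ultimately have "(norm ?w)\<^sup>2 = (?w - u) \<bullet> x'" by (simp add: power2_norm_eq_inner inner_diff_left)
    also have "\<dots> \<le> norm (?w - u) * norm x'" by (rule norm_cauchy_schwarz)
    also have "\<dots> \<le> (e * norm ?w) * norm x" using u(2) x' e by (intro mult_mono) auto
    finally have "norm ?w * norm ?w \<le> norm ?w * (e * norm x)" by (simp add: power2_eq_square mult_ac)
    then show ?thesis using e by (cases "?w = 0") (auto dest: mult_left_le_imp_le)
  qed
  have "?Q x = ?Q (?P x) + ?Q x'" using orth_proj_add[OF W, of "?P x" x'] by (simp add: x'_def)
  then have "?P x - ?Q x = (?P x - ?Q (?P x)) - ?Q x'" by (simp add: algebra_simps)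
  then have "norm (?P x - ?Q x) \<le> norm (?P x - ?Q (?P x)) + norm (?Q x')" by (metis norm_triangle_ineq4)
  with 1 2 show ?thesis by simp
qed

definition graph_plane :: "'d::finite set \<Rightarrow> ('d \<Rightarrow> real \<times> ('d \<Rightarrow> real)) \<Rightarrow> (real ^ 'd) set"
  where "graph_plane I \<theta> = {x. \<forall>k\<in>-I. defect I \<theta> x k = 0}"

lemma affine_plane_is_graph:
  "\<exists>c\<ge>0. \<forall>V :: (real ^ 'd) set. V \<in> affine_planes n \<longrightarrow>
    (\<exists>I \<theta>. card I = n \<and> V = graph_plane I \<theta> \<and> (\<forall>k\<in>-I. \<forall>i\<in>I. \<bar>snd (\<theta> k) i\<bar> \<le> c))"
proof -
  from bounded_graph_basis[where n = n and 'd = 'd]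
  obtain c where c: "c \<ge> 0" "\<forall>U :: (real ^ 'd) set. subspace U \<and> dim U = n \<longrightarrow>
    (\<exists>I v. card I = n \<and> (\<forall>i\<in>I. v i \<in> U \<and> v i $ i = 1 \<and> (\<forall>j\<in>I - {i}. v i $ j = 0) \<and> (\<forall>k. \<bar>v i $ k\<bar> \<le> c))
      \<and> (\<forall>x\<in>U. x = (\<Sum>i\<in>I. x $ i *\<^sub>R v i)))"
    by (elim exE conjE) (rule that)
  have "\<exists>I \<theta>. card I = n \<and> V = graph_plane I \<theta> \<and> (\<forall>k\<in>-I. \<forall>i\<in>I. \<bar>snd (\<theta> k) i\<bar> \<le> c)"
    if V: "V \<in> affine_planes n" for V :: "(real ^ 'd) set"
  proof -
    obtain a U where U: "V = (+) a ` U" "subspace U" "dim U = n" using V unfolding affine_planes_repr by blast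
    from c(2)[rule_format, OF conjI[OF U(2,3)]] obtain I v where Iv: "card I = n \<and> (\<forall>i\<in>I. v i \<in> U \<and> v i $ i = 1
        \<and> (\<forall>j\<in>I - {i}. v i $ j = 0) \<and> (\<forall>k. \<bar>v i $ k\<bar> \<le> c)) \<and> (\<forall>x\<in>U. x = (\<Sum>i\<in>I. x $ i *\<^sub>R v i))"
      by (elim exE) (rule that)
    have v: "v i \<in> U" "v i $ i = 1" "\<forall>j\<in>I - {i}. v i $ j = 0" "\<forall>k. \<bar>v i $ k\<bar> \<le> c" if "i \<in> I" for i
      using Iv that by (elim conjE; auto)+
    have rep: "x = (\<Sum>i\<in>I. x $ i *\<^sub>R v i)" if "x \<in> U" for x
      using Iv that by (elim conjE) (rule bspec)
    define \<theta> where "\<theta> k = (a $ k - (\<Sum>i\<in>I. a $ i * v i $ k), \<lambda>i. v i $ k)" for k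
    have def: "defect I \<theta> x k = (x - a) $ k - (\<Sum>i\<in>I. (x - a) $ i * v i $ k)" for x k
    proof -
      have "(\<Sum>i\<in>I. v i $ k * x $ i) = (\<Sum>i\<in>I. x $ i * v i $ k)" by (intro sum.cong refl mult.commute)
      then show ?thesis by (simp add: defect_def \<theta>_def left_diff_distrib sum_subtractf)
    qed
    have "x \<in> V \<longleftrightarrow> x - a \<in> U" for x
    proof
      assume "x - a \<in> U"
      then have "a + (x - a) \<in> (+) a ` U" by (rule imageI)
      then show "x \<in> V" by (simp add: U(1))
    qed (auto simp: U(1))
    moreover have "x - a \<in> U \<longleftrightarrow> x \<in> graph_plane I \<theta>" for x
    proof
      assume "x - a \<in> U"
      have comp: "(x - a) $ k = (\<Sum>i\<in>I. (x - a) $ i * v i $ k)" for k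
      proof -
        have "(x - a) $ k = (\<Sum>i\<in>I. (x - a) $ i *\<^sub>R v i) $ k"
          using \<open>x - a \<in> U\<close> by (intro arg_cong[where f = "\<lambda>y. y $ k"] rep)
        also have "\<dots> = (\<Sum>i\<in>I. (x - a) $ i * v i $ k)" by (simp add: sum_component)
        finally show ?thesis .
      qed
      show "x \<in> graph_plane I \<theta>"
        unfolding graph_plane_def def by (intro CollectI ballI right_minus_eq[THEN iffD2] comp)
    next
      assume x: "x \<in> graph_plane I \<theta>"
      have "(x - a) $ k = (\<Sum>i\<in>I. (x - a) $ i *\<^sub>R v i) $ k" for k
      proof (cases "k \<in> I")
        case True
        have "(\<Sum>i\<in>I. (x - a) $ i * v i $ k) = (\<Sum>i\<in>I. if i = k then (x - a) $ k else 0)"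
          using v(2,3) True by (intro sum.cong) auto
        also have "\<dots> = (x - a) $ k" using True by simp
        finally have "(\<Sum>i\<in>I. (x - a) $ i * v i $ k) = (x - a) $ k" .
        moreover have "(\<Sum>i\<in>I. (x - a) $ i *\<^sub>R v i) $ k = (\<Sum>i\<in>I. (x - a) $ i * v i $ k)"
          by (simp add: sum_component)
        ultimately show ?thesis by (metis (no_types))
      next
        case False
        then have "(x - a) $ k - (\<Sum>i\<in>I. (x - a) $ i * v i $ k) = 0"
          using x unfolding graph_plane_def def by blast
        then have "(x - a) $ k = (\<Sum>i\<in>I. (x - a) $ i * v i $ k)" by (rule right_minus_eq[THEN iffD1])
        also have "\<dots> = (\<Sum>i\<in>I. (x - a) $ i *\<^sub>R v i) $ k" by (simp add: sum_component)
        finally show ?thesis .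
      qed
      then have "x - a = (\<Sum>i\<in>I. (x - a) $ i *\<^sub>R v i)" unfolding vec_eq_iff ..
      also have "\<dots> \<in> U" using v(1) U(2) by (intro subspace_sum subspace_scale) auto
      finally show "x - a \<in> U" .
    qed
    ultimately have "V = graph_plane I \<theta>" by blast
    moreover have "\<forall>k\<in>-I. \<forall>i\<in>I. \<bar>snd (\<theta> k) i\<bar> \<le> c" using v(4) by (simp add: \<theta>_def)
    ultimately show ?thesis using Iv by (intro exI[of _ I] exI[of _ \<theta>] conjI) (elim conjE)
  qed
  with c(1) show ?thesis by (intro exI[of _ c] conjI allI impI)
qed

lemma defect_diff_le:
  fixes p x :: "real ^ 'd"
  assumes "\<forall>i\<in>I. \<bar>snd (\<theta> k) i\<bar> \<le> c" "c \<ge> 0"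
  shows "\<bar>defect I \<theta> p k - defect I \<theta> x k\<bar> \<le> (1 + real CARD('d) * c) * dist p x"
proof -
  have comp: "\<bar>p $ i - x $ i\<bar> \<le> dist p x" for i
    using component_le_norm_cart[of "p - x" i] by (simp add: dist_norm)
  have "\<bar>\<Sum>i\<in>I. snd (\<theta> k) i * (p $ i - x $ i)\<bar> \<le> (\<Sum>i\<in>I. c * dist p x)"
  proof (intro order.trans[OF sum_abs] sum_mono)
    fix i assume "i \<in> I"
    then show "\<bar>snd (\<theta> k) i * (p $ i - x $ i)\<bar> \<le> c * dist p x"
      unfolding abs_mult using assms comp by (intro mult_mono) auto
  qed
  also have "\<dots> \<le> real CARD('d) * (c * dist p x)" using assms by (simp add: card_mono mult_right_mono)
  finally have "\<bar>\<Sum>i\<in>I. snd (\<theta> k) i * (p $ i - x $ i)\<bar> \<le> real CARD('d) * (c * dist p x)" .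
  moreover have "defect I \<theta> p k - defect I \<theta> x k = (p $ k - x $ k) - (\<Sum>i\<in>I. snd (\<theta> k) i * (p $ i - x $ i))"
    by (simp add: defect_def right_diff_distrib sum_subtractf)
  ultimately show ?thesis using comp[of k] by (simp add: algebra_simps)
qed

lemma incident_defect_le:
  fixes p :: "real ^ 'd"
  assumes V: "graph_plane I \<theta> \<in> affine_planes n" and p: "p \<in> neighbourhood (graph_plane I \<theta>) r"
    and c: "\<forall>k\<in>-I. \<forall>i\<in>I. \<bar>snd (\<theta> k) i\<bar> \<le> c" "c \<ge> 0" and k: "k \<in> - I"
  shows "\<bar>defect I \<theta> p k\<bar> \<le> (1 + real CARD('d) * c) * r"
proof -
  have "affine (graph_plane I \<theta>)" "graph_plane I \<theta> \<noteq> {}" using V by (auto simp: affine_planes_def)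
  then obtain x where x: "x \<in> graph_plane I \<theta>" "infdist p (graph_plane I \<theta>) = dist p x"
    using infdist_attains_inf affine_closed by blast
  have "\<bar>defect I \<theta> p k - defect I \<theta> x k\<bar> \<le> (1 + real CARD('d) * c) * dist p x"
    using c k by (intro defect_diff_le) auto
  also have "\<dots> \<le> (1 + real CARD('d) * c) * r"
    using p x(2) c(2) by (intro mult_left_mono) (auto simp: neighbourhood_def)
  finally show ?thesis using x(1) k by (simp add: graph_plane_def)
qed

text \<open>Slopes are bounded by the choice of the coordinates \<open>I\<close>; offsets only because the plane comes close
  to a point of the unit ball.\<close>

lemma incident_bounded_params:
  fixes p :: "real ^ 'd"
  assumes c: "\<forall>k\<in>-I. \<forall>i\<in>I. \<bar>snd (\<theta> k) i\<bar> \<le> c" "c \<ge> 0" and p: "norm p \<le> 1"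
    and b: "\<forall>k\<in>-I. \<bar>defect I \<theta> p k\<bar> \<le> b" "b \<ge> 0"
  shows "bounded_params I (1 + real CARD('d) * c + c + b) \<theta>"
  unfolding bounded_params_def
proof (intro ballI conjI)
  fix k assume k: "k \<in> - I"
  have "\<bar>defect I \<theta> p k - defect I \<theta> 0 k\<bar> \<le> (1 + real CARD('d) * c) * dist p 0"
    using c k by (intro defect_diff_le) auto
  also have "\<dots> \<le> (1 + real CARD('d) * c) * 1" using p c(2) by (intro mult_left_mono) auto
  finally have "\<bar>defect I \<theta> p k - defect I \<theta> 0 k\<bar> \<le> 1 + real CARD('d) * c" by simp
  moreover have "defect I \<theta> 0 k = - fst (\<theta> k)" by (simp add: defect_def)
  moreover have "\<bar>defect I \<theta> p k\<bar> \<le> b" using b k by blast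
  ultimately show "\<bar>fst (\<theta> k)\<bar> \<le> 1 + real CARD('d) * c + c + b" using c(2) by linarith
  fix i assume "i \<in> I"
  then have "\<bar>snd (\<theta> k) i\<bar> \<le> c" using c k by blast
  moreover have "0 \<le> real CARD('d) * c" using c(2) by simp
  ultimately show "\<bar>snd (\<theta> k) i\<bar> \<le> 1 + real CARD('d) * c + c + b" using b(2) by linarith
qed

lemma graph_plane_direction:
  fixes I :: "'d::finite set"
  shows "plane_direction (graph_plane I \<theta>) = {u. \<forall>k\<in>-I. u $ k = (\<Sum>i\<in>I. snd (\<theta> k) i * u $ i)}"
proof (intro set_eqI iffI)
  fix u assume "u \<in> plane_direction (graph_plane I \<theta>)"
  then obtain x y where xy: "u = x - y" "x \<in> graph_plane I \<theta>" "y \<in> graph_plane I \<theta>"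
    by (auto simp: plane_direction_def)
  show "u \<in> {u. \<forall>k\<in>-I. u $ k = (\<Sum>i\<in>I. snd (\<theta> k) i * u $ i)}"
  proof (intro CollectI ballI)
    fix k assume "k \<in> - I"
    then have "defect I \<theta> x k = 0" "defect I \<theta> y k = 0" using xy by (auto simp: graph_plane_def)
    then show "u $ k = (\<Sum>i\<in>I. snd (\<theta> k) i * u $ i)"
      by (simp add: xy(1) defect_def right_diff_distrib sum_subtractf)
  qed
next
  fix u :: "real ^ 'd"
  assume u: "u \<in> {u. \<forall>k\<in>-I. u $ k = (\<Sum>i\<in>I. snd (\<theta> k) i * u $ i)}"
  define y :: "real ^ 'd" where "y = (\<chi> k. if k \<in> I then 0 else fst (\<theta> k))"
  have y: "y \<in> graph_plane I \<theta>" by (auto simp: graph_plane_def defect_def y_def)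
  then have "y + u \<in> graph_plane I \<theta>"
    using u by (auto simp: graph_plane_def defect_def distrib_left sum.distrib)
  moreover have "u = (y + u) - y" by simp
  ultimately show "u \<in> plane_direction (graph_plane I \<theta>)"
    using y unfolding plane_direction_def by blast
qed

lemma graph_direction_close:
  fixes I :: "'d::finite set"
  assumes "\<forall>k\<in>-I. \<forall>i\<in>I. \<bar>snd (\<theta> k) i - snd (\<theta>' k) i\<bar> \<le> h" "h \<ge> 0"
    and u: "u \<in> plane_direction (graph_plane I \<theta>)"
  shows "\<exists>w\<in>plane_direction (graph_plane I \<theta>'). norm (u - w) \<le> (real CARD('d))\<^sup>2 * h * norm u"
proof -
  (* The vector of the other direction with the same horizontal coordinates as u. *)
  define w :: "real ^ 'd" where "w = (\<chi> k. if k \<in> I then u $ k else (\<Sum>i\<in>I. snd (\<theta>' k) i * u $ i))"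
  have "w \<in> plane_direction (graph_plane I \<theta>')" by (auto simp: graph_plane_direction w_def)
  moreover have "\<bar>(u - w) $ k\<bar> \<le> real CARD('d) * h * norm u" for k
  proof (cases "k \<in> I")
    case True
    then show ?thesis using assms(2) by (simp add: w_def)
  next
    case False
    then have "(u - w) $ k = (\<Sum>i\<in>I. (snd (\<theta> k) i - snd (\<theta>' k) i) * u $ i)"
      using u by (simp add: graph_plane_direction w_def left_diff_distrib sum_subtractf)
    also have "\<bar>\<dots>\<bar> \<le> (\<Sum>i\<in>I. h * norm u)"
    proof (intro order.trans[OF sum_abs] sum_mono)
      fix i assume "i \<in> I"
      then show "\<bar>(snd (\<theta> k) i - snd (\<theta>' k) i) * u $ i\<bar> \<le> h * norm u"
        unfolding abs_mult using assms False component_le_norm_cart[of u i] by (intro mult_mono) auto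
    qed
    also have "\<dots> \<le> real CARD('d) * (h * norm u)" using assms by (simp add: card_mono mult_right_mono)
    finally show ?thesis by (simp add: mult.assoc)
  qed
  then have "(\<Sum>k\<in>UNIV. \<bar>(u - w) $ k\<bar>) \<le> (\<Sum>k\<in>(UNIV :: 'd set). real CARD('d) * h * norm u)" by (intro sum_mono)
  then have "norm (u - w) \<le> (real CARD('d))\<^sup>2 * h * norm u"
    using norm_le_l1_cart[of "u - w"] by (simp add: power2_eq_square mult.assoc)
  ultimately show ?thesis by blast
qed

text \<open>The offset is the component orthogonal to the direction of an arbitrary point of the plane.\<close>

lemma plane_offset_eq:
  assumes "V \<in> affine_planes n" "x \<in> V"
  shows "plane_offset V = x - orth_proj (plane_direction V) x"
proof -
  obtain a U where U: "V = (+) a ` U" "subspace U" "a \<in> U\<^sup>\<bottom>" using assms(1) unfolding affine_planes_repr by blast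
  obtain u where u: "u \<in> U" "x = a + u" using assms(2) U(1) by auto
  have "orth_proj U x = u" using U u by (intro orth_proj_eqI) auto
  then show ?thesis using u U by (simp add: plane_offset_translate plane_direction_translate)
qed

lemma plane_direction_subspace:
  assumes "V \<in> affine_planes n"
  shows "subspace (plane_direction V)"
  using assms unfolding affine_planes_repr by (auto simp: plane_direction_translate)

text \<open>The distance of planes is Lipschitz in the parameters. In the contrapositive, separated planes have
  separated parameters. The bound on the offsets of \<open>\<theta>\<close> is needed because a change of direction moves
  the offset by an amount proportional to the distance of the plane from the origin.\<close>

lemma plane_dist_graph_le:
  fixes I :: "'d::finite set" and \<theta> \<theta>' :: "'d \<Rightarrow> real \<times> ('d \<Rightarrow> real)"
  defines "d \<equiv> real CARD('d)"
  assumes V: "graph_plane I \<theta> \<in> affine_planes n" and W: "graph_plane I \<theta>' \<in> affine_planes n"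
    and bnd: "bounded_params I c \<theta>" "c \<ge> 0" and h: "h \<ge> 0"
    and diff: "\<forall>k\<in>-I. \<bar>fst (\<theta> k) - fst (\<theta>' k)\<bar> \<le> h" "\<forall>k\<in>-I. \<forall>i\<in>I. \<bar>snd (\<theta> k) i - snd (\<theta>' k) i\<bar> \<le> h"
  shows "plane_dist (graph_plane I \<theta>) (graph_plane I \<theta>') \<le> (2 * d\<^sup>2 + d + 2 * d ^ 3 * c) * h"
proof -
  let ?V = "graph_plane I \<theta>" and ?W = "graph_plane I \<theta>'"
  let ?P = "orth_proj (plane_direction ?V)" and ?Q = "orth_proj (plane_direction ?W)"
  note sV = plane_direction_subspace[OF V] and sW = plane_direction_subspace[OF W]
  have diff': "\<forall>k\<in>-I. \<forall>i\<in>I. \<bar>snd (\<theta>' k) i - snd (\<theta> k) i\<bar> \<le> h" using diff(2) by (simp add: abs_minus_commute)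
  have proj: "norm (?P x - ?Q x) \<le> 2 * (d\<^sup>2 * h) * norm x" for x
    unfolding d_def using h diff(2) diff'
    by (intro orth_proj_diff_le[OF sV sW] graph_direction_close) auto
  have op: "onorm (\<lambda>x. ?P x - ?Q x) \<le> 2 * (d\<^sup>2 * h)" by (rule onorm_le) (rule proj)
  (* The points of the two planes with horizontal coordinates 0. *)
  define x :: "real ^ 'd" where "x = (\<chi> k. if k \<in> I then 0 else fst (\<theta> k))"
  define y :: "real ^ 'd" where "y = (\<chi> k. if k \<in> I then 0 else fst (\<theta>' k))"
  have xy: "x \<in> ?V" "y \<in> ?W" by (auto simp: graph_plane_def defect_def x_def y_def)
  have "norm x \<le> (\<Sum>k\<in>(UNIV :: 'd set). c)"
    using norm_le_l1_cart[of x] bnd by (elim order.trans, intro sum_mono) (auto simp: x_def bounded_params_def)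
  then have nx: "norm x \<le> d * c" by (simp add: d_def)
  have "norm (x - y) \<le> (\<Sum>k\<in>(UNIV :: 'd set). h)"
    using norm_le_l1_cart[of "x - y"] diff(1) h by (elim order.trans, intro sum_mono) (auto simp: x_def y_def)
  then have nxy: "norm (x - y) \<le> d * h" by (simp add: d_def)
  have "plane_offset ?V - plane_offset ?W = ((x - y) - ?Q (x - y)) - (?P x - ?Q x)"
  proof -
    have "?Q x = ?Q (x - y) + ?Q y" using orth_proj_add[OF sW, of "x - y" y] by simp
    then show ?thesis using plane_offset_eq[OF V xy(1)] plane_offset_eq[OF W xy(2)] by (simp add: algebra_simps)
  qed
  then have "norm (plane_offset ?V - plane_offset ?W) \<le> norm ((x - y) - ?Q (x - y)) + norm (?P x - ?Q x)"
    by (metis norm_triangle_ineq4)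
  also have "\<dots> \<le> d * h + 2 * (d\<^sup>2 * h) * (d * c)"
  proof (rule add_mono)
    show "norm ((x - y) - ?Q (x - y)) \<le> d * h" using orth_proj_norms(2)[OF sW] nxy by (rule order.trans)
    have "norm (?P x - ?Q x) \<le> 2 * (d\<^sup>2 * h) * norm x" by (rule proj)
    also have "\<dots> \<le> 2 * (d\<^sup>2 * h) * (d * c)" using nx h by (intro mult_left_mono) auto
    finally show "norm (?P x - ?Q x) \<le> 2 * (d\<^sup>2 * h) * (d * c)" .
  qed
  finally show ?thesis using op unfolding plane_dist_def
    by (simp add: algebra_simps power2_eq_square power3_eq_cube)
qed

section \<open>The incidence bound\<close>

lemma frostman_bound_of_delta_s_set:
  fixes P :: "(real ^ 'd) set"
  assumes "delta_separated dist \<delta> P" "0 < \<delta>" "\<delta> < 1" "delta_s_set \<delta> t C\<^sub>F P" "C\<^sub>F \<ge> 1" "t \<ge> 0" "P \<subseteq> cball 0 1"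
  shows "frostman_bound \<delta> t (real ((2 * CARD('d) + 3) ^ CARD('d)) * C\<^sub>F * real (card P)) P"
  unfolding frostman_bound_def
proof (intro conjI allI impI)
  show "finite P" using separated_finite assms(1,2,4) by (auto simp: delta_s_set_def)
  have "1 * 1 \<le> real ((2 * CARD('d) + 3) ^ CARD('d)) * C\<^sub>F"
    using assms(5) by (intro mult_mono) (auto simp: one_le_power)
  then have "1 * real (card P) \<le> real ((2 * CARD('d) + 3) ^ CARD('d)) * C\<^sub>F * real (card P)"
    by (intro mult_right_mono) auto
  then show "real (card P) \<le> real ((2 * CARD('d) + 3) ^ CARD('d)) * C\<^sub>F * real (card P)" by simp
qed (use assms frostman_count in auto)

lemma card_incidences:
  assumes "finite P" "finite \<V>"
  shows "card (incidences r P \<V>) = (\<Sum>V\<in>\<V>. card {p\<in>P. p \<in> neighbourhood V r})"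
proof -
  have "incidences r P \<V> = prod.swap ` (SIGMA V:\<V>. {p\<in>P. p \<in> neighbourhood V r})"
    by (auto simp: incidences_def image_iff)
  then show ?thesis using assms by (simp add: card_image card_SigmaI)
qed

text \<open>Planes without incidences may have unbounded offsets, so they are discarded before passing to
  parameters.\<close>

lemma incidences_of_graphs:
  fixes I :: "'d::finite set" and A c t :: real
  assumes I: "I \<noteq> {}" and t: "real (card (- I)) < t" "t \<le> real CARD('d)" and c: "c \<ge> 0" and A: "A \<ge> 0"
  defines "n \<equiv> card I" and "d \<equiv> real CARD('d)"
  shows "\<exists>K\<ge>0. \<forall>P B \<delta> \<V> \<Theta>. frostman_bound \<delta> t B P \<longrightarrow> 0 < \<delta> \<longrightarrow> \<delta> < 1 \<longrightarrow> finite \<V> \<longrightarrow> \<V> \<subseteq> affine_planes n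
    \<longrightarrow> delta_separated plane_dist \<delta> \<V>
    \<longrightarrow> (\<forall>V\<in>\<V>. V = graph_plane I (\<Theta> V) \<and> (\<forall>k\<in>-I. \<forall>i\<in>I. \<bar>snd (\<Theta> V k) i\<bar> \<le> c))
    \<longrightarrow> (\<Sum>V\<in>\<V>. real (card {p\<in>P. p \<in> neighbourhood V (A * \<delta>)}))
      \<le> K * B * incidence_rate d (real n) t \<delta> (card \<V>)"
proof -
  (* An incidence within A \<delta> of the plane has defects at most a \<delta>, and then all parameters are at
     most c2. The constant L is the Lipschitz constant of the plane distance, and \<kappa> is so small that
     parameters closer than 2 \<kappa> \<delta> give planes closer than \<delta>. *)
  define a where "a = (1 + d * c) * A"
  have d: "d \<ge> 0" by (simp add: d_def)
  have a: "a \<ge> 0" using c d A by (simp add: a_def)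
  define c2 where "c2 = 1 + d * c + c + a"
  have c2: "c2 \<ge> 0" using c d a by (simp add: c2_def)
  define L where "L = 2 * d\<^sup>2 + d + 2 * d ^ 3 * c2"
  have L: "L \<ge> 0" using d c2 by (simp add: L_def)
  define \<kappa> where "\<kappa> = 1 / (2 * (L + 1))"
  have \<kappa>: "0 < \<kappa>" "\<kappa> \<le> 1" using L by (simp_all add: \<kappa>_def)
  from incidence_bound_graphs[OF I t c2 \<kappa>, of a]
  obtain K where K: "K \<ge> 0" "\<forall>P B \<delta> T. frostman_bound \<delta> t B P \<longrightarrow> 0 < \<delta> \<longrightarrow> \<delta> < 1
    \<longrightarrow> separated_family I c2 (2 * (\<kappa> * \<delta>)) T
    \<longrightarrow> (\<Sum>\<theta>\<in>T. real (card {p\<in>P. \<forall>k\<in>-I. \<bar>defect I \<theta> p k\<bar> \<le> a * \<delta>}))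
      \<le> K * B * incidence_rate (real CARD('d)) (real (card I)) t \<delta> (card T)"
    by (elim exE conjE) (rule that)
  have main: "(\<Sum>V\<in>\<V>. real (card {p\<in>P. p \<in> neighbourhood V (A * \<delta>)}))
      \<le> K * B * incidence_rate d (real n) t \<delta> (card \<V>)"
    if P: "frostman_bound \<delta> t B P" and \<delta>: "0 < \<delta>" "\<delta> < 1" and V: "finite \<V>" "\<V> \<subseteq> affine_planes n"
      "delta_separated plane_dist \<delta> \<V>"
      and g: "\<forall>V\<in>\<V>. V = graph_plane I (\<Theta> V) \<and> (\<forall>k\<in>-I. \<forall>i\<in>I. \<bar>snd (\<Theta> V k) i\<bar> \<le> c)" for P B \<delta> \<V> \<Theta>
  proof -
    let ?Q = "\<lambda>V. {p\<in>P. p \<in> neighbourhood V (A * \<delta>)}"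
    let ?D = "\<lambda>\<theta>. {p\<in>P. \<forall>k\<in>-I. \<bar>defect I \<theta> p k\<bar> \<le> a * \<delta>}"
    have fin: "finite P" "P \<subseteq> cball 0 1" "real (card P) \<le> B" using P by (auto simp: frostman_bound_def)
    have B: "B \<ge> 0" using fin(3) by (meson of_nat_0_le_iff order.trans)
    define \<W> where "\<W> = {V\<in>\<V>. ?Q V \<noteq> {}}"
    have W: "\<W> \<subseteq> \<V>" "finite \<W>" using V(1) by (auto simp: \<W>_def)
    have gV: "V = graph_plane I (\<Theta> V)" "\<forall>k\<in>-I. \<forall>i\<in>I. \<bar>snd (\<Theta> V k) i\<bar> \<le> c" if "V \<in> \<V>" for V
      using g that by auto
    have QD: "?Q V \<subseteq> ?D (\<Theta> V)" if "V \<in> \<V>" for V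
    proof clarify
      fix p k assume p: "p \<in> P" "p \<in> neighbourhood V (A * \<delta>)" and k: "k \<notin> I"
      have "\<bar>defect I (\<Theta> V) p k\<bar> \<le> (1 + real CARD('d) * c) * (A * \<delta>)"
        using gV[OF that] that V(2) p c k by (intro incident_defect_le[where n = n]) auto
      then show "\<bar>defect I (\<Theta> V) p k\<bar> \<le> a * \<delta>" by (simp add: a_def d_def mult.assoc)
    qed
    have bnd: "bounded_params I c2 (\<Theta> V)" if VW: "V \<in> \<W>" for V
    proof -
      obtain p where p: "p \<in> ?Q V" using VW by (auto simp: \<W>_def)
      have "V \<in> \<V>" using VW W by auto
      then have "p \<in> ?D (\<Theta> V)" using p QD by blast
      then have "\<forall>k\<in>-I. \<bar>defect I (\<Theta> V) p k\<bar> \<le> a * \<delta>" by blast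
      moreover have "a * \<delta> \<le> a * 1" using a \<delta> by (intro mult_left_mono) auto
      ultimately have "\<forall>k\<in>-I. \<bar>defect I (\<Theta> V) p k\<bar> \<le> a" by force
      moreover have "norm p \<le> 1" using p fin(2) by auto
      ultimately show ?thesis
        unfolding c2_def d_def using gV(2)[OF \<open>V \<in> \<V>\<close>] c a by (intro incident_bounded_params)
    qed
    have inj: "inj_on \<Theta> \<W>"
    proof (rule inj_onI)
      fix V W' assume VW': "V \<in> \<W>" "W' \<in> \<W>" "\<Theta> V = \<Theta> W'"
      have "V = graph_plane I (\<Theta> V)" using VW' W by (intro gV) auto
      also have "\<dots> = graph_plane I (\<Theta> W')" by (simp only: VW'(3))
      also have "\<dots> = W'" using VW' W by (intro gV(1)[symmetric]) auto
      finally show "V = W'" .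
    qed
    have sep: "separated_params I (2 * (\<kappa> * \<delta>)) (\<Theta> V) (\<Theta> W')"
      if VW': "V \<in> \<W>" "W' \<in> \<W>" "\<Theta> V \<noteq> \<Theta> W'" for V W'
    proof (rule ccontr)
      assume "\<not> ?thesis"
      then have diff: "\<forall>k\<in>-I. \<bar>fst (\<Theta> V k) - fst (\<Theta> W' k)\<bar> \<le> 2 * (\<kappa> * \<delta>)"
        "\<forall>k\<in>-I. \<forall>i\<in>I. \<bar>snd (\<Theta> V k) i - snd (\<Theta> W' k) i\<bar> \<le> 2 * (\<kappa> * \<delta>)"
        by (auto simp: separated_params_def not_le less_imp_le)
      have mem: "V \<in> \<V>" "W' \<in> \<V>" using VW' W by auto
      have "plane_dist (graph_plane I (\<Theta> V)) (graph_plane I (\<Theta> W')) \<le> L * (2 * (\<kappa> * \<delta>))"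
        unfolding L_def d_def
      proof (rule plane_dist_graph_le[OF _ _ bnd[OF VW'(1)] c2 _ diff])
        show "graph_plane I (\<Theta> V) \<in> affine_planes n" "graph_plane I (\<Theta> W') \<in> affine_planes n"
          using gV(1) mem V(2) by auto
        show "0 \<le> 2 * (\<kappa> * \<delta>)" using \<kappa> \<delta> by simp
      qed
      also have "L * (2 * (\<kappa> * \<delta>)) < \<delta>" using L \<delta> by (simp add: \<kappa>_def field_simps)
      finally have "plane_dist V W' < \<delta>" using gV(1)[OF mem(1)] gV(1)[OF mem(2)] by simp
      moreover have "\<delta> \<le> plane_dist V W'" using V(3) mem VW'(3) by (auto simp: delta_separated_def)
      ultimately show False by simp
    qed
    have "(\<Sum>V\<in>\<V>. real (card (?Q V))) = (\<Sum>V\<in>\<W>. real (card (?Q V)))"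
    proof (rule sum.mono_neutral_right[OF V(1) W(1)], rule ballI)
      fix V assume "V \<in> \<V> - \<W>"
      then have "?Q V = {}" unfolding \<W>_def by blast
      then show "real (card (?Q V)) = 0" by (simp only: card.empty of_nat_0)
    qed
    also have "\<dots> \<le> (\<Sum>V\<in>\<W>. real (card (?D (\<Theta> V))))"
      using fin(1) QD W(1) by (intro sum_mono) (auto intro!: card_mono)
    also have "\<dots> = (\<Sum>\<theta>\<in>\<Theta> ` \<W>. real (card (?D \<theta>)))" using inj by (simp add: sum.reindex)
    also have "\<dots> \<le> K * B * incidence_rate d (real n) t \<delta> (card (\<Theta> ` \<W>))"
      unfolding n_def d_def
      by (rule K(2)[rule_format, OF P \<delta>]) (use W(2) bnd sep in \<open>auto simp: separated_family_def\<close>)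
    also have "\<dots> \<le> K * B * incidence_rate d (real n) t \<delta> (card \<V>)"
    proof (intro mult_left_mono incidence_rate_mono)
      have "card (\<Theta> ` \<W>) \<le> card \<W>" using W(2) by (rule card_image_le)
      also have "\<dots> \<le> card \<V>" using W(1) V(1) by (intro card_mono)
      finally show "card (\<Theta> ` \<W>) \<le> card \<V>" .
    qed (use K(1) B t in \<open>auto simp: d_def\<close>)
    finally show ?thesis .
  qed
  show ?thesis
  proof (intro exI[of _ K] conjI allI impI)
    show "0 \<le> K" by (rule K(1))
  qed (rule main; assumption)
qed

text \<open>There are finitely many sets \<open>I\<close> of \<open>n\<close> coordinates, and each plane is assigned one over which it is a
  graph with bounded slopes.\<close>

lemma incidence_bound_fixed_dim:
  fixes A t :: real and n :: nat
  defines "d \<equiv> real CARD('d::finite)"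
  assumes n: "0 < n" "n < CARD('d)" and t: "d - real n < t" "t \<le> d" and A: "A \<ge> 0"
  shows "\<exists>K\<ge>0. \<forall>(P :: (real ^ 'd) set) B \<delta> \<V>. frostman_bound \<delta> t B P \<longrightarrow> 0 < \<delta> \<longrightarrow> \<delta> < 1 \<longrightarrow> finite \<V>
    \<longrightarrow> \<V> \<subseteq> affine_planes n \<longrightarrow> delta_separated plane_dist \<delta> \<V>
    \<longrightarrow> real (card (incidences (A * \<delta>) P \<V>))
      \<le> K * B * incidence_rate d (real n) t \<delta> (card \<V>)"
proof -
  from affine_plane_is_graph[of n, where 'd = 'd]
  obtain c where c: "c \<ge> 0" "\<forall>V :: (real ^ 'd) set. V \<in> affine_planes n \<longrightarrow>
    (\<exists>I \<theta>. card I = n \<and> V = graph_plane I \<theta> \<and> (\<forall>k\<in>-I. \<forall>i\<in>I. \<bar>snd (\<theta> k) i\<bar> \<le> c))"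
    by (elim exE conjE) (rule that)
  let ?chart = "\<lambda>V (I, \<theta>). card I = n \<and> V = graph_plane I \<theta> \<and> (\<forall>k\<in>-I. \<forall>i\<in>I. \<bar>snd (\<theta> k) i\<bar> \<le> c)"
  define chart where "chart V = (SOME I\<theta>. ?chart V I\<theta>)" for V :: "(real ^ 'd) set"
  have chart: "?chart V (chart V)" if "V \<in> affine_planes n" for V
    unfolding chart_def using c(2)[rule_format, OF that] by (intro someI_ex[of "?chart V"]) auto
  define \<I> where "\<I> = {I :: 'd set. card I = n}"
  let ?bound = "\<lambda>I K. 0 \<le> K \<and> (\<forall>P B \<delta> \<V> \<Theta>. frostman_bound \<delta> t B P \<longrightarrow> 0 < \<delta> \<longrightarrow> \<delta> < 1 \<longrightarrow> finite \<V> \<longrightarrow> \<V> \<subseteq> affine_planes n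
    \<longrightarrow> delta_separated plane_dist \<delta> \<V>
    \<longrightarrow> (\<forall>V\<in>\<V>. V = graph_plane I (\<Theta> V) \<and> (\<forall>k\<in>-I. \<forall>i\<in>I. \<bar>snd (\<Theta> V k) i\<bar> \<le> c))
    \<longrightarrow> (\<Sum>V\<in>\<V>. real (card {p\<in>P. p \<in> neighbourhood V (A * \<delta>)}))
      \<le> K * B * incidence_rate d (real n) t \<delta> (card \<V>))"
  have ex: "\<forall>I\<in>\<I>. \<exists>K. ?bound I K"
  proof
    fix I assume "I \<in> \<I>"
    then have I: "card I = n" by (simp add: \<I>_def)
    then have "real (card (- I)) < t" using card_add_card_Compl[of I] t(1) by (simp add: d_def)
    moreover have "I \<noteq> {}" using I n(1) by auto
    ultimately show "\<exists>K. ?bound I K"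
      using incidences_of_graphs[of I t c A] t(2) c(1) A unfolding I d_def by blast
  qed
  from bchoice[OF ex] obtain K where K0: "\<forall>I\<in>\<I>. ?bound I (K I)"
    by (elim exE) (rule that)
  note K = K0[THEN bspec, THEN conjunct1] K0[THEN bspec, THEN conjunct2, rule_format]
  have main: "real (card (incidences (A * \<delta>) P \<V>))
      \<le> (\<Sum>I\<in>\<I>. K I) * B * incidence_rate d (real n) t \<delta> (card \<V>)"
    if P: "frostman_bound \<delta> t B P" and \<delta>: "0 < \<delta>" "\<delta> < 1" and V: "finite \<V>" "\<V> \<subseteq> affine_planes n"
      "delta_separated plane_dist \<delta> \<V>" for P :: "(real ^ 'd) set" and B \<delta> \<V>
  proof -
    let ?N = "\<lambda>V. real (card {p\<in>P. p \<in> neighbourhood V (A * \<delta>)})"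
    let ?R = "\<lambda>\<V>. incidence_rate d (real n) t \<delta> (card \<V>)"
    have fin: "finite P" "real (card P) \<le> B" using P by (auto simp: frostman_bound_def)
    have B: "B \<ge> 0" using fin(2) by (meson of_nat_0_le_iff order.trans)
    have chartV: "card (fst (chart V)) = n \<and> V = graph_plane (fst (chart V)) (snd (chart V))
        \<and> (\<forall>k\<in>-fst (chart V). \<forall>i\<in>fst (chart V). \<bar>snd (snd (chart V) k) i\<bar> \<le> c)" if "V \<in> \<V>" for V
      using chart[OF subsetD[OF V(2) that]] unfolding case_prod_beta .
    have "real (card (incidences (A * \<delta>) P \<V>)) = (\<Sum>V\<in>\<V>. ?N V)"
      using fin(1) V(1) by (simp add: card_incidences)
    also have "\<dots> = (\<Sum>I\<in>\<I>. \<Sum>V\<in>{V\<in>\<V>. fst (chart V) = I}. ?N V)"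
    proof (rule sum.group[symmetric])
      show "(\<lambda>V. fst (chart V)) ` \<V> \<subseteq> \<I>"
        unfolding \<I>_def using chartV[THEN conjunct1] by (intro image_subsetI CollectI)
    qed (use V(1) in auto)
    also have "\<dots> \<le> (\<Sum>I\<in>\<I>. K I * B * ?R \<V>)"
    proof (rule sum_mono)
      fix I assume I: "I \<in> \<I>"
      let ?\<V>I = "{V\<in>\<V>. fst (chart V) = I}"
      have "(\<Sum>V\<in>?\<V>I. ?N V) \<le> K I * B * ?R ?\<V>I"
      proof (rule K(2)[OF I P \<delta>, where \<Theta> = "\<lambda>V. snd (chart V)"])
        fix V assume V': "V \<in> ?\<V>I"
        then have "V \<in> \<V>" "fst (chart V) = I" by auto
        from chartV[OF this(1), unfolded this(2)]
        show "V = graph_plane I (snd (chart V)) \<and> (\<forall>k\<in>-I. \<forall>i\<in>I. \<bar>snd (snd (chart V) k) i\<bar> \<le> c)"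
          by (rule conjunct2)
      qed (use V in \<open>auto simp: delta_separated_def\<close>)
      also have "\<dots> \<le> K I * B * ?R \<V>"
      proof (intro mult_left_mono incidence_rate_mono)
        show "card ?\<V>I \<le> card \<V>" using V(1) by (intro card_mono) auto
      qed (use K(1)[OF I] B t in auto)
      finally show "(\<Sum>V\<in>?\<V>I. ?N V) \<le> K I * B * ?R \<V>" .
    qed
    also have "\<dots> = (\<Sum>I\<in>\<I>. K I) * B * ?R \<V>" by (simp only: sum_distrib_right)
    finally show ?thesis .
  qed
  show ?thesis
  proof (intro exI[of _ "\<Sum>I\<in>\<I>. K I"] conjI allI impI)
    show "0 \<le> (\<Sum>I\<in>\<I>. K I)" using K(1) by (intro sum_nonneg)
  qed (rule main; assumption)
qed

theorem theorem1p12: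
  fixes C t \<epsilon> :: real
  assumes "C \<ge> 1" and "\<epsilon> > 0"
  shows "\<exists>K>0. \<forall>(n::nat) (\<delta>::real) (C\<^sub>F::real) (\<V> :: (real ^ 'd) set set) (P :: (real ^ 'd) set).
    0 < n \<and> n < CARD('d) \<and>
    0 < \<delta> \<and> \<delta> < 1 \<and> C\<^sub>F \<ge> 1 \<and>
    \<V> \<subseteq> affine_planes n \<and> finite \<V> \<and> delta_separated plane_dist \<delta> \<V> \<and>
    P \<subseteq> cball 0 1 \<and> delta_separated dist \<delta> P \<and>
    real CARD('d) - real n < t \<and> t \<le> real CARD('d) \<and> delta_s_set \<delta> t C\<^sub>F P
    \<longrightarrow>
    real (card (incidences (C * \<delta>) P \<V>))
      \<le> K * \<delta> powr (- \<epsilon>) * C\<^sub>F * real (card P)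
          * real (card \<V>) powr (real n / (real CARD('d) + real n - t))
          * \<delta> powr (real n * (t + 1 - real CARD('d)) * (real CARD('d) - real n)
                      / (real CARD('d) + real n - t))"
proof -
  (* The constant must not depend on n, so the constants of the finitely many admissible n are added. *)
  define N where "N = {n. 0 < n \<and> n < CARD('d) \<and> real CARD('d) - real n < t \<and> t \<le> real CARD('d)}"
  have finN: "finite N" by (rule finite_subset[of _ "{..<CARD('d)}"]) (auto simp: N_def)
  (* The constant that relates cardinalities of \<delta>-separated sets to covering numbers. *)
  define c0 where "c0 = real ((2 * CARD('d) + 3) ^ CARD('d))"
  let ?bound = "\<lambda>n K. 0 \<le> K \<and> (\<forall>(P :: (real ^ 'd) set) B \<delta> \<V>. frostman_bound \<delta> t B P \<longrightarrow> 0 < \<delta> \<longrightarrow> \<delta> < 1 \<longrightarrow> finite \<V>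
    \<longrightarrow> \<V> \<subseteq> affine_planes n \<longrightarrow> delta_separated plane_dist \<delta> \<V>
    \<longrightarrow> real (card (incidences (C * \<delta>) P \<V>))
      \<le> K * B * incidence_rate (real CARD('d)) (real n) t \<delta> (card \<V>))"
  have ex: "\<forall>n\<in>N. \<exists>K. ?bound n K"
    using assms(1) by (intro ballI incidence_bound_fixed_dim) (auto simp: N_def)
  from bchoice[OF ex] obtain K where K0: "\<forall>n\<in>N. ?bound n (K n)"
    by (elim exE) (rule that)
  note K = K0[THEN bspec, THEN conjunct1] K0[THEN bspec, THEN conjunct2, rule_format]
  define K' where "K' = 1 + c0 * (\<Sum>n\<in>N. K n)"
  have c0: "c0 \<ge> 0" by (simp add: c0_def)
  have K': "K' > 0" using c0 K(1) by (simp add: K'_def add_pos_nonneg sum_nonneg)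
  have main: "real (card (incidences (C * \<delta>) P \<V>))
      \<le> K' * \<delta> powr (- \<epsilon>) * C\<^sub>F * real (card P)
          * real (card \<V>) powr (real n / (real CARD('d) + real n - t))
          * \<delta> powr (real n * (t + 1 - real CARD('d)) * (real CARD('d) - real n) / (real CARD('d) + real n - t))"
    if h: "0 < n \<and> n < CARD('d) \<and> 0 < \<delta> \<and> \<delta> < 1 \<and> C\<^sub>F \<ge> 1 \<and>
      \<V> \<subseteq> affine_planes n \<and> finite \<V> \<and> delta_separated plane_dist \<delta> \<V> \<and>
      P \<subseteq> cball 0 1 \<and> delta_separated dist \<delta> P \<and>
      real CARD('d) - real n < t \<and> t \<le> real CARD('d) \<and> delta_s_set \<delta> t C\<^sub>F P"
    for n \<delta> C\<^sub>F \<V> and P :: "(real ^ 'd) set"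
  proof -
    let ?R = "real (card \<V>) powr (real n / (real CARD('d) + real n - t))"
    let ?\<Delta> = "\<delta> powr (real n * (t + 1 - real CARD('d)) * (real CARD('d) - real n) / (real CARD('d) + real n - t))"
    have nN: "n \<in> N" using h by (simp add: N_def)
    have CF: "C\<^sub>F \<ge> 1" and \<delta>: "0 < \<delta>" "\<delta> < 1" using h by auto
    have t0: "t \<ge> 0" using h by linarith
    have "frostman_bound \<delta> t (c0 * C\<^sub>F * real (card P)) P"
      unfolding c0_def using h t0 by (intro frostman_bound_of_delta_s_set) auto
    from K(2)[OF nN this, of \<V>] h
    have "real (card (incidences (C * \<delta>) P \<V>)) \<le> K n * (c0 * C\<^sub>F * real (card P)) * ?R * ?\<Delta>"
      by (simp add: incidence_rate_def mult.assoc)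
    also have "\<dots> = (K n * c0) * (C\<^sub>F * real (card P) * ?R * ?\<Delta>)" by (simp only: mult_ac)
    also have "\<dots> \<le> (K' * \<delta> powr (- \<epsilon>)) * (C\<^sub>F * real (card P) * ?R * ?\<Delta>)"
    proof (rule mult_right_mono)
      have "K n \<le> (\<Sum>n\<in>N. K n)" using finN nN K(1) by (intro member_le_sum) auto
      then have "c0 * K n \<le> c0 * (\<Sum>n\<in>N. K n)" using c0 by (rule mult_left_mono)
      then have "K n * c0 \<le> K'" by (simp add: K'_def mult.commute)
      also have "K' * 1 \<le> K' * \<delta> powr (- \<epsilon>)"
        using K' \<delta> assms(2) powr_le1[of "\<epsilon>" \<delta>] by (intro mult_left_mono) (auto simp: powr_minus_divide)
      finally show "K n * c0 \<le> K' * \<delta> powr (- \<epsilon>)" by simp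
    qed (use CF in simp)
    finally show ?thesis by (simp only: mult_ac)
  qed
  show ?thesis by (intro exI[of _ K'] conjI[OF K'] allI impI main)
qed

end
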